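(* Let $r>0$, $p\in(0,1)$ and let the prior be $\mu=p\,\delta_r+(1-p)\,\delta_{-r}$. Let $\mathcal{C}$ and $\mathcal{D}$ be the continuation region and the stopping region of the problem of optimally stopping a Brownian bridge with unknown pinning point with prior $\mu$. Then: (i) For every $\epsilon>0$ there exists $\delta>0$ such that $(1-\delta,1)\times(\epsilon,r-\epsilon)\subseteq\mathcal{C}$. (ii) For all $z\in(-r,0)$ and all $\epsilon>0$, $\big([1-\epsilon,1)\times(z-\epsilon,z+\epsilon)\big)\cap\mathcal{D}\neq\emptyset$.
   Context: For $(t,z)\in[0,1)\times\mathbb{R}$ let $$\pi(t,z):=\frac{\frac{p}{1-p}e^{\frac{2rz}{1-t}}}{\frac{p}{1-p}e^{\frac{2rz}{1-t}}+1}.$$ The posterior distribution is $\mu_{t,z}=\pi(t,z)\delta_r+(1-\pi(t,z))\delta_{-r}$, with mean $h(t,z)=r(2\pi(t,z)-1)$. The process $Z^{t,z}$ is the solution of $$dZ_{t+s}=\frac{h(t+s,Z_{t+s})-Z_{t+s}}{1-(t+s)}\,ds+d\hat W_{t+s},\quad0\le s<1-t,\qquad Z_t=z,$$ with $\hat W$ a standard Brownian motion, extended to time $1$ by its a.s. limit; equivalently, in law, it is a Brownian bridge started at time $t$ from $z$ whose (unknown) pinning point at time $1$ has distribution $\mu_{t,z}$. The value function is $$v(t,z)=\sup_{\tau\in\mathcal{T}^Z_{1-t}}\mathbb{E}[Z^{t,z}_{t+\tau}],\qquad(t,z)\in[0,1)\times\mathbb{R},$$ where $\mathcal{T}^Z_{1-t}$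 is the set of $[0,1-t]$-valued stopping times with respect to the filtration generated by $s\mapsto Z^{t,z}_{t+s}$. The continuation region is $\mathcal{C}:=\{(t,z)\in[0,1)\times\mathbb{R}:v(t,z)>z\}$ and the stopping region is $\mathcal{D}:=([0,1]\times\mathbb{R})\setminus\mathcal{C}$. *)

theory Defs
  imports "HOL-Probability.Probability"
begin

definition two_point_pmf :: "real \<Rightarrow> real \<Rightarrow> real pmf" where
  "two_point_pmf r q = map_pmf (\<lambda>b. if b then r else - r) (bernoulli_pmf q)"

definition post_weight :: "real \<Rightarrow> real \<Rightarrow> real \<Rightarrow> real \<Rightarrow> real" where
  "post_weight r p t z =
     (p / (1 - p) * exp (2 * r * z / (1 - t))) / (p / (1 - p) * exp (2 * r * z / (1 - t)) + 1)"

text \<open>The law of the pinning point given that the bridge with prior \<open>two_point_pmf r p\<close>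
  is at \<open>z\<close> at time \<open>t\<close>.\<close>

definition posterior :: "real \<Rightarrow> real \<Rightarrow> real \<Rightarrow> real \<Rightarrow> real pmf" where
  "posterior r p t z = two_point_pmf r (post_weight r p t z)"

definition post_mean :: "real \<Rightarrow> real \<Rightarrow> real \<Rightarrow> real \<Rightarrow> real" where
  "post_mean r p t z = measure_pmf.expectation (posterior r p t z) (\<lambda>x. x)"

lemma post_weight_bounds:
  assumes "0 < p" "p < 1"
  shows "0 < post_weight r p t z" "post_weight r p t z < 1"
proof -
  have "0 < p / (1 - p) * exp (2 * r * z / (1 - t))"
    using assms by simp
  then show "0 < post_weight r p t z" "post_weight r p t z < 1"
    unfolding post_weight_def by (simp_all only: divide_simps) auto
qed

lemma post_mean_eq:
  assumes "0 < p" "p < 1"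
  shows "post_mean r p t z = r * (2 * post_weight r p t z - 1)"
  using post_weight_bounds[OF assms, of r t z]
  by (simp add: post_mean_def posterior_def two_point_pmf_def algebra_simps)

lemma posterior_initial:
  assumes "0 < p" "p < 1"
  shows "posterior r p 0 0 = two_point_pmf r p"
proof -
  have "p / (1 - p) + 1 = 1 / (1 - p)"
    using assms by (simp add: divide_simps)
  then have "post_weight r p 0 0 = p"
    using assms by (simp add: post_weight_def)
  then show ?thesis
    by (simp add: posterior_def)
qed

text \<open>Standard Brownian motion on \<open>[0, \<infinity>)\<close> relative to a filtration \<open>F\<close>;
  the values of \<open>F\<close> and \<open>W\<close> at negative times play no role.\<close>

definition brownian_motion :: "'a measure \<Rightarrow> (real \<Rightarrow> 'a measure) \<Rightarrow> (real \<Rightarrow> 'a \<Rightarrow> real) \<Rightarrow> bool" where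
  "brownian_motion M F W \<longleftrightarrow>
     prob_space M \<and>
     filtration (space M) F \<and> (\<forall>s. sets (F s) \<subseteq> sets M) \<and>
     (\<forall>s\<ge>0. W s \<in> borel_measurable (F s)) \<and>
     (AE \<omega> in M. W 0 \<omega> = 0) \<and>
     (\<forall>\<omega>\<in>space M. continuous_on {0..} (\<lambda>s. W s \<omega>)) \<and>
     (\<forall>s u. 0 \<le> s \<and> s < u \<longrightarrow>
        distributed M lborel (\<lambda>\<omega>. W u \<omega> - W s \<omega>) (normal_density 0 (sqrt (u - s))) \<and>
        prob_space.indep_set M (sets (F s))
          (sets (vimage_algebra (space M) (\<lambda>\<omega>. W u \<omega> - W s \<omega>) borel)))"

text \<open>\<open>Z u\<close>, for \<open>u \<in> [t, 1]\<close>, is the process at absolute time \<open>u\<close>, whereas \<open>F\<close> and \<open>W\<close>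
  are indexed by the time elapsed since \<open>t\<close>. The noise in the equation is additive, so it is
  the pathwise integral equation below; at \<open>s = 0\<close> it gives the initial condition
  \<open>Z t = z\<close> almost surely.\<close>

definition bridge_solution ::
  "real \<Rightarrow> real \<Rightarrow> real \<Rightarrow> real \<Rightarrow>
   'a measure \<Rightarrow> (real \<Rightarrow> 'a measure) \<Rightarrow> (real \<Rightarrow> 'a \<Rightarrow> real) \<Rightarrow> (real \<Rightarrow> 'a \<Rightarrow> real) \<Rightarrow> bool" where
  "bridge_solution r p t z M F W Z \<longleftrightarrow>
     brownian_motion M F W \<and>
     (\<forall>s\<in>{0..<1 - t}. Z (t + s) \<in> borel_measurable (F s)) \<and>
     (\<forall>\<omega>\<in>space M. continuous_on {t..<1} (\<lambda>u. Z u \<omega>)) \<and>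
     (AE \<omega> in M. \<forall>s\<in>{0..<1 - t}.
        Z (t + s) \<omega> =
          z + integral {0..s} (\<lambda>u. (post_mean r p (t + u) (Z (t + u) \<omega>) - Z (t + u) \<omega>) / (1 - (t + u)))
            + W s \<omega>) \<and>
     Z 1 \<in> borel_measurable M \<and>
     (AE \<omega> in M. ((\<lambda>u. Z u \<omega>) \<longlongrightarrow> Z 1 \<omega>) (at_left 1))"

definition natural_filtration :: "'a measure \<Rightarrow> (real \<Rightarrow> 'a \<Rightarrow> real) \<Rightarrow> real \<Rightarrow> 'a measure" where
  "natural_filtration M X s =
     sigma (space M) (\<Union>u\<in>{0..s}. {X u -` A \<inter> space M | A. A \<in> sets borel})"

definition stopping_times :: "'a measure \<Rightarrow> (real \<Rightarrow> 'a \<Rightarrow> real) \<Rightarrow> real \<Rightarrow> ('a \<Rightarrow> real) set" where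
  "stopping_times M Z t =
     {\<tau>. stopping_time (natural_filtration M (\<lambda>s. Z (t + s))) \<tau> \<and>
         (\<forall>\<omega>\<in>space M. \<tau> \<omega> \<in> {0..1 - t})}"

text \<open>From here on \<open>M t z\<close> and \<open>Z t z\<close> are the probability space and the process started at
  time \<open>t\<close> from \<open>z\<close>. The supremum is taken in the extended reals, so that boundedness of the
  set of expectations is not presupposed.\<close>

definition value_function ::
  "(real \<Rightarrow> real \<Rightarrow> 'a measure) \<Rightarrow> (real \<Rightarrow> real \<Rightarrow> real \<Rightarrow> 'a \<Rightarrow> real) \<Rightarrow> real \<Rightarrow> real \<Rightarrow> ereal" where
  "value_function M Z t z =
     (SUP \<tau>\<in>stopping_times (M t z) (Z t z) t. ereal (\<integral>\<omega>. Z t z (t + \<tau> \<omega>) \<omega> \<partial>M t z))"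

definition continuation_region ::
  "(real \<Rightarrow> real \<Rightarrow> 'a measure) \<Rightarrow> (real \<Rightarrow> real \<Rightarrow> real \<Rightarrow> 'a \<Rightarrow> real) \<Rightarrow> (real \<times> real) set" where
  "continuation_region M Z = {(t, z). t \<in> {0..<1} \<and> value_function M Z t z > ereal z}"

definition stopping_region ::
  "(real \<Rightarrow> real \<Rightarrow> 'a measure) \<Rightarrow> (real \<Rightarrow> real \<Rightarrow> real \<Rightarrow> 'a \<Rightarrow> real) \<Rightarrow> (real \<times> real) set" where
  "stopping_region M Z = ({0..1} \<times> UNIV) - continuation_region M Z"

end

theory Submission
  imports Defs
begin

text \<open>Every expectation is computed without Ito calculus: for an equation with additive noise and
  Lipschitz drift, Gronwall's inequality gives second moments, and a Taylor expansion over a step of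
  length \<open>\<delta>\<close> is correct in mean up to an error of order \<open>\<delta>\<^bsup>3/2\<^esup>\<close>, even on an event known at the
  start of the step. Summed over \<open>1 / \<delta>\<close> steps these errors vanish, so supersolutions are
  supermartingales along stopping times.

  Part (i): near the terminal time the posterior mean exceeds \<open>z\<close>, so the drift is positive and it pays
  to wait for a short deterministic time.

  Part (ii): for \<open>z \<in> (-r, 0)\<close> and \<open>t\<close> close to \<open>1\<close> there is a supersolution that dominates the gain
  \<open>x\<close> and equals it at \<open>(t, z)\<close>; hence \<open>(t, z)\<close> itself is a stopping point. It is the minimum of a
  convex function that coincides with the gain on an interval ending in \<open>z\<close>, and of a function that
  exceeds \<open>r\<close> everywhere. The former is a supersolution only for \<open>x \<le> z / 2\<close>, where the posterior
  weight of \<open>r\<close> is exponentially small in \<open>1 / (1 - t)\<close>, but it is already above the latter for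
  \<open>x \<ge> z / 2\<close>.\<close>

section \<open>Time integrals of continuous processes\<close>

text \<open>The drift is singular at the terminal time, so the moment and Taylor constants exist
  only on an interval \<open>{0..S}\<close> with \<open>t + S < 1\<close> and may blow up with
  \<open>S\<close>. Stopping is therefore estimated on such intervals, the number of grid steps
  being chosen after \<open>S\<close>, and is carried to the terminal time by Fatou's lemma. Fatou
  needs integrands bounded below, which the gain is not; it is replaced by
  \<open>max x (- r)\<close>, which the barrier still dominates. Integrability of the stopped value
  is a separate issue: the integral of a nonintegrable function is 0 by convention, and for
  \<open>z < 0\<close> this would count as better than stopping at once. A second supersolution,
  dominating the absolute value of the gain, excludes it. A supersolution carries one constant
  \<Gamma> instead of a second derivative. Then the quadratic term has to be centred only on events,
  and no third derivatives occur, so that piecewise quadratic functions can be used.\<close>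

lemma joint_measurable_continuous_process:
  fixes f :: "real \<Rightarrow> 'a \<Rightarrow> real"
  assumes meas: "\<And>u. u \<in> {a..b} \<Longrightarrow> f u \<in> borel_measurable M"
    and cont: "\<And>\<omega>. \<omega> \<in> space M \<Longrightarrow> continuous_on {a..b} (\<lambda>u. f u \<omega>)"
    and "a \<le> b"
  shows "(\<lambda>(u, \<omega>). indicator {a..b} u * f u \<omega>) \<in> borel_measurable (lborel \<Otimes>\<^sub>M M)"
proof -
  \<comment> \<open>Rounding down may leave \<open>{a..b}\<close> on the left, where neither
    measurability nor continuity is assumed; clamping returns to the interval and keeps the
    limit.\<close>
  define cl where "cl u = max a (min b u)" for u
  have cl: "cl u \<in> {a..b}" for u using \<open>a \<le> b\<close> by (auto simp: cl_def)
  \<comment> \<open>Rounded times take countably many values, so the process at a rounded time is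
    jointly measurable; continuity in time passes this on to the limit.\<close>
  define q where "q n u = real_of_int \<lfloor>real (Suc n) * u\<rfloor> / real (Suc n)" for n u
  have q_lim: "(\<lambda>n. q n u) \<longlonglongrightarrow> u" for u
  proof (rule tendsto_sandwich[where f="\<lambda>n. u - inverse (real (Suc n))" and h="\<lambda>n. u"])
    show "\<forall>\<^sub>F n in sequentially. u - inverse (real (Suc n)) \<le> q n u"
    proof (intro always_eventually allI)
      fix n
      have "real (Suc n) * u - 1 \<le> real_of_int \<lfloor>real (Suc n) * u\<rfloor>" by linarith
      then have "(real (Suc n) * u - 1) / real (Suc n) \<le> q n u"
        unfolding q_def by (intro divide_right_mono) auto
      moreover have "(real (Suc n) * u - 1) / real (Suc n) = u - inverse (real (Suc n))"
        by (simp add: field_simps)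
      ultimately show "u - inverse (real (Suc n)) \<le> q n u" by simp
    qed
    show "\<forall>\<^sub>F n in sequentially. q n u \<le> u"
      by (intro always_eventually allI) (simp add: q_def divide_simps, simp add: mult.commute)
    show "(\<lambda>n. u - inverse (real (Suc n))) \<longlonglongrightarrow> u"
      using tendsto_diff[OF tendsto_const[of u] LIMSEQ_inverse_real_of_nat] by simp
  qed simp
  have "(\<lambda>x. f (cl (fst x)) (snd x)) \<in> borel_measurable (lborel \<Otimes>\<^sub>M M)"
  proof (rule borel_measurable_LIMSEQ_metric)
    fix n
    have "(\<lambda>x. f (cl (real_of_int i / real (Suc n))) (snd x)) \<in> borel_measurable (lborel \<Otimes>\<^sub>M M)" for i
      by (rule measurable_compose[OF measurable_snd meas[OF cl]])
    then show "(\<lambda>x. f (cl (q n (fst x))) (snd x)) \<in> borel_measurable (lborel \<Otimes>\<^sub>M M)"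
      unfolding q_def
      by (rule measurable_compose_countable[where f="\<lambda>i x. f (cl (real_of_int i / real (Suc n))) (snd x)"])
        measurable
  next
    fix x :: "real \<times> 'a" assume "x \<in> space (lborel \<Otimes>\<^sub>M M)"
    then have sp: "snd x \<in> space M" by (auto simp: space_pair_measure)
    have "(\<lambda>n. cl (q n (fst x))) \<longlonglongrightarrow> cl (fst x)"
      unfolding cl_def by (intro tendsto_intros q_lim)
    then show "(\<lambda>n. f (cl (q n (fst x))) (snd x)) \<longlonglongrightarrow> f (cl (fst x)) (snd x)"
      using cl by (intro continuous_on_tendsto_compose[OF cont[OF sp]]) auto
  qed
  then have "(\<lambda>x. indicator {a..b} (fst x) * f (cl (fst x)) (snd x)) \<in> borel_measurable (lborel \<Otimes>\<^sub>M M)"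
    by measurable
  also have "(\<lambda>x. indicator {a..b} (fst x) * f (cl (fst x)) (snd x)) = (\<lambda>(u, \<omega>). indicator {a..b} u * f u \<omega>)"
    by (auto simp: fun_eq_iff indicator_def cl_def)
  finally show ?thesis .
qed

text \<open>Fubini's theorem, made available by the joint measurability of continuous
  processes.\<close>

lemma (in prob_space) time_integral_bound:
  fixes f :: "real \<Rightarrow> 'a \<Rightarrow> real"
  assumes int: "\<And>u. u \<in> {a..b} \<Longrightarrow> integrable M (f u)"
    and cont: "\<And>\<omega>. \<omega> \<in> space M \<Longrightarrow> continuous_on {a..b} (\<lambda>u. f u \<omega>)"
    and bnd: "\<And>u. u \<in> {a..b} \<Longrightarrow> expectation (\<lambda>\<omega>. \<bar>f u \<omega>\<bar>) \<le> c"
    and "a \<le> b"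
  shows "integrable M (\<lambda>\<omega>. integral {a..b} (\<lambda>u. f u \<omega>))"
    and "expectation (\<lambda>\<omega>. \<bar>integral {a..b} (\<lambda>u. f u \<omega>)\<bar>) \<le> (b - a) * c"
proof -
  interpret P: pair_sigma_finite lborel M ..
  define g where "g = (\<lambda>u \<omega>. indicator {a..b} u * f u \<omega>)"
  have g_meas [measurable]: "case_prod g \<in> borel_measurable (lborel \<Otimes>\<^sub>M M)"
    unfolding g_def using int \<open>a \<le> b\<close>
    by (intro joint_measurable_continuous_process cont) auto
  have g_int: "integrable M (g u)" for u
    using int[of u] by (cases "u \<in> {a..b}") (auto simp: g_def)
  have c0: "0 \<le> c" using order_trans[OF _ bnd[of a]] \<open>a \<le> b\<close> by (auto intro: integral_nonneg)
  have g_bnd: "expectation (\<lambda>\<omega>. \<bar>g u \<omega>\<bar>) \<le> indicator {a..b} u * c" for u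
    using bnd[of u] c0 by (cases "u \<in> {a..b}") (auto simp: g_def)
  have ci: "integrable lborel (\<lambda>u. indicator {a..b} u * c)"
    using \<open>a \<le> b\<close> by (intro integrable_mult_left) (auto intro!: integrable_real_indicator)
  have abs_int: "integrable lborel (\<lambda>u. expectation (\<lambda>\<omega>. \<bar>g u \<omega>\<bar>))"
    by (rule Bochner_Integration.integrable_bound[OF ci])
      (use g_bnd in \<open>auto intro!: AE_I2 order_trans[OF _ abs_ge_self]\<close>)
  have int_g: "integrable (lborel \<Otimes>\<^sub>M M) (case_prod g)"
    by (rule P.Fubini_integrable) (use abs_int g_int in auto)
  have eq: "(LINT u|lborel. g u \<omega>) = integral {a..b} (\<lambda>u. f u \<omega>)" if "\<omega> \<in> space M" for \<omega>
    using set_borel_integral_eq_integral(2)[OF borel_integrable_atLeastAtMost'[OF cont[OF that]]]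
    by (simp add: set_lebesgue_integral_def g_def)
  show "integrable M (\<lambda>\<omega>. integral {a..b} (\<lambda>u. f u \<omega>))"
    using P.integrable_snd[OF int_g] eq by (auto cong: Bochner_Integration.integrable_cong)
  have int_ag: "integrable (lborel \<Otimes>\<^sub>M M) (\<lambda>(u, \<omega>). \<bar>g u \<omega>\<bar>)"
    using integrable_abs[OF int_g] by (simp add: case_prod_unfold)
  have "expectation (\<lambda>\<omega>. \<bar>integral {a..b} (\<lambda>u. f u \<omega>)\<bar>) = expectation (\<lambda>\<omega>. \<bar>LINT u|lborel. g u \<omega>\<bar>)"
    by (intro Bochner_Integration.integral_cong) (auto simp: eq)
  also have "\<dots> \<le> expectation (\<lambda>\<omega>. LINT u|lborel. \<bar>g u \<omega>\<bar>)"
    using P.integrable_snd[OF int_g] P.integrable_snd[OF int_ag]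
    by (intro integral_mono) auto
  also have "\<dots> = (LINT u|lborel. expectation (\<lambda>\<omega>. \<bar>g u \<omega>\<bar>))"
    by (rule P.Fubini_integral[OF int_ag])
  also have "\<dots> \<le> (LINT u|lborel. indicator {a..b} u * c)"
    by (intro integral_mono abs_int ci g_bnd)
  also have "\<dots> = (b - a) * c"
    using \<open>a \<le> b\<close> by simp
  finally show "expectation (\<lambda>\<omega>. \<bar>integral {a..b} (\<lambda>u. f u \<omega>)\<bar>) \<le> (b - a) * c" .
qed

text \<open>Cauchy-Schwarz against the constant 1: the integral of \<open>(f u - m)^2\<close> about
  the mean value \<open>m\<close> is nonnegative.\<close>

lemma integral_square_le:
  fixes f :: "real \<Rightarrow> real"
  assumes "continuous_on {a..b} f" "a \<le> b"
  shows "(integral {a..b} f)\<^sup>2 \<le> (b - a) * integral {a..b} (\<lambda>u. (f u)\<^sup>2)"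
proof (cases "a = b")
  case False
  then have ab: "0 < b - a" using assms by simp
  define m where "m = integral {a..b} f / (b - a)"
  have "0 \<le> integral {a..b} (\<lambda>u. (f u - m)\<^sup>2)"
    by (intro integral_nonneg integrable_continuous_interval continuous_intros assms) auto
  also have "\<dots> = integral {a..b} (\<lambda>u. (f u)\<^sup>2 - 2 * m * f u + m\<^sup>2)"
    by (simp add: power2_diff algebra_simps)
  also have "\<dots> = integral {a..b} (\<lambda>u. (f u)\<^sup>2) - 2 * m * integral {a..b} f + (b - a) * m\<^sup>2"
    using \<open>a \<le> b\<close>
    by (subst integral_add integral_diff;
        (intro integrable_continuous_interval continuous_intros assms)?)+ simp
  finally have "0 \<le> (b - a) * (integral {a..b} (\<lambda>u. (f u)\<^sup>2) - 2 * m * integral {a..b} f + (b - a) * m\<^sup>2)"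
    using ab by simp
  also have "\<dots> = (b - a) * integral {a..b} (\<lambda>u. (f u)\<^sup>2)
      - 2 * ((b - a) * m) * integral {a..b} f + ((b - a) * m)\<^sup>2"
    by (simp add: power2_eq_square algebra_simps)
  also have "(b - a) * m = integral {a..b} f"
    using ab by (simp add: m_def)
  finally show ?thesis by (simp add: power2_eq_square)
qed simp

lemma (in prob_space) time_integral_square_bound:
  fixes f :: "real \<Rightarrow> 'a \<Rightarrow> real"
  assumes meas: "\<And>u. u \<in> {a..b} \<Longrightarrow> f u \<in> borel_measurable M"
    and int: "\<And>u. u \<in> {a..b} \<Longrightarrow> integrable M (\<lambda>\<omega>. (f u \<omega>)\<^sup>2)"
    and cont: "\<And>\<omega>. \<omega> \<in> space M \<Longrightarrow> continuous_on {a..b} (\<lambda>u. f u \<omega>)"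
    and bnd: "\<And>u. u \<in> {a..b} \<Longrightarrow> expectation (\<lambda>\<omega>. (f u \<omega>)\<^sup>2) \<le> c"
    and "a \<le> b"
  shows "integrable M (\<lambda>\<omega>. (integral {a..b} (\<lambda>u. f u \<omega>))\<^sup>2)"
    and "expectation (\<lambda>\<omega>. (integral {a..b} (\<lambda>u. f u \<omega>))\<^sup>2) \<le> (b - a)\<^sup>2 * c"
    and "(\<lambda>\<omega>. integral {a..b} (\<lambda>u. f u \<omega>)) \<in> borel_measurable M"
proof -
  have abs_le: "\<bar>y\<bar> \<le> 1 + y\<^sup>2" for y :: real
    using sum_squares_bound[of "\<bar>y\<bar>" 1] by simp
  have le: "(integral {a..b} (\<lambda>u. f u \<omega>))\<^sup>2 \<le> (b - a) * integral {a..b} (\<lambda>u. (f u \<omega>)\<^sup>2)"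
    if "\<omega> \<in> space M" for \<omega>
    using integral_square_le[OF cont[OF that] \<open>a \<le> b\<close>] .
  have f_int: "integrable M (f u)" if "u \<in> {a..b}" for u
    using int[OF that] meas[OF that]
    by (intro Bochner_Integration.integrable_bound[where f="\<lambda>\<omega>. 1 + (f u \<omega>)\<^sup>2" and g="f u"])
      (auto intro!: AE_I2 abs_le)
  have f_abs: "expectation (\<lambda>\<omega>. \<bar>f u \<omega>\<bar>) \<le> 1 + c" if "u \<in> {a..b}" for u
  proof -
    have "expectation (\<lambda>\<omega>. \<bar>f u \<omega>\<bar>) \<le> expectation (\<lambda>\<omega>. 1 + (f u \<omega>)\<^sup>2)"
      using f_int[OF that] int[OF that] by (intro integral_mono) (auto intro: abs_le)
    also have "\<dots> \<le> 1 + c" using int[OF that] bnd[OF that] by (simp add: prob_space)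
    finally show ?thesis .
  qed
  show meas_I: "(\<lambda>\<omega>. integral {a..b} (\<lambda>u. f u \<omega>)) \<in> borel_measurable M"
    using time_integral_bound(1)[OF f_int cont f_abs \<open>a \<le> b\<close>] by (rule borel_measurable_integrable)
  have sq: "integrable M (\<lambda>\<omega>. integral {a..b} (\<lambda>u. (f u \<omega>)\<^sup>2))"
    "expectation (\<lambda>\<omega>. \<bar>integral {a..b} (\<lambda>u. (f u \<omega>)\<^sup>2)\<bar>) \<le> (b - a) * c"
    by (rule time_integral_bound[of a b "\<lambda>u \<omega>. (f u \<omega>)\<^sup>2" c];
        use int cont bnd \<open>a \<le> b\<close> in \<open>auto intro!: continuous_on_power\<close>)+
  show I: "integrable M (\<lambda>\<omega>. (integral {a..b} (\<lambda>u. f u \<omega>))\<^sup>2)"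
    by (rule Bochner_Integration.integrable_bound[OF integrable_mult_right[OF sq(1), of "b - a"]])
      (use meas_I le in \<open>auto intro!: AE_I2 order_trans[OF _ abs_ge_self]\<close>)
  have "expectation (\<lambda>\<omega>. (integral {a..b} (\<lambda>u. f u \<omega>))\<^sup>2)
      \<le> expectation (\<lambda>\<omega>. (b - a) * \<bar>integral {a..b} (\<lambda>u. (f u \<omega>)\<^sup>2)\<bar>)"
    using I sq(1) \<open>a \<le> b\<close>
    by (intro integral_mono) (auto intro!: order_trans[OF le] mult_left_mono)
  also have "\<dots> \<le> (b - a) * ((b - a) * c)"
    using sq(2) \<open>a \<le> b\<close> by (simp add: mult_left_mono)
  finally show "expectation (\<lambda>\<omega>. (integral {a..b} (\<lambda>u. f u \<omega>))\<^sup>2) \<le> (b - a)\<^sup>2 * c"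
    by (simp add: power2_eq_square algebra_simps)
qed

text \<open>The difference \<open>exp (- L * s) * integral {0..s} \<phi> - integral {0..s} a\<close>
  is nonincreasing in \<open>s\<close>. The final bound does not depend on \<open>s\<close>; applied
  to paths, it provides a single random variable that controls all times.\<close>

lemma gronwall_time_integral:
  fixes \<phi> a :: "real \<Rightarrow> real"
  assumes \<phi>: "continuous_on {0..S} \<phi>" and a: "continuous_on {0..S} a"
    and a0: "\<And>s. s \<in> {0..S} \<Longrightarrow> 0 \<le> a s"
    and "0 \<le> L" and s: "s \<in> {0..S}"
    and le: "\<And>s. s \<in> {0..S} \<Longrightarrow> \<phi> s \<le> a s + L * integral {0..s} \<phi>"
  shows "integral {0..s} \<phi> \<le> exp (L * S) * integral {0..S} a"
proof -
  define G where "G s = exp (- L * s) * integral {0..s} \<phi> - integral {0..s} a" for s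
  have G': "(G has_real_derivative
      (exp (- L * u) * (\<phi> u - L * integral {0..u} \<phi>) - a u)) (at u within {0..S})"
    if "u \<in> {0..S}" for u
    unfolding G_def using that
    by (auto intro!: derivative_eq_intros integral_has_real_derivative[OF \<phi>]
        integral_has_real_derivative[OF a] simp: algebra_simps)
  have "G s \<le> G 0"
  proof (rule DERIV_nonpos_imp_decreasing_open[where f=G])
    show "0 \<le> s" using s by simp
    show "continuous_on {0..s} G"
      using s by (intro continuous_on_subset[OF DERIV_continuous_on[OF G'], of "{0..s}"]) auto
    fix u assume u: "0 < u" "u < s"
    with s have "u \<in> {0..S}" by auto
    have "exp (- L * u) * (\<phi> u - L * integral {0..u} \<phi>) \<le> 1 * a u"
    proof -
      have "exp (- L * u) * (\<phi> u - L * integral {0..u} \<phi>) \<le> exp (- L * u) * a u"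
        using le[OF \<open>u \<in> {0..S}\<close>] by (intro mult_left_mono) auto
      also have "\<dots> \<le> 1 * a u"
        using u \<open>0 \<le> L\<close> a0[OF \<open>u \<in> {0..S}\<close>] by (intro mult_right_mono) auto
      finally show ?thesis .
    qed
    moreover have "(G has_real_derivative
      (exp (- L * u) * (\<phi> u - L * integral {0..u} \<phi>) - a u)) (at u)"
      using has_field_derivative_subset[OF G'[OF \<open>u \<in> {0..S}\<close>] greaterThanLessThan_subseteq_atLeastAtMost_iff[THEN iffD2, of 0 S 0 S]] u s
        at_within_open[of u "{0<..<S}"] by auto
    ultimately show "\<exists>y. (G has_real_derivative y) (at u) \<and> y \<le> 0" by auto
  qed
  then have "exp (- L * s) * integral {0..s} \<phi> \<le> integral {0..s} a" by (simp add: G_def)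
  then have "exp (L * s) * (exp (- L * s) * integral {0..s} \<phi>) \<le> exp (L * s) * integral {0..s} a"
    by (rule mult_left_mono) simp
  then have "integral {0..s} \<phi> \<le> exp (L * s) * integral {0..s} a"
    by (simp add: mult.assoc[symmetric] exp_add[symmetric])
  also have "\<dots> \<le> exp (L * S) * integral {0..S} a"
  proof (rule mult_mono)
    show "exp (L * s) \<le> exp (L * S)" using s \<open>0 \<le> L\<close> by (simp add: mult_left_mono)
    show "integral {0..s} a \<le> integral {0..S} a"
      using s a0 by (intro integral_subset_le integrable_continuous_interval
          continuous_on_subset[OF a]) auto
    show "0 \<le> integral {0..s} a"
      using s a0 by (intro integral_nonneg integrable_continuous_interval
          continuous_on_subset[OF a]) auto
  qed auto
  finally show ?thesis .
qed

section \<open>Equations with additive noise and Lipschitz drift\<close>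

text \<open>The horizon \<open>S\<close> will stay short of the terminal time. In
  \<open>lipschitz\<close> the time modulus grows linearly in \<open>x\<close>, as it must for a
  drift containing \<open>x / (1 - (t + s))\<close>; the weight is taken at the earlier time, whose
  state is known to \<open>F s\<close>.\<close>

locale lipschitz_sde = prob_space M for M :: "'a measure" +
  fixes F :: "real \<Rightarrow> 'a measure" and W X :: "real \<Rightarrow> 'a \<Rightarrow> real"
    and b :: "real \<Rightarrow> real \<Rightarrow> real" and S L z :: real
  assumes bm: "brownian_motion M F W"
    and S_pos: "0 < S" and L_nonneg: "0 \<le> L"
    and adapted: "s \<in> {0..S} \<Longrightarrow> X s \<in> borel_measurable (F s)"
    and cont: "\<omega> \<in> space M \<Longrightarrow> continuous_on {0..S} (\<lambda>s. X s \<omega>)"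
    and sde: "AE \<omega> in M. \<forall>s\<in>{0..S}. X s \<omega> = z + integral {0..s} (\<lambda>u. b u (X u \<omega>)) + W s \<omega>"
    and growth: "s \<in> {0..S} \<Longrightarrow> \<bar>b s x\<bar> \<le> L * (1 + \<bar>x\<bar>)"
    and lipschitz: "0 \<le> s \<Longrightarrow> s \<le> u \<Longrightarrow> u \<le> S \<Longrightarrow>
      \<bar>b u y - b s x\<bar> \<le> L * (\<bar>y - x\<bar> + (u - s) * (1 + \<bar>x\<bar>))"
begin

text \<open>Up to a constant, the common majorant of the drift and of the slopes of supersolutions;
  multipliers below it are admissible in \<open>first_order_estimate\<close>.\<close>

definition H :: "real \<Rightarrow> 'a \<Rightarrow> real" where "H s \<omega> = 1 + \<bar>X s \<omega>\<bar>"

lemma H_ge_1: "1 \<le> H s \<omega>" by (simp add: H_def)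

lemma sets_F_subset: "sets (F s) \<subseteq> sets M"
  and space_F: "space (F s) = space M"
  and W_adapted: "0 \<le> s \<Longrightarrow> W s \<in> borel_measurable (F s)"
  and W_0: "AE \<omega> in M. W 0 \<omega> = 0"
  and W_cont: "\<omega> \<in> space M \<Longrightarrow> continuous_on {0..} (\<lambda>s. W s \<omega>)"
  and W_normal: "0 \<le> s \<Longrightarrow> s < u \<Longrightarrow>
    distributed M lborel (\<lambda>\<omega>. W u \<omega> - W s \<omega>) (normal_density 0 (sqrt (u - s)))"
  and W_indep: "0 \<le> s \<Longrightarrow> s < u \<Longrightarrow>
    indep_set (sets (F s)) (sets (vimage_algebra (space M) (\<lambda>\<omega>. W u \<omega> - W s \<omega>) borel))"
  using bm by (auto simp: brownian_motion_def filtration_def)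

lemma F_measurable: "f \<in> borel_measurable (F s) \<Longrightarrow> f \<in> borel_measurable M"
  using sets_F_subset[of s] space_F[of s] by (auto simp: measurable_def)

lemma W_measurable: "0 \<le> s \<Longrightarrow> W s \<in> borel_measurable M"
  using W_adapted F_measurable by blast

lemma X_measurable: "s \<in> {0..S} \<Longrightarrow> X s \<in> borel_measurable M"
  using adapted F_measurable by blast

lemma b_measurable:
  assumes "s \<in> {0..S}" shows "b s \<in> borel_measurable borel"
proof (rule borel_measurable_continuous_onI, unfold continuous_on_iff, intro ballI allI impI)
  fix x e :: real assume "0 < e"
  \<comment> \<open>Dividing by \<open>L + 1\<close> instead of \<open>L\<close> covers
    \<open>L = 0\<close>.\<close>
  have "dist (b s y) (b s x) < e" if "dist y x < e / (L + 1)" for y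
  proof -
    have "dist (b s y) (b s x) \<le> L * \<bar>y - x\<bar>"
      using lipschitz[of s s y x] assms by (simp add: dist_real_def)
    also have "\<dots> \<le> (L + 1) * \<bar>y - x\<bar>" by (intro mult_right_mono) auto
    also have "\<dots> < e" using that L_nonneg by (simp add: dist_real_def field_simps)
    finally show ?thesis .
  qed
  then show "\<exists>d>0. \<forall>x'\<in>UNIV. dist x' x < d \<longrightarrow> dist (b s x') (b s x) < e"
    using \<open>0 < e\<close> L_nonneg by (intro exI[of _ "e / (L + 1)"]) auto
qed

lemma bX_adapted: "s \<in> {0..S} \<Longrightarrow> (\<lambda>\<omega>. b s (X s \<omega>)) \<in> borel_measurable (F s)"
  by (rule measurable_compose[OF adapted b_measurable])

lemma bX_measurable: "s \<in> {0..S} \<Longrightarrow> (\<lambda>\<omega>. b s (X s \<omega>)) \<in> borel_measurable M"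
  using bX_adapted F_measurable by blast

lemma drift_continuous:
  assumes "\<omega> \<in> space M"
  shows "continuous_on {0..S} (\<lambda>u. b u (X u \<omega>))"
  unfolding continuous_on_def
proof
  fix v assume v: "v \<in> {0..S}"
  have X_lim: "((\<lambda>u. X u \<omega>) \<longlongrightarrow> X v \<omega>) (at v within {0..S})"
    using cont[OF assms] v by (auto simp: continuous_on_def)
  show "((\<lambda>u. b u (X u \<omega>)) \<longlongrightarrow> b v (X v \<omega>)) (at v within {0..S})"
  proof (rule Lim_transform[OF tendsto_const], rule Lim_null_comparison)
    \<comment> \<open>The majorant is symmetric in \<open>u\<close> and \<open>v\<close>:
      \<open>lipschitz\<close> puts the weight at the earlier of the two times, and \<open>v\<close>
      is approached from both sides.\<close>
    show "\<forall>\<^sub>F u in at v within {0..S}. norm (b u (X u \<omega>) - b v (X v \<omega>))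
        \<le> L * (\<bar>X u \<omega> - X v \<omega>\<bar> + \<bar>u - v\<bar> * (1 + \<bar>X u \<omega>\<bar> + \<bar>X v \<omega>\<bar>))"
      unfolding eventually_at_filter
    proof (intro always_eventually allI impI)
      fix u assume u: "u \<in> {0..S}"
      have "u \<le> v \<or> v \<le> u" by auto
      then show "norm (b u (X u \<omega>) - b v (X v \<omega>))
        \<le> L * (\<bar>X u \<omega> - X v \<omega>\<bar> + \<bar>u - v\<bar> * (1 + \<bar>X u \<omega>\<bar> + \<bar>X v \<omega>\<bar>))"
      proof
        assume "u \<le> v"
        then have "norm (b u (X u \<omega>) - b v (X v \<omega>)) \<le> L * (\<bar>X v \<omega> - X u \<omega>\<bar> + (v - u) * (1 + \<bar>X u \<omega>\<bar>))"
          using lipschitz[of u v "X v \<omega>" "X u \<omega>"] u v by (simp add: abs_minus_commute)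
        also have "\<dots> \<le> L * (\<bar>X u \<omega> - X v \<omega>\<bar> + \<bar>u - v\<bar> * (1 + \<bar>X u \<omega>\<bar> + \<bar>X v \<omega>\<bar>))"
          using \<open>u \<le> v\<close> L_nonneg
          by (intro mult_left_mono[OF _ L_nonneg] add_mono[OF _ mult_mono]) auto
        finally show ?thesis .
      next
        assume "v \<le> u"
        then have "norm (b u (X u \<omega>) - b v (X v \<omega>)) \<le> L * (\<bar>X u \<omega> - X v \<omega>\<bar> + (u - v) * (1 + \<bar>X v \<omega>\<bar>))"
          using lipschitz[of v u "X u \<omega>" "X v \<omega>"] u v by simp
        also have "\<dots> \<le> L * (\<bar>X u \<omega> - X v \<omega>\<bar> + \<bar>u - v\<bar> * (1 + \<bar>X u \<omega>\<bar> + \<bar>X v \<omega>\<bar>))"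
          using \<open>v \<le> u\<close> L_nonneg
          by (intro mult_left_mono[OF _ L_nonneg] add_mono[OF _ mult_mono]) auto
        finally show ?thesis .
      qed
    qed
    have "((\<lambda>u. L * (\<bar>X u \<omega> - X v \<omega>\<bar> + \<bar>u - v\<bar> * (1 + \<bar>X u \<omega>\<bar> + \<bar>X v \<omega>\<bar>)))
        \<longlongrightarrow> L * (\<bar>X v \<omega> - X v \<omega>\<bar> + \<bar>v - v\<bar> * (1 + \<bar>X v \<omega>\<bar> + \<bar>X v \<omega>\<bar>))) (at v within {0..S})"
      by (intro tendsto_intros X_lim)
    then show "((\<lambda>u. L * (\<bar>X u \<omega> - X v \<omega>\<bar> + \<bar>u - v\<bar> * (1 + \<bar>X u \<omega>\<bar> + \<bar>X v \<omega>\<bar>))) \<longlongrightarrow> 0) (at v within {0..S})"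
      by simp
  qed
qed

lemma increment:
  "AE \<omega> in M. \<forall>s u. 0 \<le> s \<longrightarrow> s \<le> u \<longrightarrow> u \<le> S \<longrightarrow>
     X u \<omega> - X s \<omega> = integral {s..u} (\<lambda>v. b v (X v \<omega>)) + (W u \<omega> - W s \<omega>)"
  using sde AE_space
proof eventually_elim
  case (elim \<omega>)
  show ?case
  proof (intro allI impI)
    fix s u assume su: "0 \<le> s" "s \<le> u" "u \<le> S"
    have "integral {0..s} (\<lambda>v. b v (X v \<omega>)) + integral {s..u} (\<lambda>v. b v (X v \<omega>)) = integral {0..u} (\<lambda>v. b v (X v \<omega>))"
      using su by (intro Henstock_Kurzweil_Integration.integral_combine integrable_continuous_interval
          continuous_on_subset[OF drift_continuous[OF elim(2)]]) auto
    then show "X u \<omega> - X s \<omega> = integral {s..u} (\<lambda>v. b v (X v \<omega>)) + (W u \<omega> - W s \<omega>)"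
      using elim(1) su by auto
  qed
qed

section \<open>Moments of the noise and of the solution\<close>

lemma noise_moments:
  assumes "0 \<le> s" "s < u"
  shows "integrable M (\<lambda>\<omega>. W u \<omega> - W s \<omega>)"
    and "expectation (\<lambda>\<omega>. W u \<omega> - W s \<omega>) = 0"
    and "integrable M (\<lambda>\<omega>. (W u \<omega> - W s \<omega>)\<^sup>2)"
    and "expectation (\<lambda>\<omega>. (W u \<omega> - W s \<omega>)\<^sup>2) = u - s"
proof -
  have pos: "0 < sqrt (u - s)" using assms by simp
  note D = W_normal[OF assms]
  show "integrable M (\<lambda>\<omega>. W u \<omega> - W s \<omega>)"
    using distributed_integrable[OF D, of "\<lambda>x. x"] integrable_normal_moment[OF pos, of 0 1] by simp
  show E: "expectation (\<lambda>\<omega>. W u \<omega> - W s \<omega>) = 0"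
    by (rule normal_distributed_expectation[OF pos D])
  show "integrable M (\<lambda>\<omega>. (W u \<omega> - W s \<omega>)\<^sup>2)"
    using distributed_integrable[OF D, of "\<lambda>x. x\<^sup>2"] integrable_normal_moment[OF pos, of 0 2] by simp
  show "expectation (\<lambda>\<omega>. (W u \<omega> - W s \<omega>)\<^sup>2) = u - s"
    using normal_distributed_variance[OF pos D] assms by (simp add: E)
qed

text \<open>A substitute for conditioning on \<open>F s\<close>: the multiplier \<open>g\<close>
  carries whatever is known at time \<open>s\<close>.\<close>

lemma noise_independent:
  fixes \<phi> :: "real \<Rightarrow> real"
  assumes su: "0 \<le> s" "s < u" and g: "g \<in> borel_measurable (F s)" "integrable M g"
    and \<phi>: "\<phi> \<in> borel_measurable borel" "integrable M (\<lambda>\<omega>. \<phi> (W u \<omega> - W s \<omega>))"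
  shows "integrable M (\<lambda>\<omega>. g \<omega> * \<phi> (W u \<omega> - W s \<omega>))"
    and "expectation (\<lambda>\<omega>. g \<omega> * \<phi> (W u \<omega> - W s \<omega>)) =
      expectation g * expectation (\<lambda>\<omega>. \<phi> (W u \<omega> - W s \<omega>))"
proof -
  have W_meas: "(\<lambda>\<omega>. W u \<omega> - W s \<omega>) \<in> borel_measurable M"
    using su by (intro borel_measurable_diff W_measurable) auto
  have sub: "sigma_sets (space M) {g -` A \<inter> space M |A. A \<in> sets borel} \<subseteq> sets (F s)"
    using g(1) space_F[of s] by (intro sets.sigma_sets_subset') (auto simp: measurable_sets dest!: measurable_sets)
  have "indep_var borel g borel (\<lambda>\<omega>. W u \<omega> - W s \<omega>)"
    unfolding indep_var_eq
    using W_indep[OF su] sub W_meas F_measurable[OF g(1)]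
    by (auto simp: indep_sets2_eq sets_vimage_algebra)
  from indep_var_compose[OF this, of "\<lambda>x. x" borel \<phi> borel] \<phi>(1)
  have "indep_var borel g borel (\<lambda>\<omega>. \<phi> (W u \<omega> - W s \<omega>))" by (simp add: comp_def)
  from indep_var_integrable[OF this g(2) \<phi>(2)] indep_var_lebesgue_integral[OF this g(2) \<phi>(2)]
  show "integrable M (\<lambda>\<omega>. g \<omega> * \<phi> (W u \<omega> - W s \<omega>))"
    and "expectation (\<lambda>\<omega>. g \<omega> * \<phi> (W u \<omega> - W s \<omega>)) =
      expectation g * expectation (\<lambda>\<omega>. \<phi> (W u \<omega> - W s \<omega>))" .
qed

lemma W_square:
  assumes "s \<in> {0..S}"
  shows "integrable M (\<lambda>\<omega>. (W s \<omega>)\<^sup>2)" and "expectation (\<lambda>\<omega>. (W s \<omega>)\<^sup>2) \<le> S"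
proof -
  have meas: "W s \<in> borel_measurable M" using assms W_measurable by auto
  have "integrable M (\<lambda>\<omega>. (W s \<omega>)\<^sup>2) \<and> expectation (\<lambda>\<omega>. (W s \<omega>)\<^sup>2) \<le> S"
  \<comment> \<open>\<open>W_normal\<close> needs an interval of positive length, and
    \<open>W 0\<close> vanishes only almost surely.\<close>
  proof (cases "s = 0")
    case True
    with W_0 have ae: "AE \<omega> in M. (W s \<omega>)\<^sup>2 = 0" by auto
    have "integrable M (\<lambda>\<omega>. (W s \<omega>)\<^sup>2)"
      by (subst integrable_cong_AE[OF _ _ ae]) (use meas in auto)
    moreover have "expectation (\<lambda>\<omega>. (W s \<omega>)\<^sup>2) = expectation (\<lambda>\<omega>. 0)"
      by (intro integral_cong_AE ae) (use meas in auto)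
    ultimately show ?thesis using S_pos by simp
  next
    case False
    with assms have s: "0 < s" by auto
    from W_0 have ae: "AE \<omega> in M. (W s \<omega>)\<^sup>2 = (W s \<omega> - W 0 \<omega>)\<^sup>2" by auto
    have W0m: "W 0 \<in> borel_measurable M" using W_measurable[of 0] by simp
    have "integrable M (\<lambda>\<omega>. (W s \<omega>)\<^sup>2)"
      by (subst integrable_cong_AE[OF _ _ ae]) (use meas W0m noise_moments(3)[of 0 s] s in auto)
    moreover have "expectation (\<lambda>\<omega>. (W s \<omega>)\<^sup>2) = expectation (\<lambda>\<omega>. (W s \<omega> - W 0 \<omega>)\<^sup>2)"
      by (intro integral_cong_AE ae) (use meas W0m in auto)
    ultimately show ?thesis using noise_moments(4)[of 0 s] s assms by simp
  qed
  then show "integrable M (\<lambda>\<omega>. (W s \<omega>)\<^sup>2)" "expectation (\<lambda>\<omega>. (W s \<omega>)\<^sup>2) \<le> S" by auto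
qed

text \<open>Gronwall is applied to each path, with majorant \<open>c0 + |W s|\<close>, and squares
  are integrated only afterwards; applied to expectations it would presuppose that the moments are
  finite.\<close>

lemma second_moment:
  obtains C where "1 \<le> C"
    "\<And>s. s \<in> {0..S} \<Longrightarrow> integrable M (\<lambda>\<omega>. (H s \<omega>)\<^sup>2)"
    "\<And>s. s \<in> {0..S} \<Longrightarrow> expectation (\<lambda>\<omega>. (H s \<omega>)\<^sup>2) \<le> C"
proof -
  define c0 where "c0 = \<bar>z\<bar> + L * S"
  define c1 where "c1 = L * exp (L * S)"
  define Q where "Q \<omega> = integral {0..S} (\<lambda>u. c0 + \<bar>W u \<omega>\<bar>)" for \<omega>
  have c0: "0 \<le> c0" using L_nonneg S_pos by (simp add: c0_def)
  have c1: "0 \<le> c1" using L_nonneg by (simp add: c1_def)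
  have sq2: "(x + y)\<^sup>2 \<le> 2 * (x\<^sup>2 + y\<^sup>2)" for x y :: real
    using sum_squares_bound[of x y] by (simp add: power2_sum)
  have W_contS: "continuous_on {0..S} (\<lambda>u. W u \<omega>)" if "\<omega> \<in> space M" for \<omega>
    using W_cont[OF that] by (rule continuous_on_subset) auto
  have intW: "integrable M (\<lambda>\<omega>. (c0 + \<bar>W u \<omega>\<bar>)\<^sup>2)"
    "expectation (\<lambda>\<omega>. (c0 + \<bar>W u \<omega>\<bar>)\<^sup>2) \<le> 2 * c0\<^sup>2 + 2 * S" if u: "u \<in> {0..S}" for u
  proof -
    have m: "W u \<in> borel_measurable M" using W_measurable u by simp
    have i: "integrable M (\<lambda>\<omega>. 2 * (c0\<^sup>2 + (W u \<omega>)\<^sup>2))"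
      using W_square(1)[OF u] by simp
    have le: "(c0 + \<bar>W u \<omega>\<bar>)\<^sup>2 \<le> 2 * (c0\<^sup>2 + (W u \<omega>)\<^sup>2)" for \<omega>
      using sq2[of c0 "\<bar>W u \<omega>\<bar>"] by simp
    show I: "integrable M (\<lambda>\<omega>. (c0 + \<bar>W u \<omega>\<bar>)\<^sup>2)"
      by (rule Bochner_Integration.integrable_bound[OF i])
        (use m le in \<open>auto intro!: AE_I2 order_trans[OF _ abs_ge_self]\<close>)
    have "expectation (\<lambda>\<omega>. (c0 + \<bar>W u \<omega>\<bar>)\<^sup>2) \<le> expectation (\<lambda>\<omega>. 2 * (c0\<^sup>2 + (W u \<omega>)\<^sup>2))"
      by (rule integral_mono[OF I i le])
    also have "\<dots> = 2 * c0\<^sup>2 + 2 * expectation (\<lambda>\<omega>. (W u \<omega>)\<^sup>2)"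
      using W_square(1)[OF u] by (simp add: prob_space)
    finally show "expectation (\<lambda>\<omega>. (c0 + \<bar>W u \<omega>\<bar>)\<^sup>2) \<le> 2 * c0\<^sup>2 + 2 * S"
      using W_square(2)[OF u] by simp
  qed
  have cQ: "continuous_on {0..S} (\<lambda>u. c0 + \<bar>W u \<omega>\<bar>)" if "\<omega> \<in> space M" for \<omega>
    by (intro continuous_intros W_contS that)
  have Q: "integrable M (\<lambda>\<omega>. (Q \<omega>)\<^sup>2)" "expectation (\<lambda>\<omega>. (Q \<omega>)\<^sup>2) \<le> S\<^sup>2 * (2 * c0\<^sup>2 + 2 * S)"
    using time_integral_square_bound(1,2)[of 0 S "\<lambda>u \<omega>. c0 + \<bar>W u \<omega>\<bar>" "2 * c0\<^sup>2 + 2 * S"]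
      W_measurable intW S_pos cQ
    by (auto simp: Q_def)
  have bound: "AE \<omega> in M. \<forall>s\<in>{0..S}. (H s \<omega>)\<^sup>2 \<le> 4 * (1 + (c0 + \<bar>W s \<omega>\<bar>)\<^sup>2 + c1\<^sup>2 * (Q \<omega>)\<^sup>2)"
    using sde AE_space
  proof eventually_elim
    case (elim \<omega>)
    note cX = cont[OF elim(2)] and cW = W_contS[OF elim(2)]
    have le: "\<bar>X s \<omega>\<bar> \<le> (c0 + \<bar>W s \<omega>\<bar>) + L * integral {0..s} (\<lambda>u. \<bar>X u \<omega>\<bar>)" if s: "s \<in> {0..S}" for s
    proof -
      have sub: "continuous_on {0..s} (\<lambda>u. b u (X u \<omega>))" "continuous_on {0..s} (\<lambda>u. X u \<omega>)"
        using s by (auto intro: continuous_on_subset[OF drift_continuous[OF elim(2)]] continuous_on_subset[OF cX])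
      have "\<bar>integral {0..s} (\<lambda>u. b u (X u \<omega>))\<bar> \<le> integral {0..s} (\<lambda>u. L * (1 + \<bar>X u \<omega>\<bar>))"
        using s growth unfolding real_norm_def[symmetric]
        by (intro integral_norm_bound_integral integrable_continuous_interval continuous_intros sub) auto
      also have "\<dots> = L * (s + integral {0..s} (\<lambda>u. \<bar>X u \<omega>\<bar>))"
        using s by (subst integral_mult_right, subst integral_add)
          (auto intro!: integrable_continuous_interval continuous_intros sub)
      also have "\<dots> \<le> L * S + L * integral {0..s} (\<lambda>u. \<bar>X u \<omega>\<bar>)"
        using s L_nonneg by (simp add: distrib_left mult_left_mono)
      finally show ?thesis using elim(1) s unfolding c0_def by force
    qed
    show ?case
    proof
      fix s assume s: "s \<in> {0..S}"
      have "integral {0..s} (\<lambda>u. \<bar>X u \<omega>\<bar>) \<le> exp (L * S) * Q \<omega>"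
        unfolding Q_def
        by (rule gronwall_time_integral[where L=L and S=S])
          (use le s c0 L_nonneg in \<open>auto intro!: continuous_intros cX cW\<close>)
      then have "L * integral {0..s} (\<lambda>u. \<bar>X u \<omega>\<bar>) \<le> L * (exp (L * S) * Q \<omega>)"
        by (rule mult_left_mono[OF _ L_nonneg])
      then have "H s \<omega> \<le> (1 + (c0 + \<bar>W s \<omega>\<bar>)) + c1 * Q \<omega>"
        using le[OF s] unfolding H_def c1_def by (simp add: mult.assoc)
      then have "(H s \<omega>)\<^sup>2 \<le> ((1 + (c0 + \<bar>W s \<omega>\<bar>)) + c1 * Q \<omega>)\<^sup>2"
        using H_ge_1[of s \<omega>] by (intro power_mono) auto
      also have "\<dots> \<le> 2 * ((1 + (c0 + \<bar>W s \<omega>\<bar>))\<^sup>2 + (c1 * Q \<omega>)\<^sup>2)" by (rule sq2)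
      also have "\<dots> \<le> 2 * (2 * (1 + (c0 + \<bar>W s \<omega>\<bar>)\<^sup>2) + 2 * (c1 * Q \<omega>)\<^sup>2)"
        using sq2[of 1 "c0 + \<bar>W s \<omega>\<bar>"] by (intro mult_left_mono add_mono) auto
      finally show "(H s \<omega>)\<^sup>2 \<le> 4 * (1 + (c0 + \<bar>W s \<omega>\<bar>)\<^sup>2 + c1\<^sup>2 * (Q \<omega>)\<^sup>2)"
        by (simp add: power_mult_distrib)
    qed
  qed
  define C where "C = 4 * (1 + (2 * c0\<^sup>2 + 2 * S) + c1\<^sup>2 * (S\<^sup>2 * (2 * c0\<^sup>2 + 2 * S)))"
  have main: "integrable M (\<lambda>\<omega>. (H s \<omega>)\<^sup>2)" "expectation (\<lambda>\<omega>. (H s \<omega>)\<^sup>2) \<le> C" if s: "s \<in> {0..S}" for s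
  proof -
    have i: "integrable M (\<lambda>\<omega>. 4 * (1 + (c0 + \<bar>W s \<omega>\<bar>)\<^sup>2 + c1\<^sup>2 * (Q \<omega>)\<^sup>2))"
      using intW(1)[OF s] Q(1) by simp
    have ae: "AE \<omega> in M. (H s \<omega>)\<^sup>2 \<le> 4 * (1 + (c0 + \<bar>W s \<omega>\<bar>)\<^sup>2 + c1\<^sup>2 * (Q \<omega>)\<^sup>2)"
      using bound s by auto
    have m: "H s \<in> borel_measurable M"
      unfolding H_def using X_measurable[OF s] by measurable
    show I: "integrable M (\<lambda>\<omega>. (H s \<omega>)\<^sup>2)"
      by (rule Bochner_Integration.integrable_bound[OF i]) (use m ae in auto)
    have "expectation (\<lambda>\<omega>. (H s \<omega>)\<^sup>2) \<le> expectation (\<lambda>\<omega>. 4 * (1 + (c0 + \<bar>W s \<omega>\<bar>)\<^sup>2 + c1\<^sup>2 * (Q \<omega>)\<^sup>2))"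
      by (rule integral_mono_AE[OF I i ae])
    also have "\<dots> = 4 * (1 + expectation (\<lambda>\<omega>. (c0 + \<bar>W s \<omega>\<bar>)\<^sup>2) + c1\<^sup>2 * expectation (\<lambda>\<omega>. (Q \<omega>)\<^sup>2))"
      using intW(1)[OF s] Q(1) by (simp add: prob_space)
    also have "\<dots> \<le> C"
      unfolding C_def using intW(2)[OF s] Q(2)
      by (intro mult_left_mono add_mono) auto
    finally show "expectation (\<lambda>\<omega>. (H s \<omega>)\<^sup>2) \<le> C" .
  qed
  have "1 \<le> C"
  proof -
    have "0 \<le> c1\<^sup>2 * (S\<^sup>2 * (2 * c0\<^sup>2 + 2 * S))" using S_pos by (intro mult_nonneg_nonneg) auto
    moreover have "0 \<le> 2 * c0\<^sup>2 + 2 * S" using S_pos by simp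
    moreover have "1 \<le> 4 * (1 + x + y)" if "0 \<le> y" "0 \<le> x" for x y :: real
      using that by simp
    ultimately show ?thesis unfolding C_def by blast
  qed
  with main that show ?thesis by blast
qed

lemma H_adapted: "s \<in> {0..S} \<Longrightarrow> H s \<in> borel_measurable (F s)"
  unfolding H_def using adapted[of s] by measurable

text \<open>An increment is a drift integral, with mean square of order \<open>(u - s)^2\<close>,
  plus noise, with mean square of order \<open>u - s\<close>. The drift part is recorded separately
  because \<open>second_order_estimate\<close> relies on its better order.\<close>

lemma increment_square:
  obtains C where "0 \<le> C"
    "\<And>s u. 0 \<le> s \<Longrightarrow> s \<le> u \<Longrightarrow> u \<le> S \<Longrightarrow> integrable M (\<lambda>\<omega>. (X u \<omega> - X s \<omega>)\<^sup>2)"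
    "\<And>s u. 0 \<le> s \<Longrightarrow> s \<le> u \<Longrightarrow> u \<le> S \<Longrightarrow> expectation (\<lambda>\<omega>. (X u \<omega> - X s \<omega>)\<^sup>2) \<le> C * (u - s)"
    "\<And>s u. 0 \<le> s \<Longrightarrow> s \<le> u \<Longrightarrow> u \<le> S \<Longrightarrow>
      integrable M (\<lambda>\<omega>. (integral {s..u} (\<lambda>v. b v (X v \<omega>)))\<^sup>2)"
    "\<And>s u. 0 \<le> s \<Longrightarrow> s \<le> u \<Longrightarrow> u \<le> S \<Longrightarrow>
      expectation (\<lambda>\<omega>. (integral {s..u} (\<lambda>v. b v (X v \<omega>)))\<^sup>2) \<le> C * (u - s)\<^sup>2"
    "\<And>s u. 0 \<le> s \<Longrightarrow> s \<le> u \<Longrightarrow> u \<le> S \<Longrightarrow>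
      (\<lambda>\<omega>. integral {s..u} (\<lambda>v. b v (X v \<omega>))) \<in> borel_measurable M"
proof -
  obtain C1 where C1: "1 \<le> C1" "\<And>s. s \<in> {0..S} \<Longrightarrow> integrable M (\<lambda>\<omega>. (H s \<omega>)\<^sup>2)"
    "\<And>s. s \<in> {0..S} \<Longrightarrow> expectation (\<lambda>\<omega>. (H s \<omega>)\<^sup>2) \<le> C1" by (rule second_moment) blast
  define C2 where "C2 = L\<^sup>2 * C1"
  have C2: "0 \<le> C2" using C1 by (simp add: C2_def)
  have b_sq: "integrable M (\<lambda>\<omega>. (b v (X v \<omega>))\<^sup>2)" "expectation (\<lambda>\<omega>. (b v (X v \<omega>))\<^sup>2) \<le> C2"
    if v: "v \<in> {0..S}" for v
  proof -
    have le: "(b v (X v \<omega>))\<^sup>2 \<le> L\<^sup>2 * (H v \<omega>)\<^sup>2" for \<omega>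
      using power_mono[OF growth[OF v, of "X v \<omega>"], of 2] by (simp add: H_def power_mult_distrib)
    have i: "integrable M (\<lambda>\<omega>. L\<^sup>2 * (H v \<omega>)\<^sup>2)" using C1(2)[OF v] by simp
    show I: "integrable M (\<lambda>\<omega>. (b v (X v \<omega>))\<^sup>2)"
      by (rule Bochner_Integration.integrable_bound[OF i])
        (use bX_measurable[OF v] le in \<open>auto intro!: AE_I2\<close>)
    have "expectation (\<lambda>\<omega>. (b v (X v \<omega>))\<^sup>2) \<le> expectation (\<lambda>\<omega>. L\<^sup>2 * (H v \<omega>)\<^sup>2)"
      by (rule integral_mono[OF I i le])
    also have "\<dots> \<le> C2" unfolding C2_def using C1(3)[OF v] by (simp add: mult_left_mono)
    finally show "expectation (\<lambda>\<omega>. (b v (X v \<omega>))\<^sup>2) \<le> C2" .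
  qed
  have B: "integrable M (\<lambda>\<omega>. (integral {s..u} (\<lambda>v. b v (X v \<omega>)))\<^sup>2)"
    "expectation (\<lambda>\<omega>. (integral {s..u} (\<lambda>v. b v (X v \<omega>)))\<^sup>2) \<le> (u - s)\<^sup>2 * C2"
    "(\<lambda>\<omega>. integral {s..u} (\<lambda>v. b v (X v \<omega>))) \<in> borel_measurable M"
    if su: "0 \<le> s" "s \<le> u" "u \<le> S" for s u
    by (rule time_integral_square_bound[of s u "\<lambda>v \<omega>. b v (X v \<omega>)" C2];
        use su b_sq bX_measurable in \<open>auto intro: continuous_on_subset[OF drift_continuous]\<close>)+
  define C where "C = 2 * S * C2 + 2 + C2"
  have dX: "integrable M (\<lambda>\<omega>. (X u \<omega> - X s \<omega>)\<^sup>2) \<and> expectation (\<lambda>\<omega>. (X u \<omega> - X s \<omega>)\<^sup>2) \<le> C * (u - s)"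
    if su: "0 \<le> s" "s \<le> u" "u \<le> S" for s u
  proof (cases "s = u")
    case False
    with su have lt: "s < u" by simp
    let ?f = "\<lambda>\<omega>. 2 * (integral {s..u} (\<lambda>v. b v (X v \<omega>)))\<^sup>2 + 2 * (W u \<omega> - W s \<omega>)\<^sup>2"
    have i: "integrable M ?f" using B(1)[OF su] noise_moments(3)[OF su(1) lt] by simp
    have ae: "AE \<omega> in M. (X u \<omega> - X s \<omega>)\<^sup>2 \<le> ?f \<omega>"
      using increment
    proof eventually_elim
      case (elim \<omega>)
      have "(x + y)\<^sup>2 \<le> 2 * x\<^sup>2 + 2 * y\<^sup>2" for x y :: real
        using sum_squares_bound[of x y] by (simp add: power2_sum)
      with elim su show ?case by simp
    qed
    have m: "(\<lambda>\<omega>. X u \<omega> - X s \<omega>) \<in> borel_measurable M"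
      using su by (intro borel_measurable_diff X_measurable) auto
    have I: "integrable M (\<lambda>\<omega>. (X u \<omega> - X s \<omega>)\<^sup>2)"
      by (rule Bochner_Integration.integrable_bound[OF i]) (use m ae in auto)
    have "expectation (\<lambda>\<omega>. (X u \<omega> - X s \<omega>)\<^sup>2) \<le> expectation ?f"
      by (rule integral_mono_AE[OF I i ae])
    also have "\<dots> \<le> 2 * ((u - s)\<^sup>2 * C2) + 2 * (u - s)"
      using B(1,2)[OF su] noise_moments(3,4)[OF su(1) lt] by simp
    also have "(u - s)\<^sup>2 * C2 \<le> (S * (u - s)) * C2"
      using su C2 by (intro mult_right_mono) (auto simp: power2_eq_square intro!: mult_right_mono)
    also have "2 * ((S * (u - s)) * C2) + 2 * (u - s) = (2 * S * C2 + 2) * (u - s)" by algebra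
    also have "\<dots> \<le> C * (u - s)" unfolding C_def using C2 su by (intro mult_right_mono) auto
    finally show ?thesis using I by simp
  qed simp
  have "C2 \<le> C" "0 \<le> C" using C2 S_pos by (auto simp: C_def)
  have B2: "expectation (\<lambda>\<omega>. (integral {s..u} (\<lambda>v. b v (X v \<omega>)))\<^sup>2) \<le> C * (u - s)\<^sup>2"
    if su: "0 \<le> s" "s \<le> u" "u \<le> S" for s u
  proof -
    have "(u - s)\<^sup>2 * C2 \<le> (u - s)\<^sup>2 * C" by (intro mult_left_mono \<open>C2 \<le> C\<close>) auto
    with B(2)[OF su] show ?thesis by (simp add: mult.commute)
  qed
  show ?thesis using that[of C] \<open>0 \<le> C\<close> dX B B2 by blast
qed

lemma increment_abs:
  obtains C where "0 \<le> C"
    "\<And>s u. 0 \<le> s \<Longrightarrow> s < u \<Longrightarrow> u \<le> S \<Longrightarrow> integrable M (\<lambda>\<omega>. \<bar>X u \<omega> - X s \<omega>\<bar>)"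
    "\<And>s u. 0 \<le> s \<Longrightarrow> s < u \<Longrightarrow> u \<le> S \<Longrightarrow> expectation (\<lambda>\<omega>. \<bar>X u \<omega> - X s \<omega>\<bar>) \<le> C * sqrt (u - s)"
proof -
  obtain C where C: "0 \<le> C"
    "\<And>s u. 0 \<le> s \<Longrightarrow> s \<le> u \<Longrightarrow> u \<le> S \<Longrightarrow> integrable M (\<lambda>\<omega>. (X u \<omega> - X s \<omega>)\<^sup>2)"
    "\<And>s u. 0 \<le> s \<Longrightarrow> s \<le> u \<Longrightarrow> u \<le> S \<Longrightarrow> expectation (\<lambda>\<omega>. (X u \<omega> - X s \<omega>)\<^sup>2) \<le> C * (u - s)"
    by (rule increment_square) blast
  have *: "integrable M (\<lambda>\<omega>. \<bar>X u \<omega> - X s \<omega>\<bar>) \<and> expectation (\<lambda>\<omega>. \<bar>X u \<omega> - X s \<omega>\<bar>) \<le> (1 + C) * sqrt (u - s)"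
    if su: "0 \<le> s" "s < u" "u \<le> S" for s u
  proof -
    define d where "d = sqrt (u - s)"
    have d: "0 < d" "d\<^sup>2 = u - s" using su by (auto simp: d_def)
    \<comment> \<open>A weighted Young inequality in place of Cauchy-Schwarz for expectations: for
      an increment both terms on the right have mean of order \<open>d\<close>.\<close>
    have le: "\<bar>x\<bar> \<le> d + x\<^sup>2 / d" for x :: real
    proof -
      have "0 \<le> \<bar>x\<bar> * d" using d by simp
      then have "\<bar>x\<bar> * d \<le> d\<^sup>2 + x\<^sup>2"
        using sum_squares_bound[of "\<bar>x\<bar>" d] unfolding power2_abs by linarith
      then show ?thesis using d by (simp add: field_simps power2_eq_square)
    qed
    have i: "integrable M (\<lambda>\<omega>. d + (X u \<omega> - X s \<omega>)\<^sup>2 / d)"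
      using C(2)[of s u] su by simp
    have m: "(\<lambda>\<omega>. X u \<omega> - X s \<omega>) \<in> borel_measurable M"
      using su by (intro borel_measurable_diff X_measurable) auto
    have I: "integrable M (\<lambda>\<omega>. \<bar>X u \<omega> - X s \<omega>\<bar>)"
      by (rule Bochner_Integration.integrable_bound[OF i])
        (use m le in \<open>auto intro!: AE_I2 order_trans[OF _ abs_ge_self]\<close>)
    have "expectation (\<lambda>\<omega>. \<bar>X u \<omega> - X s \<omega>\<bar>) \<le> expectation (\<lambda>\<omega>. d + (X u \<omega> - X s \<omega>)\<^sup>2 / d)"
      by (rule integral_mono[OF I i le])
    also have "\<dots> = d + expectation (\<lambda>\<omega>. (X u \<omega> - X s \<omega>)\<^sup>2) / d"
      using C(2)[of s u] su by (simp add: prob_space)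
    also have "\<dots> \<le> d + (C * d\<^sup>2) / d"
      using C(3)[of s u] su d by (intro add_left_mono divide_right_mono) auto
    also have "\<dots> = (1 + C) * d" using d by (simp add: power2_eq_square field_simps)
    finally show ?thesis using I by (simp add: d_def)
  qed
  show ?thesis using that[of "1 + C"] C(1) * by auto
qed

text \<open>Against \<open>g\<close> the noise has mean zero; what remains is the time integral of
  \<open>g * (b v (X v) - b s (X s))\<close>. By \<open>lipschitz\<close> the integrand has mean of
  order \<open>sqrt (u - s)\<close>, and the length of the step supplies the other factor. The
  multiplier may grow like \<open>H s\<close>, as the slopes of supersolutions do.\<close>

lemma first_order_estimate:
  obtains C where "0 \<le> C"
    "\<And>s u g. 0 \<le> s \<Longrightarrow> s < u \<Longrightarrow> u \<le> S \<Longrightarrow> g \<in> borel_measurable (F s) \<Longrightarrow>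
      (\<And>\<omega>. \<omega> \<in> space M \<Longrightarrow> \<bar>g \<omega>\<bar> \<le> H s \<omega>) \<Longrightarrow>
      integrable M (\<lambda>\<omega>. g \<omega> * (X u \<omega> - X s \<omega> - b s (X s \<omega>) * (u - s)))"
    "\<And>s u g. 0 \<le> s \<Longrightarrow> s < u \<Longrightarrow> u \<le> S \<Longrightarrow> g \<in> borel_measurable (F s) \<Longrightarrow>
      (\<And>\<omega>. \<omega> \<in> space M \<Longrightarrow> \<bar>g \<omega>\<bar> \<le> H s \<omega>) \<Longrightarrow>
      \<bar>expectation (\<lambda>\<omega>. g \<omega> * (X u \<omega> - X s \<omega> - b s (X s \<omega>) * (u - s)))\<bar> \<le> C * ((u - s) * sqrt (u - s))"
proof -
  obtain C1 where C1: "1 \<le> C1" "\<And>s. s \<in> {0..S} \<Longrightarrow> integrable M (\<lambda>\<omega>. (H s \<omega>)\<^sup>2)"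
    "\<And>s. s \<in> {0..S} \<Longrightarrow> expectation (\<lambda>\<omega>. (H s \<omega>)\<^sup>2) \<le> C1" by (rule second_moment) blast
  obtain C2 where C2: "0 \<le> C2"
    "\<And>s u. 0 \<le> s \<Longrightarrow> s \<le> u \<Longrightarrow> u \<le> S \<Longrightarrow> integrable M (\<lambda>\<omega>. (X u \<omega> - X s \<omega>)\<^sup>2)"
    "\<And>s u. 0 \<le> s \<Longrightarrow> s \<le> u \<Longrightarrow> u \<le> S \<Longrightarrow> expectation (\<lambda>\<omega>. (X u \<omega> - X s \<omega>)\<^sup>2) \<le> C2 * (u - s)"
    by (rule increment_square) blast
  define C where "C = L * (C1 + C2 + sqrt S * C1)"
  have *: "integrable M (\<lambda>\<omega>. g \<omega> * (X u \<omega> - X s \<omega> - b s (X s \<omega>) * (u - s))) \<and>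
      \<bar>expectation (\<lambda>\<omega>. g \<omega> * (X u \<omega> - X s \<omega> - b s (X s \<omega>) * (u - s)))\<bar> \<le> C * ((u - s) * sqrt (u - s))"
    if su: "0 \<le> s" "s < u" "u \<le> S" and g: "g \<in> borel_measurable (F s)"
      and gH: "\<And>\<omega>. \<omega> \<in> space M \<Longrightarrow> \<bar>g \<omega>\<bar> \<le> H s \<omega>" for s u g
  proof -
    have sS: "s \<in> {0..S}" using su by auto
    define d where "d = sqrt (u - s)"
    have d: "0 < d" "d\<^sup>2 = u - s" "d \<le> sqrt S" using su by (auto simp: d_def)
    note gM = F_measurable[OF g]
    have H_int: "integrable M (H s)"
      by (rule Bochner_Integration.integrable_bound[OF C1(2)[OF sS]])
        (use F_measurable[OF H_adapted[OF sS]] H_ge_1 in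
          \<open>auto intro!: AE_I2 self_le_power simp: H_def\<close>)
    have g_int: "integrable M g"
      by (rule Bochner_Integration.integrable_bound[OF H_int])
        (use gM gH in \<open>auto intro!: AE_I2 order_trans[OF gH abs_ge_self]\<close>)
    define D where "D v \<omega> = g \<omega> * (b v (X v \<omega>) - b s (X s \<omega>))" for v \<omega>
    have D_meas: "D v \<in> borel_measurable M" if "v \<in> {s..u}" for v
      unfolding D_def using that su
      by (intro borel_measurable_times gM borel_measurable_diff bX_measurable) auto
    \<comment> \<open>Young's inequality with weight \<open>d\<close> splits the product of
      \<open>H s\<close> and \<open>|X v - X s|\<close> into two terms of mean order
      \<open>d\<close>.\<close>
    have D_le: "\<bar>D v \<omega>\<bar> \<le> L * (d * (H s \<omega>)\<^sup>2 + (X v \<omega> - X s \<omega>)\<^sup>2 / d + d\<^sup>2 * (H s \<omega>)\<^sup>2)"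
      if v: "v \<in> {s..u}" and \<omega>: "\<omega> \<in> space M" for v \<omega>
    proof -
      let ?x = "\<bar>X v \<omega> - X s \<omega>\<bar>"
      have "\<bar>D v \<omega>\<bar> \<le> H s \<omega> * (L * (?x + (v - s) * H s \<omega>))"
        unfolding D_def abs_mult H_def using lipschitz[of s v "X v \<omega>" "X s \<omega>"] v su gH[OF \<omega>]
        by (intro mult_mono) (auto simp: H_def)
      also have "\<dots> \<le> H s \<omega> * (L * (?x + d\<^sup>2 * H s \<omega>))"
        using v d L_nonneg H_ge_1[of s \<omega>] by (intro mult_left_mono add_mono mult_right_mono) auto
      also have "\<dots> = L * (H s \<omega> * ?x + d\<^sup>2 * (H s \<omega>)\<^sup>2)"
        by (simp add: power2_eq_square algebra_simps)
      also have "H s \<omega> * ?x \<le> d * (H s \<omega>)\<^sup>2 + ?x\<^sup>2 / d"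
      proof -
        have "0 \<le> (d * H s \<omega>) * ?x" using d H_ge_1[of s \<omega>] by simp
        then have "(d * H s \<omega>) * ?x \<le> (d * H s \<omega>)\<^sup>2 + ?x\<^sup>2"
          using sum_squares_bound[of "d * H s \<omega>" ?x] by linarith
        then show ?thesis using d by (simp add: field_simps power2_eq_square)
      qed
      finally show ?thesis using L_nonneg by (simp add: mult_left_mono)
    qed
    have D_int: "integrable M (D v)" and D_exp: "expectation (\<lambda>\<omega>. \<bar>D v \<omega>\<bar>) \<le> C * d"
      if v: "v \<in> {s..u}" for v
    proof -
      let ?f = "\<lambda>\<omega>. L * (d * (H s \<omega>)\<^sup>2 + (X v \<omega> - X s \<omega>)\<^sup>2 / d + d\<^sup>2 * (H s \<omega>)\<^sup>2)"
      have i: "integrable M ?f" using C1(2)[OF sS] C2(2)[of s v] v su by simp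
      show I: "integrable M (D v)"
        by (rule Bochner_Integration.integrable_bound[OF i])
          (use D_meas[OF v] D_le[OF v] in \<open>auto intro!: AE_I2 order_trans[OF _ abs_ge_self]\<close>)
      have "expectation (\<lambda>\<omega>. \<bar>D v \<omega>\<bar>) \<le> expectation ?f"
        using I i D_le[OF v] by (intro integral_mono) auto
      also have "\<dots> = L * (d * expectation (\<lambda>\<omega>. (H s \<omega>)\<^sup>2) + expectation (\<lambda>\<omega>. (X v \<omega> - X s \<omega>)\<^sup>2) / d
          + d\<^sup>2 * expectation (\<lambda>\<omega>. (H s \<omega>)\<^sup>2))"
        using C1(2)[OF sS] C2(2)[of s v] v su by simp
      also have "\<dots> \<le> L * (d * C1 + (C2 * d\<^sup>2) / d + (sqrt S * d) * C1)"
      proof (intro mult_left_mono add_mono divide_right_mono)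
        have "expectation (\<lambda>\<omega>. (X v \<omega> - X s \<omega>)\<^sup>2) \<le> C2 * (v - s)" using C2(3)[of s v] v su by simp
        also have "\<dots> \<le> C2 * d\<^sup>2" using v d C2(1) by (intro mult_left_mono) auto
        finally show "expectation (\<lambda>\<omega>. (X v \<omega> - X s \<omega>)\<^sup>2) \<le> C2 * d\<^sup>2" .
        show "d\<^sup>2 * expectation (\<lambda>\<omega>. (H s \<omega>)\<^sup>2) \<le> (sqrt S * d) * C1"
        proof (rule mult_mono[OF _ C1(3)[OF sS]])
          show "d\<^sup>2 \<le> sqrt S * d"
            using d(1,3) by (simp add: power2_eq_square mult_right_mono)
        qed (use d S_pos in auto)
      qed (use d L_nonneg C1(3)[OF sS] in auto)
      also have "\<dots> = C * d" using d by (simp add: C_def power2_eq_square field_simps)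
      finally show "expectation (\<lambda>\<omega>. \<bar>D v \<omega>\<bar>) \<le> C * d" .
    qed
    have D_cont: "continuous_on {s..u} (\<lambda>v. D v \<omega>)" if "\<omega> \<in> space M" for \<omega>
      unfolding D_def
      by (intro continuous_intros continuous_on_subset[OF drift_continuous[OF that]]) (use su in auto)
    let ?I = "\<lambda>\<omega>. integral {s..u} (\<lambda>v. D v \<omega>)"
    have I: "integrable M ?I" "expectation (\<lambda>\<omega>. \<bar>?I \<omega>\<bar>) \<le> (u - s) * (C * d)"
      using time_integral_bound[OF D_int D_cont D_exp] su by auto
    have N: "integrable M (\<lambda>\<omega>. g \<omega> * (W u \<omega> - W s \<omega>))" "expectation (\<lambda>\<omega>. g \<omega> * (W u \<omega> - W s \<omega>)) = 0"
      using noise_independent[OF su(1,2) g g_int, of "\<lambda>x. x"] noise_moments[OF su(1,2)] by auto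
    have ae: "AE \<omega> in M. g \<omega> * (X u \<omega> - X s \<omega> - b s (X s \<omega>) * (u - s)) = ?I \<omega> + g \<omega> * (W u \<omega> - W s \<omega>)"
      using increment AE_space
    proof eventually_elim
      case (elim \<omega>)
      have cb: "continuous_on {s..u} (\<lambda>v. b v (X v \<omega>))"
        by (rule continuous_on_subset[OF drift_continuous[OF elim(2)]]) (use su in auto)
      have "?I \<omega> = g \<omega> * (integral {s..u} (\<lambda>v. b v (X v \<omega>)) - b s (X s \<omega>) * (u - s))"
        unfolding D_def using su
        by (subst integral_mult_right, subst Henstock_Kurzweil_Integration.integral_diff)
          (auto intro!: integrable_continuous_interval cb)
      moreover have "X u \<omega> - X s \<omega> = integral {s..u} (\<lambda>v. b v (X v \<omega>)) + (W u \<omega> - W s \<omega>)"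
        using elim(1) su by simp
      ultimately show ?case by (simp only:) (simp add: algebra_simps)
    qed
    have Xm: "X u \<in> borel_measurable M" "X s \<in> borel_measurable M"
      "(\<lambda>\<omega>. b s (X s \<omega>)) \<in> borel_measurable M"
      using su by (auto intro: X_measurable bX_measurable)
    have m1: "(\<lambda>\<omega>. g \<omega> * (X u \<omega> - X s \<omega> - b s (X s \<omega>) * (u - s))) \<in> borel_measurable M"
      using Xm gM by measurable
    have IN: "integrable M (\<lambda>\<omega>. ?I \<omega> + g \<omega> * (W u \<omega> - W s \<omega>))" using I N by simp
    have "integrable M (\<lambda>\<omega>. g \<omega> * (X u \<omega> - X s \<omega> - b s (X s \<omega>) * (u - s)))"
      using IN by (subst integrable_cong_AE[OF m1 _ ae]) auto
    moreover have "expectation (\<lambda>\<omega>. g \<omega> * (X u \<omega> - X s \<omega> - b s (X s \<omega>) * (u - s))) = expectation ?I"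
      using IN I N by (subst integral_cong_AE[OF m1 _ ae]) auto
    moreover have "\<bar>expectation ?I\<bar> \<le> C * ((u - s) * sqrt (u - s))"
      using order_trans[OF integral_abs_bound I(2)] by (simp add: d_def mult_ac)
    ultimately show ?thesis by simp
  qed
  have "0 \<le> C" using L_nonneg C1(1) C2(1) S_pos by (simp add: C_def)
  show ?thesis using that[OF \<open>0 \<le> C\<close>] * by blast
qed

text \<open>Write the increment as \<open>?B + ?N\<close>, drift plus noise. The square of
  \<open>?N\<close> is centred at \<open>u - s\<close>, and the cross term is at most
  \<open>?B^2 / d + d * ?N^2\<close>, with both means of order \<open>d^3\<close>. Indicators are
  enough as multipliers because \<Gamma> is constant in a supersolution.\<close>

lemma second_order_estimate:
  obtains C where "0 \<le> C"
    "\<And>s u A. 0 \<le> s \<Longrightarrow> s < u \<Longrightarrow> u \<le> S \<Longrightarrow> A \<in> sets (F s) \<Longrightarrow>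
      integrable M (\<lambda>\<omega>. indicator A \<omega> * ((X u \<omega> - X s \<omega>)\<^sup>2 - (u - s)))"
    "\<And>s u A. 0 \<le> s \<Longrightarrow> s < u \<Longrightarrow> u \<le> S \<Longrightarrow> A \<in> sets (F s) \<Longrightarrow>
      \<bar>expectation (\<lambda>\<omega>. indicator A \<omega> * ((X u \<omega> - X s \<omega>)\<^sup>2 - (u - s)))\<bar> \<le> C * ((u - s) * sqrt (u - s))"
proof -
  obtain C2 where C2: "0 \<le> C2"
    "\<And>s u. 0 \<le> s \<Longrightarrow> s \<le> u \<Longrightarrow> u \<le> S \<Longrightarrow> integrable M (\<lambda>\<omega>. (X u \<omega> - X s \<omega>)\<^sup>2)"
    "\<And>s u. 0 \<le> s \<Longrightarrow> s \<le> u \<Longrightarrow> u \<le> S \<Longrightarrow>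
      integrable M (\<lambda>\<omega>. (integral {s..u} (\<lambda>v. b v (X v \<omega>)))\<^sup>2)"
    "\<And>s u. 0 \<le> s \<Longrightarrow> s \<le> u \<Longrightarrow> u \<le> S \<Longrightarrow>
      expectation (\<lambda>\<omega>. (integral {s..u} (\<lambda>v. b v (X v \<omega>)))\<^sup>2) \<le> C2 * (u - s)\<^sup>2"
    "\<And>s u. 0 \<le> s \<Longrightarrow> s \<le> u \<Longrightarrow> u \<le> S \<Longrightarrow>
      (\<lambda>\<omega>. integral {s..u} (\<lambda>v. b v (X v \<omega>))) \<in> borel_measurable M"
    by (rule increment_square) blast
  define C where "C = C2 + 1 + sqrt S * C2"
  have *: "integrable M (\<lambda>\<omega>. indicator A \<omega> * ((X u \<omega> - X s \<omega>)\<^sup>2 - (u - s))) \<and>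
      \<bar>expectation (\<lambda>\<omega>. indicator A \<omega> * ((X u \<omega> - X s \<omega>)\<^sup>2 - (u - s)))\<bar> \<le> C * ((u - s) * sqrt (u - s))"
    if su: "0 \<le> s" "s < u" "u \<le> S" and A: "A \<in> sets (F s)" for s u A
  proof -
    have AM: "A \<in> sets M" using A sets_F_subset by auto
    define d where "d = sqrt (u - s)"
    have d: "0 < d" "d\<^sup>2 = u - s" "d \<le> sqrt S" using su by (auto simp: d_def)
    let ?B = "\<lambda>\<omega>. integral {s..u} (\<lambda>v. b v (X v \<omega>))"
    let ?N = "\<lambda>\<omega>. W u \<omega> - W s \<omega>"
    have N0: "integrable M (\<lambda>\<omega>. indicator A \<omega> * ((?N \<omega>)\<^sup>2 - (u - s)))"
      "expectation (\<lambda>\<omega>. indicator A \<omega> * ((?N \<omega>)\<^sup>2 - (u - s))) = 0"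
      using noise_independent[OF su(1,2), of "indicator A" "\<lambda>x. x\<^sup>2 - (u - s)"] A AM
        noise_moments(3,4)[OF su(1,2)] by (auto simp: prob_space emeasure_eq_measure)
    have Bi: "integrable M (\<lambda>\<omega>. (?B \<omega>)\<^sup>2)" "expectation (\<lambda>\<omega>. (?B \<omega>)\<^sup>2) \<le> C2 * (u - s)\<^sup>2"
      "?B \<in> borel_measurable M"
      using C2(3-5)[of s u] su by auto
    have Ni: "integrable M (\<lambda>\<omega>. (?N \<omega>)\<^sup>2)" "expectation (\<lambda>\<omega>. (?N \<omega>)\<^sup>2) = u - s"
      "?N \<in> borel_measurable M"
      using noise_moments[OF su(1,2)] by auto
    define R where "R \<omega> = indicator A \<omega> * (2 * ?B \<omega> * ?N \<omega> + (?B \<omega>)\<^sup>2)" for \<omega>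
    let ?f = "\<lambda>\<omega>. (?B \<omega>)\<^sup>2 / d + d * (?N \<omega>)\<^sup>2 + (?B \<omega>)\<^sup>2"
    have i: "integrable M ?f" using Bi Ni by simp
    have R_le: "\<bar>R \<omega>\<bar> \<le> ?f \<omega>" for \<omega>
    proof -
      have "\<bar>R \<omega>\<bar> \<le> \<bar>2 * ?B \<omega> * ?N \<omega> + (?B \<omega>)\<^sup>2\<bar>"
        unfolding R_def by (simp add: indicator_def)
      also have "\<dots> \<le> 2 * \<bar>?B \<omega>\<bar> * \<bar>?N \<omega>\<bar> + (?B \<omega>)\<^sup>2"
        by (rule order_trans[OF abs_triangle_ineq]) (simp add: abs_mult)
      also have "2 * \<bar>?B \<omega>\<bar> * \<bar>?N \<omega>\<bar> \<le> (?B \<omega>)\<^sup>2 / d + d * (?N \<omega>)\<^sup>2"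
      proof -
        have "2 * \<bar>?B \<omega>\<bar> * (d * \<bar>?N \<omega>\<bar>) \<le> (?B \<omega>)\<^sup>2 + (d * \<bar>?N \<omega>\<bar>)\<^sup>2"
          using sum_squares_bound[of "\<bar>?B \<omega>\<bar>" "d * \<bar>?N \<omega>\<bar>"] by simp
        then show ?thesis using d by (simp add: field_simps power2_eq_square)
      qed
      finally show ?thesis by simp
    qed
    have R_meas: "R \<in> borel_measurable M"
      unfolding R_def using Bi(3) Ni(3) AM by measurable
    have R_int: "integrable M R"
      by (rule Bochner_Integration.integrable_bound[OF i])
        (use R_meas R_le in \<open>auto intro!: AE_I2 order_trans[OF _ abs_ge_self]\<close>)
    have "\<bar>expectation R\<bar> \<le> expectation (\<lambda>\<omega>. \<bar>R \<omega>\<bar>)" by (rule integral_abs_bound)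
    also have "\<dots> \<le> expectation ?f" using R_int i R_le by (intro integral_mono) auto
    also have "\<dots> = expectation (\<lambda>\<omega>. (?B \<omega>)\<^sup>2) / d + d * (u - s) + expectation (\<lambda>\<omega>. (?B \<omega>)\<^sup>2)"
      using Bi Ni by simp
    also have "\<dots> \<le> (C2 * (u - s)\<^sup>2) / d + d * (u - s) + C2 * (u - s)\<^sup>2"
      using Bi(2) d by (intro add_mono divide_right_mono) auto
    also have "\<dots> = (C2 + 1 + C2 * d) * ((u - s) * d)"
      unfolding d(2)[symmetric] using d(1) by (simp add: power2_eq_square field_simps)
    also have "\<dots> \<le> C * ((u - s) * d)"
      unfolding C_def using d C2(1) su by (intro mult_right_mono) (auto simp: mult.commute intro!: mult_left_mono)
    finally have R_exp: "\<bar>expectation R\<bar> \<le> C * ((u - s) * d)" .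
    let ?g = "\<lambda>\<omega>. indicator A \<omega> * ((?N \<omega>)\<^sup>2 - (u - s)) + R \<omega>"
    have ae: "AE \<omega> in M. indicator A \<omega> * ((X u \<omega> - X s \<omega>)\<^sup>2 - (u - s)) = ?g \<omega>"
      using increment
    proof eventually_elim
      case (elim \<omega>)
      then have "X u \<omega> - X s \<omega> = ?B \<omega> + ?N \<omega>" using su by simp
      then show ?case by (simp only: R_def power2_sum) (simp add: algebra_simps)
    qed
    have m1: "(\<lambda>\<omega>. indicator A \<omega> * ((X u \<omega> - X s \<omega>)\<^sup>2 - (u - s))) \<in> borel_measurable M"
    proof -
      have "X u \<in> borel_measurable M" "X s \<in> borel_measurable M" using su by (auto intro: X_measurable)
      then show ?thesis using AM by measurable
    qed
    have IN: "integrable M ?g" using N0 R_int by simp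
    have "integrable M (\<lambda>\<omega>. indicator A \<omega> * ((X u \<omega> - X s \<omega>)\<^sup>2 - (u - s)))"
      using IN by (subst integrable_cong_AE[OF m1 _ ae]) auto
    moreover have "expectation (\<lambda>\<omega>. indicator A \<omega> * ((X u \<omega> - X s \<omega>)\<^sup>2 - (u - s))) = expectation R"
    proof -
      have "expectation (\<lambda>\<omega>. indicator A \<omega> * ((X u \<omega> - X s \<omega>)\<^sup>2 - (u - s))) = expectation ?g"
        by (rule integral_cong_AE[OF m1 _ ae]) (use IN in auto)
      also have "\<dots> = expectation R" using N0 R_int by simp
      finally show ?thesis .
    qed
    ultimately show ?thesis using R_exp by (simp add: d_def)
  qed
  have "0 \<le> C" using C2(1) S_pos by (simp add: C_def)
  show ?thesis using that[OF \<open>0 \<le> C\<close>] * by blast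
qed

end

section \<open>Supersolutions and optional stopping\<close>

text \<open>A one-sided second-order Taylor bound with exact leading terms: for smooth \<open>w\<close> with
  \<open>\<beta> = w\<^sub>x\<close> and \<open>w\<^sub>x\<^sub>x \<le> \<Gamma>\<close> it says \<open>w\<^sub>t + b w\<^sub>x + \<Gamma> / 2 \<le> 0\<close>. It is stable under minima,
  so no smoothness of \<open>w\<close> is required.\<close>

definition supersolution ::
  "(real \<Rightarrow> real \<Rightarrow> real) \<Rightarrow> real \<Rightarrow> (real \<Rightarrow> real \<Rightarrow> real) \<Rightarrow> (real \<Rightarrow> real \<Rightarrow> real) \<Rightarrow> real \<Rightarrow> real \<Rightarrow> bool"
where
  "supersolution b S w \<beta> \<Gamma> K \<longleftrightarrow> 0 \<le> K \<and>
    (\<forall>s\<in>{0..S}. w s \<in> borel_measurable borel \<and> \<beta> s \<in> borel_measurable borel) \<and>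
    (\<forall>s\<in>{0..S}. \<forall>x. \<bar>w s x\<bar> \<le> K * (1 + \<bar>x\<bar>)\<^sup>2 \<and> \<bar>\<beta> s x\<bar> \<le> K * (1 + \<bar>x\<bar>)) \<and>
    (\<forall>s u x y. 0 \<le> s \<longrightarrow> s < u \<longrightarrow> u \<le> S \<longrightarrow>
      w u y \<le> w s x + \<beta> s x * (y - x - b s x * (u - s)) + \<Gamma> / 2 * ((y - x)\<^sup>2 - (u - s))
        + K * ((u - s) * (\<bar>y - x\<bar> + (u - s))))"

text \<open>Rounding is upwards: the rounded time exceeds a grid point before \<open>S\<close>
  exactly when \<open>t\<close> does, and for a stopping time this is known at that grid point. The
  cap \<open>n\<close> keeps the rounded time within the horizon.\<close>

definition grid_time :: "real \<Rightarrow> nat \<Rightarrow> real \<Rightarrow> real" where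
  "grid_time S n t = S / real n * real (min n (nat \<lceil>t / (S / real n)\<rceil>))"

text \<open>The comparison is with \<open>min t S\<close> because a stopping time may run past the
  horizon.\<close>

lemma grid_time_bounds:
  assumes "0 < S" "0 < n" "0 \<le> t"
  shows "0 \<le> grid_time S n t" "grid_time S n t \<le> S" "\<bar>grid_time S n t - min t S\<bar> \<le> S / real n"
proof -
  define d where "d = S / real n"
  have d: "0 < d" "S = d * real n" using assms by (auto simp: d_def)
  let ?k = "nat \<lceil>t / d\<rceil>"
  have k: "t / d \<le> real ?k" "real ?k < t / d + 1"
    using d assms by (auto simp: of_nat_nat) linarith+
  then have kd: "t \<le> d * real ?k" "d * real ?k < t + d"
    using d by (simp_all add: field_simps)
  have g: "grid_time S n t = min S (d * real ?k)"
    using d by (simp add: grid_time_def d_def[symmetric] min_def of_nat_le_iff)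
  have "0 \<le> d * real ?k" using d by simp
  then show "0 \<le> grid_time S n t" "grid_time S n t \<le> S" using g assms by simp_all
  show "\<bar>grid_time S n t - min t S\<bar> \<le> S / real n"
  proof -
    have "\<bar>min S a - min t S\<bar> \<le> d" if "t \<le> a" "a < t + d" for a
      using that d(1) by linarith
    from this[OF kd] show ?thesis by (simp only: g d_def)
  qed
qed

section \<open>Optional stopping for the Lipschitz equation\<close>

context lipschitz_sde
begin

lemma initial_value: "AE \<omega> in M. X 0 \<omega> = z"
  using sde W_0
proof eventually_elim
  case (elim \<omega>)
  then show ?case using S_pos by (auto dest!: bspec[of _ _ 0])
qed

lemma X_integrable: "s \<in> {0..S} \<Longrightarrow> integrable M (X s)"
proof -
  assume s: "s \<in> {0..S}"
  obtain C1 where C1: "\<And>s. s \<in> {0..S} \<Longrightarrow> integrable M (\<lambda>\<omega>. (H s \<omega>)\<^sup>2)"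
    by (rule second_moment) blast
  have "\<bar>X s \<omega>\<bar> \<le> (H s \<omega>)\<^sup>2" for \<omega>
    using self_le_power[OF H_ge_1[of s \<omega>], of 2] by (simp add: H_def)
  then show ?thesis
    by (intro Bochner_Integration.integrable_bound[OF C1[OF s], of "X s"])
      (use X_measurable[OF s] in \<open>auto intro!: AE_I2\<close>)
qed

text \<open>The first-order estimate from time 0 with multiplier 1, where the starting value is
  known; it yields part (i).\<close>

lemma expectation_expansion:
  obtains C where "0 \<le> C"
    "\<And>u. 0 < u \<Longrightarrow> u \<le> S \<Longrightarrow> \<bar>expectation (X u) - z - b 0 z * u\<bar> \<le> C * (u * sqrt u)"
proof -
  obtain C where C: "0 \<le> C"
    "\<And>s u g. 0 \<le> s \<Longrightarrow> s < u \<Longrightarrow> u \<le> S \<Longrightarrow> g \<in> borel_measurable (F s) \<Longrightarrow>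
      (\<And>\<omega>. \<omega> \<in> space M \<Longrightarrow> \<bar>g \<omega>\<bar> \<le> H s \<omega>) \<Longrightarrow>
      \<bar>expectation (\<lambda>\<omega>. g \<omega> * (X u \<omega> - X s \<omega> - b s (X s \<omega>) * (u - s)))\<bar> \<le> C * ((u - s) * sqrt (u - s))"
    by (rule first_order_estimate) blast
  have "\<bar>expectation (X u) - z - b 0 z * u\<bar> \<le> C * (u * sqrt u)" if u: "0 < u" "u \<le> S" for u
  proof -
    have m: "X u \<in> borel_measurable M" "X 0 \<in> borel_measurable M"
      "(\<lambda>\<omega>. b 0 (X 0 \<omega>)) \<in> borel_measurable M"
      using u by (auto intro: X_measurable bX_measurable)
    have "expectation (\<lambda>\<omega>. 1 * (X u \<omega> - X 0 \<omega> - b 0 (X 0 \<omega>) * (u - 0)))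
        = expectation (\<lambda>\<omega>. X u \<omega> - (z + b 0 z * u))"
    proof (rule integral_cong_AE)
      show "AE \<omega> in M. 1 * (X u \<omega> - X 0 \<omega> - b 0 (X 0 \<omega>) * (u - 0)) = X u \<omega> - (z + b 0 z * u)"
        using initial_value by eventually_elim simp
    qed (use m in measurable)
    also have "\<dots> = expectation (X u) - (z + b 0 z * u)"
      using X_integrable[of u] u by (simp add: prob_space)
    finally show ?thesis using C(2)[of 0 u "\<lambda>_. 1"] u H_ge_1 by (simp add: algebra_simps)
  qed
  with that C(1) show ?thesis by blast
qed

text \<open>The Taylor bound is integrated over \<open>A\<close>. Its three correction terms all
  have mean of order \<open>(u - s) * sqrt (u - s)\<close>: the slope term by
  \<open>first_order_estimate\<close>, the quadratic term by \<open>second_order_estimate\<close>,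
  and the remainder because \<open>|X u - X s|\<close> has mean of order
  \<open>sqrt (u - s)\<close>.\<close>

lemma supersolution_step:
  assumes w: "supersolution b S w \<beta> \<Gamma> K"
  obtains C where "0 \<le> C"
    "\<And>s. s \<in> {0..S} \<Longrightarrow> integrable M (\<lambda>\<omega>. w s (X s \<omega>))"
    "\<And>s u A. 0 \<le> s \<Longrightarrow> s < u \<Longrightarrow> u \<le> S \<Longrightarrow> A \<in> sets (F s) \<Longrightarrow>
      expectation (\<lambda>\<omega>. indicator A \<omega> * (w u (X u \<omega>) - w s (X s \<omega>))) \<le> C * ((u - s) * sqrt (u - s))"
proof -
  obtain C0 where C0: "\<And>s. s \<in> {0..S} \<Longrightarrow> integrable M (\<lambda>\<omega>. (H s \<omega>)\<^sup>2)"
    by (rule second_moment) blast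
  obtain C1 where C1: "0 \<le> C1"
    "\<And>s u g. 0 \<le> s \<Longrightarrow> s < u \<Longrightarrow> u \<le> S \<Longrightarrow> g \<in> borel_measurable (F s) \<Longrightarrow>
      (\<And>\<omega>. \<omega> \<in> space M \<Longrightarrow> \<bar>g \<omega>\<bar> \<le> H s \<omega>) \<Longrightarrow>
      integrable M (\<lambda>\<omega>. g \<omega> * (X u \<omega> - X s \<omega> - b s (X s \<omega>) * (u - s)))"
    "\<And>s u g. 0 \<le> s \<Longrightarrow> s < u \<Longrightarrow> u \<le> S \<Longrightarrow> g \<in> borel_measurable (F s) \<Longrightarrow>
      (\<And>\<omega>. \<omega> \<in> space M \<Longrightarrow> \<bar>g \<omega>\<bar> \<le> H s \<omega>) \<Longrightarrow>
      \<bar>expectation (\<lambda>\<omega>. g \<omega> * (X u \<omega> - X s \<omega> - b s (X s \<omega>) * (u - s)))\<bar> \<le> C1 * ((u - s) * sqrt (u - s))"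
    by (rule first_order_estimate) blast
  obtain C2 where C2: "0 \<le> C2"
    "\<And>s u A. 0 \<le> s \<Longrightarrow> s < u \<Longrightarrow> u \<le> S \<Longrightarrow> A \<in> sets (F s) \<Longrightarrow>
      integrable M (\<lambda>\<omega>. indicator A \<omega> * ((X u \<omega> - X s \<omega>)\<^sup>2 - (u - s)))"
    "\<And>s u A. 0 \<le> s \<Longrightarrow> s < u \<Longrightarrow> u \<le> S \<Longrightarrow> A \<in> sets (F s) \<Longrightarrow>
      \<bar>expectation (\<lambda>\<omega>. indicator A \<omega> * ((X u \<omega> - X s \<omega>)\<^sup>2 - (u - s)))\<bar> \<le> C2 * ((u - s) * sqrt (u - s))"
    by (rule second_order_estimate) blast
  obtain C3 where C3: "0 \<le> C3"
    "\<And>s u. 0 \<le> s \<Longrightarrow> s < u \<Longrightarrow> u \<le> S \<Longrightarrow> integrable M (\<lambda>\<omega>. \<bar>X u \<omega> - X s \<omega>\<bar>)"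
    "\<And>s u. 0 \<le> s \<Longrightarrow> s < u \<Longrightarrow> u \<le> S \<Longrightarrow> expectation (\<lambda>\<omega>. \<bar>X u \<omega> - X s \<omega>\<bar>) \<le> C3 * sqrt (u - s)"
    by (rule increment_abs) blast
  have K: "0 \<le> K"
    and w_meas: "\<And>s. s \<in> {0..S} \<Longrightarrow> w s \<in> borel_measurable borel"
    and \<beta>_meas: "\<And>s. s \<in> {0..S} \<Longrightarrow> \<beta> s \<in> borel_measurable borel"
    and w_bound: "\<And>s x. s \<in> {0..S} \<Longrightarrow> \<bar>w s x\<bar> \<le> K * (1 + \<bar>x\<bar>)\<^sup>2"
    and \<beta>_bound: "\<And>s x. s \<in> {0..S} \<Longrightarrow> \<bar>\<beta> s x\<bar> \<le> K * (1 + \<bar>x\<bar>)"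
    and taylor: "\<And>s u x y. 0 \<le> s \<Longrightarrow> s < u \<Longrightarrow> u \<le> S \<Longrightarrow>
      w u y \<le> w s x + \<beta> s x * (y - x - b s x * (u - s)) + \<Gamma> / 2 * ((y - x)\<^sup>2 - (u - s))
        + K * ((u - s) * (\<bar>y - x\<bar> + (u - s)))"
    using w by (auto simp: supersolution_def)
  have w_int: "integrable M (\<lambda>\<omega>. w s (X s \<omega>))" if s: "s \<in> {0..S}" for s
  proof (rule Bochner_Integration.integrable_bound)
    show "integrable M (\<lambda>\<omega>. K * (H s \<omega>)\<^sup>2)" using C0[OF s] by simp
    show "(\<lambda>\<omega>. w s (X s \<omega>)) \<in> borel_measurable M"
      by (rule measurable_compose[OF X_measurable[OF s] w_meas[OF s]])
    show "AE \<omega> in M. norm (w s (X s \<omega>)) \<le> norm (K * (H s \<omega>)\<^sup>2)"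
      using w_bound[OF s] K by (auto simp: H_def)
  qed
  define C where "C = (K + 1) * C1 + \<bar>\<Gamma>\<bar> / 2 * C2 + K * (C3 + sqrt S)"
  have step: "expectation (\<lambda>\<omega>. indicator A \<omega> * (w u (X u \<omega>) - w s (X s \<omega>))) \<le> C * ((u - s) * sqrt (u - s))"
    if su: "0 \<le> s" "s < u" "u \<le> S" and A: "A \<in> sets (F s)" for s u A
  proof -
    have sS: "s \<in> {0..S}" and uS: "u \<in> {0..S}" using su by auto
    have AM: "A \<in> sets M" using A sets_F_subset by auto
    \<comment> \<open>Division by \<open>K + 1\<close> brings the slope below \<open>H s\<close>, as
      \<open>first_order_estimate\<close> demands, also when \<open>K = 0\<close>.\<close>
    define g where "g \<omega> = indicator A \<omega> * (\<beta> s (X s \<omega>) / (K + 1))" for \<omega>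
    have g: "g \<in> borel_measurable (F s)"
      unfolding g_def using A measurable_compose[OF adapted[OF sS] \<beta>_meas[OF sS]] by measurable
    have gH: "\<bar>g \<omega>\<bar> \<le> H s \<omega>" for \<omega>
    proof -
      have "\<bar>\<beta> s (X s \<omega>)\<bar> \<le> (K + 1) * H s \<omega>"
        using \<beta>_bound[OF sS, of "X s \<omega>"] by (simp add: H_def algebra_simps)
      then have "\<bar>\<beta> s (X s \<omega>) / (K + 1)\<bar> \<le> H s \<omega>"
        using K by (simp add: field_simps)
      then show ?thesis using H_ge_1[of s \<omega>] by (auto simp: g_def indicator_def)
    qed
    note I1 = C1(2)[OF su g gH] and I2 = C2(2)[OF su A] and I3 = C3(2)[OF su]
    let ?G = "\<lambda>\<omega>. g \<omega> * (X u \<omega> - X s \<omega> - b s (X s \<omega>) * (u - s))"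
    let ?Q = "\<lambda>\<omega>. indicator A \<omega> * ((X u \<omega> - X s \<omega>)\<^sup>2 - (u - s))"
    let ?f = "\<lambda>\<omega>. (K + 1) * ?G \<omega> + \<Gamma> / 2 * ?Q \<omega> + K * ((u - s) * (\<bar>X u \<omega> - X s \<omega>\<bar> + (u - s)))"
    have "expectation (\<lambda>\<omega>. indicator A \<omega> * (w u (X u \<omega>) - w s (X s \<omega>))) \<le> expectation ?f"
    proof (rule integral_mono)
      show "integrable M (\<lambda>\<omega>. indicator A \<omega> * (w u (X u \<omega>) - w s (X s \<omega>)))"
        using w_int[OF sS] w_int[OF uS] AM
        by (auto intro!: integrable_real_mult_indicator simp: mult.commute[of "indicator A _"])
      show "integrable M ?f" using I1 I2 I3 by simp
      show "indicator A \<omega> * (w u (X u \<omega>) - w s (X s \<omega>)) \<le> ?f \<omega>" for \<omega>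
      proof (cases "\<omega> \<in> A")
        case True
        have "(K + 1) * g \<omega> = \<beta> s (X s \<omega>)" using True K by (simp add: g_def)
        then have "(K + 1) * ?G \<omega> = \<beta> s (X s \<omega>) * (X u \<omega> - X s \<omega> - b s (X s \<omega>) * (u - s))"
          by (metis mult.assoc)
        then show ?thesis unfolding \<open>(K + 1) * ?G \<omega> = _\<close>
          using True taylor[OF su, of "X u \<omega>" "X s \<omega>"] by simp
      next
        case False
        then show ?thesis using K su by (simp add: g_def)
      qed
    qed
    also have "expectation ?f = (K + 1) * expectation ?G + \<Gamma> / 2 * expectation ?Q
        + K * ((u - s) * (expectation (\<lambda>\<omega>. \<bar>X u \<omega> - X s \<omega>\<bar>) + (u - s)))"
      using I1 I2 I3 by (simp add: prob_space)
    also have "\<dots> \<le> (K + 1) * (C1 * ((u - s) * sqrt (u - s))) + \<bar>\<Gamma>\<bar> / 2 * (C2 * ((u - s) * sqrt (u - s)))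
        + K * ((u - s) * (C3 * sqrt (u - s) + sqrt S * sqrt (u - s)))"
    proof (intro add_mono mult_left_mono)
      show "expectation ?G \<le> C1 * ((u - s) * sqrt (u - s))" using C1(3)[OF su g gH] by linarith
      have "\<Gamma> / 2 * expectation ?Q \<le> \<bar>\<Gamma> / 2 * expectation ?Q\<bar>" by simp
      also have "\<dots> \<le> \<bar>\<Gamma>\<bar> / 2 * (C2 * ((u - s) * sqrt (u - s)))"
        unfolding abs_mult using C2(3)[OF su A] by (intro mult_mono) auto
      finally show "\<Gamma> / 2 * expectation ?Q \<le> \<bar>\<Gamma>\<bar> / 2 * (C2 * ((u - s) * sqrt (u - s)))" .
      show "expectation (\<lambda>\<omega>. \<bar>X u \<omega> - X s \<omega>\<bar>) \<le> C3 * sqrt (u - s)" by (rule C3(3)[OF su])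
      have "u - s = sqrt (u - s) * sqrt (u - s)" using su by simp
      also have "\<dots> \<le> sqrt S * sqrt (u - s)" using su by (intro mult_right_mono) auto
      finally show "u - s \<le> sqrt S * sqrt (u - s)" .
    qed (use K su in auto)
    also have "\<dots> = C * ((u - s) * sqrt (u - s))" by (simp add: C_def algebra_simps)
    finally show ?thesis .
  qed
  have "0 \<le> C" using K C1(1) C2(1) C3(1) S_pos by (simp add: C_def)
  show ?thesis by (rule that[OF \<open>0 \<le> C\<close> w_int step])
qed

text \<open>The stopped value is the initial one plus the increments over those steps that start
  before \<tau>. That a step does so is known at its start, so each of the \<open>n\<close> steps
  costs a multiple of \<open>d * sqrt d\<close>, and together they cost a multiple of
  \<open>S * sqrt d\<close>. The constant is uniform in \<open>n\<close> and \<tau>, which allows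
  the grid to be refined later.\<close>

lemma optional_stopping_grid:
  assumes w: "supersolution b S w \<beta> \<Gamma> K"
  obtains C where "0 \<le> C"
    "\<And>n \<tau>. 0 < n \<Longrightarrow> (\<And>\<omega>. \<omega> \<in> space M \<Longrightarrow> 0 \<le> \<tau> \<omega>) \<Longrightarrow>
      (\<And>s. s \<in> {0..<S} \<Longrightarrow> {\<omega>\<in>space M. s < \<tau> \<omega>} \<in> sets (F s)) \<Longrightarrow>
      integrable M (\<lambda>\<omega>. w (grid_time S n (\<tau> \<omega>)) (X (grid_time S n (\<tau> \<omega>)) \<omega>))"
    "\<And>n \<tau>. 0 < n \<Longrightarrow> (\<And>\<omega>. \<omega> \<in> space M \<Longrightarrow> 0 \<le> \<tau> \<omega>) \<Longrightarrow>
      (\<And>s. s \<in> {0..<S} \<Longrightarrow> {\<omega>\<in>space M. s < \<tau> \<omega>} \<in> sets (F s)) \<Longrightarrow>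
      expectation (\<lambda>\<omega>. w (grid_time S n (\<tau> \<omega>)) (X (grid_time S n (\<tau> \<omega>)) \<omega>)) \<le> w 0 z + C / sqrt n"
proof -
  obtain C where C: "0 \<le> C"
    "\<And>s. s \<in> {0..S} \<Longrightarrow> integrable M (\<lambda>\<omega>. w s (X s \<omega>))"
    "\<And>s u A. 0 \<le> s \<Longrightarrow> s < u \<Longrightarrow> u \<le> S \<Longrightarrow> A \<in> sets (F s) \<Longrightarrow>
      expectation (\<lambda>\<omega>. indicator A \<omega> * (w u (X u \<omega>) - w s (X s \<omega>))) \<le> C * ((u - s) * sqrt (u - s))"
    by (rule supersolution_step[OF w]) blast
  have *: "integrable M (\<lambda>\<omega>. w (grid_time S n (\<tau> \<omega>)) (X (grid_time S n (\<tau> \<omega>)) \<omega>)) \<and>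
      expectation (\<lambda>\<omega>. w (grid_time S n (\<tau> \<omega>)) (X (grid_time S n (\<tau> \<omega>)) \<omega>)) \<le> w 0 z + (C * (S * sqrt S)) / sqrt n"
    if n: "0 < n" and \<tau>: "\<And>\<omega>. \<omega> \<in> space M \<Longrightarrow> 0 \<le> \<tau> \<omega>"
      and st: "\<And>s. s \<in> {0..<S} \<Longrightarrow> {\<omega>\<in>space M. s < \<tau> \<omega>} \<in> sets (F s)" for n \<tau>
  proof -
    define d where "d = S / real n"
    have d: "0 < d" "S = d * real n" using S_pos n by (auto simp: d_def)
    define v where "v k \<omega> = w (d * real k) (X (d * real k) \<omega>)" for k \<omega>
    define A where "A k = {\<omega>\<in>space M. d * real k < \<tau> \<omega>}" for k
    define N where "N \<omega> = min n (nat \<lceil>\<tau> \<omega> / d\<rceil>)" for \<omega>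
    have dk: "d * real k \<in> {0..<S}" if "k < n" for k
      unfolding d(2) using d(1) that by simp
    have dk': "d * real k \<in> {0..S}" if "k \<le> n" for k
      unfolding d(2) using d(1) that by simp
    have A: "A k \<in> sets (F (d * real k))" if "k < n" for k
      unfolding A_def by (rule st[OF dk[OF that]])
    have v_int: "integrable M (v k)" if "k \<le> n" for k
      unfolding v_def by (rule C(2)[OF dk'[OF that]])
    \<comment> \<open>The ceiling turns the index condition \<open>k < N\<close> into the strict
      event \<open>d * k < \<tau>\<close>.\<close>
    have kN: "k < N \<omega> \<longleftrightarrow> \<omega> \<in> A k" if "k < n" "\<omega> \<in> space M" for k \<omega>
    proof -
      have "k < N \<omega> \<longleftrightarrow> int k < \<lceil>\<tau> \<omega> / d\<rceil>" using that by (auto simp: N_def zless_nat_eq_int_zless)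
      also have "\<dots> \<longleftrightarrow> d * real k < \<tau> \<omega>" using d(1) by (simp add: less_ceiling_iff field_simps)
      finally show ?thesis using that by (simp add: A_def)
    qed
    have eq: "w (grid_time S n (\<tau> \<omega>)) (X (grid_time S n (\<tau> \<omega>)) \<omega>)
        = v 0 \<omega> + (\<Sum>k<n. indicator (A k) \<omega> * (v (Suc k) \<omega> - v k \<omega>))" if "\<omega> \<in> space M" for \<omega>
    proof -
      have "(\<Sum>k<n. indicator (A k) \<omega> * (v (Suc k) \<omega> - v k \<omega>))
          = (\<Sum>k<n. if k \<in> {..<N \<omega>} then v (Suc k) \<omega> - v k \<omega> else 0)"
        by (intro sum.cong refl) (use kN that in \<open>auto simp: indicator_def\<close>)
      also have "\<dots> = (\<Sum>k\<in>{..<n} \<inter> {..<N \<omega>}. v (Suc k) \<omega> - v k \<omega>)"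
        by (rule sum.inter_restrict[symmetric]) simp
      also have "{..<n} \<inter> {..<N \<omega>} = {..<N \<omega>}" by (auto simp: N_def)
      also have "(\<Sum>k<N \<omega>. v (Suc k) \<omega> - v k \<omega>) = v (N \<omega>) \<omega> - v 0 \<omega>"
        by (rule sum_lessThan_telescope)
      finally show ?thesis
        by (simp add: v_def grid_time_def N_def d_def)
    qed
    have inc_int: "integrable M (\<lambda>\<omega>. indicator (A k) \<omega> * (v (Suc k) \<omega> - v k \<omega>))" if "k < n" for k
      using v_int[of k] v_int[of "Suc k"] A[OF that] sets_F_subset that
      by (auto intro!: integrable_real_mult_indicator simp: mult.commute[of "indicator (A k) _"])
    let ?R = "\<lambda>\<omega>. v 0 \<omega> + (\<Sum>k<n. indicator (A k) \<omega> * (v (Suc k) \<omega> - v k \<omega>))"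
    have R_int: "integrable M ?R"
      using v_int inc_int by (intro Bochner_Integration.integrable_add Bochner_Integration.integrable_sum) auto
    have v0: "expectation (v 0) = w 0 z"
    proof -
      have "expectation (v 0) = expectation (\<lambda>_. w 0 z)"
        using v_int[of 0] initial_value
        by (intro integral_cong_AE) (auto simp: v_def elim: eventually_mono)
      then show ?thesis by (simp add: prob_space)
    qed
    have "expectation ?R = expectation (v 0) + (\<Sum>k<n. expectation (\<lambda>\<omega>. indicator (A k) \<omega> * (v (Suc k) \<omega> - v k \<omega>)))"
    proof -
      have "integrable M (\<lambda>\<omega>. \<Sum>k<n. indicator (A k) \<omega> * (v (Suc k) \<omega> - v k \<omega>))"
        using inc_int by (intro Bochner_Integration.integrable_sum) auto
      moreover have "expectation (\<lambda>\<omega>. \<Sum>k<n. indicator (A k) \<omega> * (v (Suc k) \<omega> - v k \<omega>))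
          = (\<Sum>k<n. expectation (\<lambda>\<omega>. indicator (A k) \<omega> * (v (Suc k) \<omega> - v k \<omega>)))"
        using inc_int by (intro Bochner_Integration.integral_sum) auto
      ultimately show ?thesis using v_int[of 0] by (subst Bochner_Integration.integral_add) simp_all
    qed
    also have "\<dots> \<le> w 0 z + (\<Sum>k<n. C * (d * sqrt d))"
    proof (intro add_mono sum_mono)
      fix k assume "k \<in> {..<n}"
      then have k: "k < n" by simp
      have diff: "d * real (Suc k) - d * real k = d" by (simp add: algebra_simps)
      show "expectation (\<lambda>\<omega>. indicator (A k) \<omega> * (v (Suc k) \<omega> - v k \<omega>)) \<le> C * (d * sqrt d)"
        using C(3)[OF _ _ _ A[OF k], of "d * real (Suc k)"] dk[OF k] dk'[of "Suc k"] k d(1)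
        unfolding diff v_def by auto
    qed (simp add: v0)
    also have "(\<Sum>k<n. C * (d * sqrt d)) = C * (S * sqrt d)" using d(2) by simp
    also have "sqrt d = sqrt S / sqrt n" by (simp add: d_def real_sqrt_divide)
    finally have R_exp: "expectation ?R \<le> w 0 z + (C * (S * sqrt S)) / sqrt n" by simp
    have "integrable M (\<lambda>\<omega>. w (grid_time S n (\<tau> \<omega>)) (X (grid_time S n (\<tau> \<omega>)) \<omega>)) \<longleftrightarrow> integrable M ?R"
      by (rule Bochner_Integration.integrable_cong) (use eq in auto)
    moreover have "expectation (\<lambda>\<omega>. w (grid_time S n (\<tau> \<omega>)) (X (grid_time S n (\<tau> \<omega>)) \<omega>)) = expectation ?R"
      by (rule Bochner_Integration.integral_cong) (use eq in auto)
    ultimately show ?thesis using R_int R_exp by simp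
  qed
  have "0 \<le> C * (S * sqrt S)" using C(1) S_pos by simp
  from that[OF this] * show ?thesis by blast
qed

end

section \<open>The drift of the bridge\<close>

definition drift :: "real \<Rightarrow> real \<Rightarrow> real \<Rightarrow> real \<Rightarrow> real \<Rightarrow> real" where
  "drift r p t s x = (post_mean r p (t + s) x - x) / (1 - (t + s))"

text \<open>No derivative is taken: for \<open>Y <= X\<close> the difference is
  \<open>(X - Y) / ((X + 1) * (Y + 1))\<close>, at most \<open>1 - Y / X\<close>, and
  \<open>Y / X = exp (y - x)\<close>. The resulting constant 1 is not optimal, but the sharp one
  brings no gain here.\<close>

lemma logistic_lipschitz:
  fixes \<rho> x y :: real
  assumes "0 < \<rho>"
  shows "\<bar>\<rho> * exp x / (\<rho> * exp x + 1) - \<rho> * exp y / (\<rho> * exp y + 1)\<bar> \<le> \<bar>x - y\<bar>"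
proof -
  have *: "\<bar>\<rho> * exp x / (\<rho> * exp x + 1) - \<rho> * exp y / (\<rho> * exp y + 1)\<bar> \<le> x - y" if "y \<le> x" for x y
  proof -
    define X Y where "X = \<rho> * exp x" and "Y = \<rho> * exp y"
    have XY: "0 < Y" "Y \<le> X" using assms that by (auto simp: X_def Y_def)
    have "X / (X + 1) - Y / (Y + 1) = (X - Y) / ((X + 1) * (Y + 1))"
      using XY by (simp add: field_simps)
    also have "\<dots> \<le> (X - Y) / X"
    proof (rule divide_left_mono)
      have "X * 1 \<le> (X + 1) * (Y + 1)" using XY by (intro mult_mono) auto
      then show "X \<le> (X + 1) * (Y + 1)" by simp
    qed (use XY in auto)
    also have "\<dots> = 1 - exp (y - x)"
      using assms by (simp add: X_def Y_def exp_diff field_simps)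
    also have "\<dots> \<le> x - y" using exp_ge_add_one_self[of "y - x"] by linarith
    finally have "X / (X + 1) - Y / (Y + 1) \<le> x - y" .
    moreover have "0 \<le> X / (X + 1) - Y / (Y + 1)"
    proof -
      have "Y / (Y + 1) \<le> X / (X + 1)" using XY by (simp add: field_simps)
      then show ?thesis by simp
    qed
    ultimately show ?thesis by (simp add: X_def Y_def)
  qed
  show ?thesis
    using *[of y x] *[of x y] by (cases "y \<le> x") (auto simp: abs_minus_commute)
qed

lemma post_mean_abs_le:
  assumes "0 < r" "0 < p" "p < 1"
  shows "\<bar>post_mean r p t x\<bar> \<le> r"
  using post_weight_bounds[OF assms(2,3), of r t x] assms(1)
  by (auto simp: post_mean_eq[OF assms(2,3)] abs_mult abs_le_iff intro!: mult_left_le)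

text \<open>On \<open>{0..S}\<close> the inverse of the remaining time is at most \<open>e\<close>,
  and all constants are polynomials in \<open>e\<close>. They blow up as \<open>t + S\<close> tends
  to 1.\<close>

lemma drift_lipschitz_growth:
  assumes r: "0 < r" and p: "0 < p" "p < 1" and S: "t + S < 1"
  obtains L where "0 \<le> L"
    "\<And>s x. s \<in> {0..S} \<Longrightarrow> \<bar>drift r p t s x\<bar> \<le> L * (1 + \<bar>x\<bar>)"
    "\<And>s u x y. 0 \<le> s \<Longrightarrow> s \<le> u \<Longrightarrow> u \<le> S \<Longrightarrow>
      \<bar>drift r p t u y - drift r p t s x\<bar> \<le> L * (\<bar>y - x\<bar> + (u - s) * (1 + \<bar>x\<bar>))"
proof -
  define e where "e = 1 / (1 - (t + S))"
  have e: "0 < e" using S by (simp add: e_def)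
  \<comment> \<open>The three summands serve the growth bound, the increments in space and the
    increments in time.\<close>
  define L where "L = (r + 1) * e + (4 * r\<^sup>2 * e\<^sup>2 + e) + (4 * r\<^sup>2 * e ^ 3 + (r + 1) * e\<^sup>2)"
  have pos: "0 \<le> (r + 1) * e" "0 \<le> 4 * r\<^sup>2 * e\<^sup>2 + e" "0 \<le> 4 * r\<^sup>2 * e ^ 3 + (r + 1) * e\<^sup>2"
    using r e by auto
  have inv: "0 < 1 / (1 - (t + s))" "1 / (1 - (t + s)) \<le> e" if "s \<le> S" for s
    unfolding e_def using that S by (auto intro: divide_left_mono)
  note h = post_mean_abs_le[OF r p]
  show ?thesis
  proof
    show "0 \<le> L" unfolding L_def using pos by simp
    show "\<bar>drift r p t s x\<bar> \<le> L * (1 + \<bar>x\<bar>)" if s: "s \<in> {0..S}" for s x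
    proof -
      have "\<bar>drift r p t s x\<bar> = \<bar>post_mean r p (t + s) x - x\<bar> * (1 / (1 - (t + s)))"
        using s S by (simp add: drift_def abs_divide)
      also have "\<dots> \<le> ((r + 1) * (1 + \<bar>x\<bar>)) * e"
      proof (rule mult_mono)
        have "\<bar>post_mean r p (t + s) x - x\<bar> \<le> r + \<bar>x\<bar>" using h[of "t + s" x] by linarith
        also have "\<dots> \<le> (r + 1) * (1 + \<bar>x\<bar>)" using r by (simp add: algebra_simps)
        finally show "\<bar>post_mean r p (t + s) x - x\<bar> \<le> (r + 1) * (1 + \<bar>x\<bar>)" .
      qed (use inv[of s] s r in auto)
      also have "\<dots> = ((r + 1) * e) * (1 + \<bar>x\<bar>)" by simp
      also have "\<dots> \<le> L * (1 + \<bar>x\<bar>)" unfolding L_def using pos by (intro mult_right_mono) auto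
      finally show ?thesis .
    qed
    show "\<bar>drift r p t u y - drift r p t s x\<bar> \<le> L * (\<bar>y - x\<bar> + (u - s) * (1 + \<bar>x\<bar>))"
      if su: "0 \<le> s" "s \<le> u" "u \<le> S" for s u x y
    proof -
      define a c where "a = 1 / (1 - (t + u))" and "c = 1 / (1 - (t + s))"
      have a: "0 < a" "a \<le> e" and c: "0 < c" "c \<le> e"
        using inv[of u] inv[of s] su by (auto simp: a_def c_def)
      have ac: "a - c = (u - s) * (a * c)"
        using su S by (simp add: a_def c_def divide_simps)
      then have ac_le: "\<bar>a - c\<bar> \<le> (u - s) * e\<^sup>2"
        using a c su by (simp add: abs_mult power2_eq_square mult_mono)
      let ?h = "post_mean r p (t + s) x" and ?k = "post_mean r p (t + u) y"
      have "\<bar>?k - ?h\<bar> \<le> 2 * r * \<bar>post_weight r p (t + u) y - post_weight r p (t + s) x\<bar>"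
      proof -
        have "?k - ?h = 2 * r * (post_weight r p (t + u) y - post_weight r p (t + s) x)"
          by (simp add: post_mean_eq[OF p] algebra_simps)
        then show ?thesis using r by (simp add: abs_mult)
      qed
      also have "\<dots> \<le> 2 * r * \<bar>2 * r * y * a - 2 * r * x * c\<bar>"
        using logistic_lipschitz[of "p / (1 - p)" "2 * r * y / (1 - (t + u))" "2 * r * x / (1 - (t + s))"] r p
        by (intro mult_left_mono) (auto simp: post_weight_def a_def c_def)
      also have "2 * r * y * a - 2 * r * x * c = 2 * r * ((y - x) * a + x * (a - c))" by algebra
      also have "2 * r * \<bar>2 * r * ((y - x) * a + x * (a - c))\<bar> \<le> 2 * r * (2 * r * (\<bar>y - x\<bar> * e + \<bar>x\<bar> * ((u - s) * e\<^sup>2)))"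
      proof -
        have "\<bar>(y - x) * a + x * (a - c)\<bar> \<le> \<bar>y - x\<bar> * a + \<bar>x\<bar> * \<bar>a - c\<bar>"
          using a by (intro order_trans[OF abs_triangle_ineq]) (simp add: abs_mult)
        also have "\<dots> \<le> \<bar>y - x\<bar> * e + \<bar>x\<bar> * ((u - s) * e\<^sup>2)"
          using a ac_le by (intro add_mono mult_left_mono) auto
        finally show ?thesis using r by (simp add: abs_mult mult_left_mono)
      qed
      finally have hk: "\<bar>?k - ?h\<bar> \<le> 4 * r\<^sup>2 * (\<bar>y - x\<bar> * e + \<bar>x\<bar> * ((u - s) * e\<^sup>2))"
        by (simp add: power2_eq_square)
      \<comment> \<open>The increment is split into the changes of the posterior mean, of the
        position and of the remaining time.\<close>
      have "drift r p t u y - drift r p t s x = (?k - ?h) * a - (y - x) * a + (?h - x) * (a - c)"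
        unfolding drift_def a_def c_def by (simp add: algebra_simps diff_divide_distrib)
      also have "\<bar>\<dots>\<bar> \<le> \<bar>?k - ?h\<bar> * a + \<bar>y - x\<bar> * a + \<bar>?h - x\<bar> * \<bar>a - c\<bar>"
        using a by (intro order_trans[OF abs_triangle_ineq] order_trans[OF abs_triangle_ineq4] add_mono)
          (auto simp: abs_mult intro: order_trans[OF abs_triangle_ineq4])
      also have "\<dots> \<le> (4 * r\<^sup>2 * (\<bar>y - x\<bar> * e + \<bar>x\<bar> * ((u - s) * e\<^sup>2))) * e + \<bar>y - x\<bar> * e
          + (r + \<bar>x\<bar>) * ((u - s) * e\<^sup>2)"
        using a hk ac_le h[of "t + s" x] e su r by (intro add_mono mult_mono) auto
      also have "\<dots> = (4 * r\<^sup>2 * e\<^sup>2 + e) * \<bar>y - x\<bar> + (u - s) * (4 * r\<^sup>2 * e ^ 3 * \<bar>x\<bar> + (r + \<bar>x\<bar>) * e\<^sup>2)"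
        by (simp add: power2_eq_square power3_eq_cube algebra_simps)
      also have "\<dots> \<le> L * \<bar>y - x\<bar> + (u - s) * (L * (1 + \<bar>x\<bar>))"
      proof (intro add_mono mult_right_mono mult_left_mono)
        show "4 * r\<^sup>2 * e\<^sup>2 + e \<le> L" unfolding L_def using pos by simp
        have "4 * r\<^sup>2 * e ^ 3 * \<bar>x\<bar> + (r + \<bar>x\<bar>) * e\<^sup>2
            \<le> 4 * r\<^sup>2 * e ^ 3 * (1 + \<bar>x\<bar>) + ((r + 1) * (1 + \<bar>x\<bar>)) * e\<^sup>2"
          using r e by (intro add_mono mult_left_mono mult_right_mono) (auto simp: algebra_simps)
        also have "\<dots> = (4 * r\<^sup>2 * e ^ 3 + (r + 1) * e\<^sup>2) * (1 + \<bar>x\<bar>)" by (simp add: algebra_simps)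
        also have "\<dots> \<le> L * (1 + \<bar>x\<bar>)" unfolding L_def using pos by (intro mult_right_mono) auto
        finally show "4 * r\<^sup>2 * e ^ 3 * \<bar>x\<bar> + (r + \<bar>x\<bar>) * e\<^sup>2 \<le> L * (1 + \<bar>x\<bar>)" .
      qed (use su in auto)
      finally show ?thesis by (simp add: algebra_simps)
    qed
  qed
qed

lemma bridge_solution_lipschitz_sde:
  assumes bridge: "bridge_solution r p t z M F W Z"
    and r: "0 < r" and p: "0 < p" "p < 1" and S: "0 < S" "t + S < 1"
  obtains L where "lipschitz_sde M F W (\<lambda>s. Z (t + s)) (drift r p t) S L z"
proof -
  obtain L where L: "0 \<le> L"
    "\<And>s x. s \<in> {0..S} \<Longrightarrow> \<bar>drift r p t s x\<bar> \<le> L * (1 + \<bar>x\<bar>)"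
    "\<And>s u x y. 0 \<le> s \<Longrightarrow> s \<le> u \<Longrightarrow> u \<le> S \<Longrightarrow>
      \<bar>drift r p t u y - drift r p t s x\<bar> \<le> L * (\<bar>y - x\<bar> + (u - s) * (1 + \<bar>x\<bar>))"
    using drift_lipschitz_growth[OF r p S(2)] by blast
  have bm: "brownian_motion M F W" using bridge by (simp add: bridge_solution_def)
  have Z_cont: "continuous_on {0..S} (\<lambda>s. Z (t + s) \<omega>)" if "\<omega> \<in> space M" for \<omega>
  proof -
    have "continuous_on {t..<1} (\<lambda>u. Z u \<omega>)" using bridge that by (simp add: bridge_solution_def)
    then show ?thesis
      by (rule continuous_on_compose2) (use S in \<open>auto intro!: continuous_intros\<close>)
  qed
  have sde: "AE \<omega> in M. \<forall>s\<in>{0..S}. Z (t + s) \<omega>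
      = z + integral {0..s} (\<lambda>u. drift r p t u (Z (t + u) \<omega>)) + W s \<omega>"
  proof -
    have "AE \<omega> in M. \<forall>s\<in>{0..<1 - t}. Z (t + s) \<omega>
        = z + integral {0..s} (\<lambda>u. drift r p t u (Z (t + u) \<omega>)) + W s \<omega>"
      using bridge unfolding drift_def by (simp add: bridge_solution_def)
    then show ?thesis by eventually_elim (use S in auto)
  qed
  have "prob_space M" using bm by (simp add: brownian_motion_def)
  then have "lipschitz_sde M F W (\<lambda>s. Z (t + s)) (drift r p t) S L z"
    unfolding lipschitz_sde_def lipschitz_sde_axioms_def
    using bm S L Z_cont sde bridge by (auto simp: bridge_solution_def)
  then show ?thesis by (rule that)
qed

section \<open>Barriers at negative starting points\<close>

text \<open>A Taylor bound with second derivative 2 that holds across the kink of the derivative as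
  well, since \<open>max 0 y <= |max 0 x + (y - x)|\<close>.\<close>

lemma pos_part_square_le:
  fixes x y :: real
  shows "(max 0 y)\<^sup>2 \<le> (max 0 x)\<^sup>2 + 2 * max 0 x * (y - x) + (y - x)\<^sup>2"
proof -
  have "\<bar>max 0 y\<bar> \<le> \<bar>max 0 x + (y - x)\<bar>" by (auto simp: max_def)
  then have "(max 0 y)\<^sup>2 \<le> (max 0 x + (y - x))\<^sup>2" by (simp only: abs_le_square_iff)
  then show ?thesis by (simp add: power2_sum)
qed

text \<open>Here \<open>1 / k\<close> is half the distance from \<open>- r\<close> to
  \<open>z\<close>. The size of \<kappa> makes \<open>inner\<close> exceed \<open>outer\<close> from
  \<open>z / 2\<close> on, where \<open>x - z\<close> is at least \<open>- z / 2\<close>. \<Gamma>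
  adds up the bounds \<open>k\<close> and \<open>2 * \<kappa>\<close> for the second derivatives of
  the two squares in \<open>inner\<close>. The conditions in \<open>small\<close> hold for
  \<open>t\<close> close to 1; in turn they keep the left edge at or below \<open>z\<close>, bound
  the time term of \<open>outer\<close> by 1, and make the posterior weight of \<open>r\<close>
  negligible.\<close>

locale bridge_barrier =
  fixes r p t z k \<kappa> \<Gamma> :: real
  assumes r: "0 < r" and p: "0 < p" "p < 1" and z: "- r < z" "z < 0" and t: "0 \<le> t" "t < 1"
    and k_def: "k = 2 / (r + z)"
    and \<kappa>_def: "\<kappa> = 2 + (2 * r + 2) / (z / 2)\<^sup>2"
    and \<Gamma>_def: "\<Gamma> = k + 2 * \<kappa>"
    and small: "\<Gamma> * (1 - t) \<le> (r + z) / 2" "\<Gamma> * (1 - t) \<le> 2"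
      "8 * r * (p / (1 - p)) * (1 - t) \<le> \<Gamma> * (r * z)\<^sup>2"
begin

text \<open>Outside \<open>[- r, r]\<close> the drift points inwards, so the convex squares cost
  only their second derivatives, and the decrease of the time term pays for these. The number
  \<open>1 / 4\<close> comes from \<open>(y - r - 1/2)^2 >= 0\<close>, that is,
  \<open>y <= r + 1/4 + (y - r)^2\<close>.\<close>

definition outer :: "real \<Rightarrow> real \<Rightarrow> real" where
  "outer s x = r + 1 / 4 + ((max 0 (x - r))\<^sup>2 + (max 0 (- x - r))\<^sup>2) + \<Gamma> / 2 * (1 - (t + s))"

definition outer_slope :: "real \<Rightarrow> real \<Rightarrow> real" where
  "outer_slope s x = 2 * max 0 (x - r) - 2 * max 0 (- x - r)"

text \<open>To the left of \<open>left_edge\<close> the drift is not negative enough, and to the right of \<open>z\<close> the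
  atom at \<open>r\<close> comes into play; in between \<open>inner\<close> is the gain function itself. The edge recedes
  at rate \<open>\<Gamma>\<close>, which compensates the second derivatives of \<open>inner\<close>.\<close>

definition left_edge :: "real \<Rightarrow> real" where
  "left_edge s = - r + 1 / k + \<Gamma> * (1 - (t + s))"

definition inner :: "real \<Rightarrow> real \<Rightarrow> real" where
  "inner s x = x + k / 2 * (max 0 (left_edge s - x))\<^sup>2 + \<kappa> * (max 0 (x - z))\<^sup>2"

definition inner_slope :: "real \<Rightarrow> real \<Rightarrow> real" where
  "inner_slope s x = 1 - k * max 0 (left_edge s - x) + 2 * \<kappa> * max 0 (x - z)"

definition barrier :: "real \<Rightarrow> real \<Rightarrow> real" where
  "barrier s x = min (inner s x) (outer s x)"

definition barrier_slope :: "real \<Rightarrow> real \<Rightarrow> real" where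
  "barrier_slope s x = (if inner s x \<le> outer s x then inner_slope s x else outer_slope s x)"

section \<open>Size of the two branches and of the posterior weight\<close>

lemma k_pos: "0 < k" and \<kappa>_ge: "2 \<le> \<kappa>" and \<Gamma>_ge: "4 \<le> \<Gamma>"
proof -
  show "0 < k" "2 \<le> \<kappa>" using z r by (auto simp: k_def \<kappa>_def)
  then show "4 \<le> \<Gamma>" by (simp add: \<Gamma>_def)
qed

lemma left_edge_le: "0 \<le> s \<Longrightarrow> left_edge s \<le> z"
proof -
  assume "0 \<le> s"
  then have "\<Gamma> * (1 - (t + s)) \<le> \<Gamma> * (1 - t)" using \<Gamma>_ge by (intro mult_left_mono) auto
  moreover have "1 / k = (r + z) / 2" by (simp add: k_def)
  ultimately show ?thesis using small(1) unfolding left_edge_def by argo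
qed

lemma left_edge_ge: "t + s < 1 \<Longrightarrow> - r + 1 / k \<le> left_edge s"
  using \<Gamma>_ge by (simp add: left_edge_def)

lemma outer_ge:
  assumes "t + s < 1" shows "\<bar>x\<bar> \<le> outer s x"
proof -
  have "y \<le> r + 1 / 4 + (max 0 (y - r))\<^sup>2" for y
  proof (cases "y \<le> r")
    case False
    then show ?thesis using zero_le_power2[of "y - r - 1 / 2"]
      by (simp add: power2_diff max_def power2_eq_square algebra_simps)
  qed (auto intro: order_trans[of y r])
  from this[of x] this[of "- x"] have "\<bar>x\<bar> \<le> r + 1 / 4 + ((max 0 (x - r))\<^sup>2 + (max 0 (- x - r))\<^sup>2)"
    using zero_le_power2[of "max 0 (x - r)"] zero_le_power2[of "max 0 (- x - r)"] by linarith
  then show ?thesis using assms \<Gamma>_ge by (simp add: outer_def add_increasing2)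
qed

text \<open>Left of the edge the parabola stops the descent of the gain:
  \<open>k / 2 * u^2 - u\<close> is at least \<open>- 1 / (2 * k)\<close>, and the edge lies at
  least \<open>1 / k\<close> above \<open>- r\<close>. This lower bound is the one that Fatou's
  lemma needs.\<close>

lemma inner_ge:
  assumes "t + s < 1" shows "max x (- r) \<le> inner s x"
proof -
  let ?u = "max 0 (left_edge s - x)"
  have 1: "x \<le> inner s x" using k_pos \<kappa>_ge by (simp add: inner_def)
  have "0 \<le> k / 2 * (?u - 1 / k)\<^sup>2" using k_pos by simp
  also have "\<dots> = k / 2 * ?u\<^sup>2 - ?u + 1 / (2 * k)"
    using k_pos by (simp add: power2_diff field_simps power2_eq_square)
  finally have "?u - 1 / (2 * k) \<le> k / 2 * ?u\<^sup>2" by simp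
  moreover have "left_edge s - x \<le> ?u" by simp
  moreover have "1 / (2 * k) \<le> 1 / k" using k_pos by (simp add: field_simps)
  moreover have "0 \<le> \<kappa> * (max 0 (x - z))\<^sup>2" using \<kappa>_ge by simp
  ultimately have "- r \<le> inner s x" using left_edge_ge[OF assms] unfolding inner_def by linarith
  with 1 show ?thesis by simp
qed

lemma barrier_ge: "t + s < 1 \<Longrightarrow> max x (- r) \<le> barrier s x"
  using inner_ge[of s x] outer_ge[of s x] r by (auto simp: barrier_def)

lemma barrier_start: "barrier 0 z = z"
  using left_edge_le[of 0] outer_ge[of 0 z] t by (auto simp: barrier_def inner_def)

text \<open>In this range the left square of \<open>outer\<close> vanishes and the right one is at
  most \<open>(x - z)^2\<close>, so \<open>outer\<close> is at most
  \<open>r + 5/4 + (x - z)^2\<close>. The choice of \<kappa> lifts \<open>inner\<close> above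
  \<open>- r + (2 * r + 2) + 2 * (x - z)^2\<close>.\<close>

lemma outer_less_inner:
  assumes "0 \<le> s" "z / 2 \<le> x"
  shows "outer s x < inner s x"
proof -
  have x: "z < x" "- r < x" using assms z by auto
  have "\<Gamma> / 2 * (1 - (t + s)) \<le> \<Gamma> / 2 * (1 - t)" using \<Gamma>_ge assms by (intro mult_left_mono) auto
  then have T: "\<Gamma> / 2 * (1 - (t + s)) \<le> 1" using small(2) by simp
  have "(max 0 (x - r))\<^sup>2 \<le> (x - z)\<^sup>2" using x z r by (intro power_mono) auto
  moreover have "max 0 (- x - r) = 0" using x by simp
  ultimately have o: "outer s x \<le> r + 5 / 4 + (x - z)\<^sup>2" using T by (simp add: outer_def)
  have "(z / 2)\<^sup>2 \<le> (x - z)\<^sup>2"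
    using assms z by (intro abs_le_square_iff[THEN iffD1]) auto
  then have "(2 * r + 2) / (z / 2)\<^sup>2 * (z / 2)\<^sup>2 \<le> (2 * r + 2) / (z / 2)\<^sup>2 * (x - z)\<^sup>2"
    using r by (intro mult_left_mono) auto
  then have "2 * r + 2 \<le> (2 * r + 2) / (z / 2)\<^sup>2 * (x - z)\<^sup>2" using z by simp
  then have "2 * (x - z)\<^sup>2 + (2 * r + 2) \<le> \<kappa> * (x - z)\<^sup>2"
    by (simp add: \<kappa>_def distrib_right)
  moreover have "x + \<kappa> * (x - z)\<^sup>2 \<le> inner s x" using x k_pos by (simp add: inner_def)
  ultimately show ?thesis using o x zero_le_power2[of "x - z"] by linarith
qed

text \<open>The weight is at most \<open>\<rho> * exp (r * z / T)\<close>. Only a bound linear in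
  \<open>T\<close> is wanted, so \<open>exp (- v) <= 2 / v^2\<close> suffices: it yields
  \<open>T^2\<close>, and the third condition in \<open>small\<close> absorbs one factor. Since
  \<open>2 * r\<close> times the weight is the excess of the posterior mean over \<open>- r\<close>,
  the factor \<open>4 * r\<close> makes this excess at most half of
  \<open>\<Gamma> * T\<close>.\<close>

lemma post_weight_small:
  assumes "0 \<le> s" "t + s < 1" "x \<le> z / 2"
  shows "4 * r * post_weight r p (t + s) x \<le> \<Gamma> * (1 - (t + s))"
proof -
  define T where "T = 1 - (t + s)"
  have T: "0 < T" "T \<le> 1 - t" using assms by (auto simp: T_def)
  define \<rho> where "\<rho> = p / (1 - p)"
  have \<rho>: "0 < \<rho>" using p by (simp add: \<rho>_def)
  have "post_weight r p (t + s) x = \<rho> * exp (2 * r * x / T) / (\<rho> * exp (2 * r * x / T) + 1)"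
    by (simp add: post_weight_def \<rho>_def T_def)
  also have "\<dots> \<le> \<rho> * exp (2 * r * x / T) / 1"
    using \<rho> by (intro divide_left_mono) (auto intro: add_pos_pos)
  also have "\<dots> \<le> \<rho> * exp (r * z / T)"
  proof -
    have "2 * r * x \<le> r * z" using mult_left_mono[OF assms(3), of "2 * r"] r by simp
    then show ?thesis using \<rho> T by (simp add: divide_right_mono)
  qed
  also have "exp (r * z / T) \<le> 2 * T\<^sup>2 / (r * z)\<^sup>2"
  proof -
    define v where "v = - (r * z) / T"
    have v: "0 < v" using r z T by (simp add: v_def divide_simps mult_pos_neg)
    have "v\<^sup>2 / 2 \<le> exp v" using exp_lower_Taylor_quadratic[of v] v by simp
    then have "inverse (exp v) \<le> inverse (v\<^sup>2 / 2)" using v by (intro le_imp_inverse_le) auto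
    then have "exp (- v) \<le> 2 / v\<^sup>2" by (simp add: exp_minus)
    then show ?thesis by (simp add: v_def power_divide)
  qed
  finally have "post_weight r p (t + s) x \<le> \<rho> * (2 * T\<^sup>2 / (r * z)\<^sup>2)" using \<rho> by simp
  then have "4 * r * post_weight r p (t + s) x \<le> 4 * r * (\<rho> * (2 * T\<^sup>2 / (r * z)\<^sup>2))"
    using r by (intro mult_left_mono) auto
  also have "\<dots> = (8 * r * \<rho> * T / (r * z)\<^sup>2) * T" by (simp add: power2_eq_square)
  also have "\<dots> \<le> \<Gamma> * T"
  proof (rule mult_right_mono)
    have "8 * r * \<rho> * T \<le> 8 * r * \<rho> * (1 - t)" using T r \<rho> by (intro mult_left_mono) auto
    with small(3) have "8 * r * \<rho> * T \<le> \<Gamma> * (r * z)\<^sup>2" by (simp add: \<rho>_def)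
    then show "8 * r * \<rho> * T / (r * z)\<^sup>2 \<le> \<Gamma>" using r z by (simp add: divide_le_eq)
  qed (use T in auto)
  finally show ?thesis by (simp add: T_def)
qed

text \<open>The slope vanishes on \<open>[- r, r]\<close>, which contains the posterior mean;
  outside, the drift points back to this interval, against the slope.\<close>

lemma outer_drift: "t + s < 1 \<Longrightarrow> outer_slope s x * drift r p t s x \<le> 0"
  using post_mean_abs_le[OF r p, of "t + s" x]
  unfolding drift_def outer_slope_def
  by (cases "x > r"; cases "x < - r") 
    (auto simp: max_def divide_simps mult_nonneg_nonpos mult_nonpos_nonneg not_less)

text \<open>The right-hand side is the rate at which \<open>inner\<close> falls in time because its
  edge recedes at rate \<Gamma>. So this is the differential inequality of a supersolution, with the
  second derivative replaced by its bound.\<close>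

lemma inner_drift:
  assumes "0 \<le> s" "t + s < 1" "x \<le> z / 2"
  shows "inner_slope s x * drift r p t s x + \<Gamma> / 2 \<le> k * \<Gamma> * max 0 (left_edge s - x)"
proof -
  define T where "T = 1 - (t + s)"
  have T: "0 < T" using assms by (simp add: T_def)
  define q where "q = 2 * r * post_weight r p (t + s) x"
  have q: "0 \<le> q" "q \<le> \<Gamma> * T / 2"
    using post_weight_small[OF assms] post_weight_bounds[OF p, of r "t + s" x] r
    by (auto simp: q_def T_def)
  have m: "post_mean r p (t + s) x = q - r"
    by (simp add: post_mean_eq[OF p] q_def algebra_simps)
  define u where "u = left_edge s - x"
  have x: "x = - r + 1 / k + \<Gamma> * T - u" by (simp add: u_def left_edge_def T_def)
  have d: "drift r p t s x = (q - r - x) / T" by (simp add: drift_def m T_def)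
  have "inner_slope s x * (q - r - x) + \<Gamma> / 2 * T \<le> k * \<Gamma> * max 0 u * T"
  proof (cases "0 \<le> u")
    case True
    then have "x \<le> z" using left_edge_le[OF assms(1)] by (simp add: u_def)
    then have sl: "inner_slope s x = 1 - k * u" using True by (simp add: inner_slope_def u_def)
    \<comment> \<open>The factors \<open>1 - k * u\<close> and \<open>u - 1 / k\<close> have
      opposite signs, whence the negative square; the offset \<open>1 / k\<close> in
      \<open>left_edge\<close> is chosen for this. The terms with
      \<open>k * u * \<Gamma> * T\<close> cancel against the recession of the edge.\<close>
    have "inner_slope s x * (q - r - x) + \<Gamma> / 2 * T - k * \<Gamma> * u * T
        = - (k * (u - 1 / k)\<^sup>2) - \<Gamma> / 2 * T + (1 - k * u) * q"
      unfolding sl unfolding x using k_pos by (simp add: power2_eq_square field_simps)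
    also have "\<dots> \<le> - \<Gamma> / 2 * T + q"
    proof -
      have "0 \<le> k * (u - 1 / k)\<^sup>2" using k_pos by simp
      moreover have "0 \<le> k * u * q" using k_pos True q by simp
      ultimately show ?thesis by (simp add: algebra_simps)
    qed
    also have "\<dots> \<le> 0" using q by simp
    finally show ?thesis using True by simp
  next
    case False
    have sl: "1 \<le> inner_slope s x" using False \<kappa>_ge by (simp add: inner_slope_def u_def)
    have "0 < 1 / k" using k_pos by simp
    \<comment> \<open>Right of the edge the drift alone pays: the position is more than
      \<open>\<Gamma> * T\<close> above \<open>- r\<close>, and \<open>q\<close> takes back at most
      half of that.\<close>
    then have neg: "q - r - x \<le> - (\<Gamma> / 2 * T)" unfolding x using q False by linarith
    have "inner_slope s x * (q - r - x) \<le> 1 * (q - r - x)"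
    proof (rule mult_right_mono_neg[OF sl])
      have "0 < \<Gamma> * T" using \<Gamma>_ge T by simp
      with neg show "q - r - x \<le> 0" by linarith
    qed
    with neg False show ?thesis by simp
  qed
  then have "(inner_slope s x * (q - r - x) + \<Gamma> / 2 * T) / T \<le> (k * \<Gamma> * max 0 u * T) / T"
    using T by (intro divide_right_mono) auto
  then show ?thesis using T by (simp add: d u_def add_divide_distrib)
qed

lemma outer_taylor:
  assumes "0 \<le> s" "s < v" "t + v < 1"
  shows "outer v y \<le> outer s x + outer_slope s x * (y - x - drift r p t s x * (v - s))
    + \<Gamma> / 2 * ((y - x)\<^sup>2 - (v - s))"
proof -
  have "0 \<le> - (outer_slope s x * drift r p t s x) * (v - s)"
    using outer_drift[of s x] assms by (intro mult_nonneg_nonneg) auto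
  \<comment> \<open>Each of the two squares contributes \<open>(y - x)^2\<close>, which explains the
    bound \<open>4 <= \<Gamma>\<close>.\<close>
  moreover have "2 * (y - x)\<^sup>2 \<le> \<Gamma> / 2 * (y - x)\<^sup>2" using \<Gamma>_ge by (intro mult_right_mono) auto
  ultimately show ?thesis
    using pos_part_square_le[of "y - r" "x - r"] pos_part_square_le[of "- y - r" "- x - r"]
    unfolding outer_def outer_slope_def
    by (simp add: algebra_simps add_divide_distrib diff_divide_distrib power2_commute)
qed

text \<open>Only the starting point is confined to \<open>x <= z / 2\<close>; the end point is
  arbitrary. During the step the edge moves by \<open>- \<Gamma> * d\<close>; beyond the term that
  \<open>inner_drift\<close> accounts for, this adds products of \<open>d\<close> with
  \<open>y - x\<close> and with \<open>d\<close>, which form the remainder.\<close>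

lemma inner_taylor:
  assumes "0 \<le> s" "s < v" "t + v < 1" "x \<le> z / 2"
  shows "inner v y \<le> inner s x + inner_slope s x * (y - x - drift r p t s x * (v - s))
    + \<Gamma> / 2 * ((y - x)\<^sup>2 - (v - s)) + (k * \<Gamma> + k * \<Gamma>\<^sup>2) * ((v - s) * (\<bar>y - x\<bar> + (v - s)))"
proof -
  define d where "d = v - s"
  have d: "0 < d" using assms by (simp add: d_def)
  define A where "A = max 0 (left_edge s - x)"
  have A: "0 \<le> A" by (simp add: A_def)
  have edge: "(left_edge v - y) - (left_edge s - x) = - (y - x) - \<Gamma> * d"
    by (simp add: left_edge_def d_def algebra_simps)
  have "(max 0 (left_edge v - y))\<^sup>2 \<le> A\<^sup>2 + 2 * A * (- (y - x) - \<Gamma> * d) + (- (y - x) - \<Gamma> * d)\<^sup>2"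
    using pos_part_square_le[of "left_edge v - y" "left_edge s - x"] unfolding edge A_def .
  then have 1: "k / 2 * (max 0 (left_edge v - y))\<^sup>2
      \<le> k / 2 * (A\<^sup>2 + 2 * A * (- (y - x) - \<Gamma> * d) + (- (y - x) - \<Gamma> * d)\<^sup>2)"
    using k_pos by (intro mult_left_mono) auto
  have 2: "\<kappa> * (max 0 (y - z))\<^sup>2 \<le> \<kappa> * ((max 0 (x - z))\<^sup>2 + 2 * max 0 (x - z) * (y - x) + (y - x)\<^sup>2)"
    using pos_part_square_le[of "y - z" "x - z"] \<kappa>_ge by (intro mult_left_mono) auto
  have 3: "(inner_slope s x * drift r p t s x + \<Gamma> / 2) * d \<le> (k * \<Gamma> * A) * d"
    using inner_drift[OF assms(1) _ assms(4)] assms d unfolding A_def by (intro mult_right_mono) auto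
  have 4: "k * \<Gamma> * d * (y - x) \<le> k * \<Gamma> * d * \<bar>y - x\<bar>"
    using k_pos \<Gamma>_ge d by (intro mult_left_mono) auto
  have 5: "0 \<le> k * \<Gamma> * d * d" "0 \<le> k * \<Gamma>\<^sup>2 * d * \<bar>y - x\<bar>" "0 \<le> k * \<Gamma>\<^sup>2 * d * d"
    using k_pos \<Gamma>_ge d by auto
  have "inner v y \<le> y + k / 2 * (A\<^sup>2 + 2 * A * (- (y - x) - \<Gamma> * d) + (- (y - x) - \<Gamma> * d)\<^sup>2)
      + \<kappa> * ((max 0 (x - z))\<^sup>2 + 2 * max 0 (x - z) * (y - x) + (y - x)\<^sup>2)"
    unfolding inner_def using 1 2 by linarith
  \<comment> \<open>The two squares contribute \<open>(k / 2 + \<kappa>) * (y - x)^2\<close>, and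
    the coefficient is exactly \<open>\<Gamma> / 2\<close>.\<close>
  also have "\<dots> = inner s x + inner_slope s x * (y - x) + \<Gamma> / 2 * (y - x)\<^sup>2
      - k * \<Gamma> * A * d + k * \<Gamma> * d * (y - x) + k * \<Gamma>\<^sup>2 * d * d / 2"
    unfolding inner_def inner_slope_def A_def[symmetric]
    unfolding \<Gamma>_def
    by (simp add: power2_eq_square field_simps)
  also have "\<dots> \<le> inner s x + inner_slope s x * (y - x - drift r p t s x * d)
    + \<Gamma> / 2 * ((y - x)\<^sup>2 - d) + (k * \<Gamma> + k * \<Gamma>\<^sup>2) * (d * (\<bar>y - x\<bar> + d))"
    using 3 4 5 by (simp add: algebra_simps)
  finally show ?thesis by (simp add: d_def)
qed

section \<open>Growth bounds and the supersolution property\<close>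

lemma outer_bounds:
  assumes "0 \<le> s" "t + s < 1"
  shows "outer s x \<le> (r + 1 + \<Gamma>) * (1 + \<bar>x\<bar>)\<^sup>2" "\<bar>outer_slope s x\<bar> \<le> 2 * (1 + \<bar>x\<bar>)"
proof -
  have "(max 0 (x - r))\<^sup>2 + (max 0 (- x - r))\<^sup>2 \<le> \<bar>x\<bar>\<^sup>2"
    using r by (cases "0 \<le> x") (auto simp: max_def abs_le_square_iff[symmetric])
  moreover have "\<Gamma> / 2 * (1 - (t + s)) \<le> \<Gamma> * 1"
    using \<Gamma>_ge assms t by (intro mult_mono) auto
  ultimately have "outer s x \<le> (r + 1 + \<Gamma>) * 1 + 1 * \<bar>x\<bar>\<^sup>2" by (simp add: outer_def)
  also have "\<dots> \<le> (r + 1 + \<Gamma>) * (1 + \<bar>x\<bar>\<^sup>2)"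
    unfolding distrib_left using r \<Gamma>_ge by (intro add_mono mult_right_mono) auto
  also have "\<dots> \<le> (r + 1 + \<Gamma>) * (1 + \<bar>x\<bar>)\<^sup>2"
    using r \<Gamma>_ge by (intro mult_left_mono) (auto simp: power2_sum)
  finally show "outer s x \<le> (r + 1 + \<Gamma>) * (1 + \<bar>x\<bar>)\<^sup>2" .
  show "\<bar>outer_slope s x\<bar> \<le> 2 * (1 + \<bar>x\<bar>)" using r by (auto simp: outer_slope_def max_def)
qed

lemma inner_slope_bound:
  assumes "0 \<le> s" "t + s < 1"
  shows "\<bar>inner_slope s x\<bar> \<le> (1 + k * (1 + r) + 2 * \<kappa> * (1 + r)) * (1 + \<bar>x\<bar>)"
proof -
  have le: "c + \<bar>x\<bar> \<le> (1 + c) * (1 + \<bar>x\<bar>)" if "0 \<le> c" for c using that by (simp add: algebra_simps)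
  have "\<bar>left_edge s\<bar> \<le> r"
    using left_edge_le[OF assms(1)] left_edge_ge[OF assms(2)] z k_pos zero_less_divide_1_iff[of k] by linarith
  then have "max 0 (left_edge s - x) \<le> r + \<bar>x\<bar>" by auto
  also have "\<dots> \<le> (1 + r) * (1 + \<bar>x\<bar>)" using r by (intro le) auto
  finally have 1: "k * max 0 (left_edge s - x) \<le> k * ((1 + r) * (1 + \<bar>x\<bar>))"
    using k_pos by (intro mult_left_mono) auto
  have "max 0 (x - z) \<le> r + \<bar>x\<bar>" using z r by auto
  also have "\<dots> \<le> (1 + r) * (1 + \<bar>x\<bar>)" using r by (intro le) auto
  finally have 2: "2 * \<kappa> * max 0 (x - z) \<le> 2 * \<kappa> * ((1 + r) * (1 + \<bar>x\<bar>))"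
    using \<kappa>_ge by (intro mult_left_mono) auto
  have "0 \<le> k * max 0 (left_edge s - x)" "0 \<le> 2 * \<kappa> * max 0 (x - z)" using k_pos \<kappa>_ge by auto
  with 1 2 have "\<bar>inner_slope s x\<bar> \<le> (1 + \<bar>x\<bar>) + k * ((1 + r) * (1 + \<bar>x\<bar>)) + 2 * \<kappa> * ((1 + r) * (1 + \<bar>x\<bar>))"
    unfolding inner_slope_def by linarith
  then show ?thesis by (simp add: algebra_simps)
qed

lemma outer_supersolution:
  assumes "t + S < 1"
  shows "supersolution (drift r p t) S outer outer_slope \<Gamma> (r + 2 + \<Gamma>)"
  unfolding supersolution_def
proof (intro conjI ballI allI impI)
  show "0 \<le> r + 2 + \<Gamma>" using r \<Gamma>_ge by simp
  fix s x :: real assume s: "s \<in> {0..S}"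
  show "outer s \<in> borel_measurable borel" "outer_slope s \<in> borel_measurable borel"
    unfolding outer_def outer_slope_def by measurable
  have "\<bar>outer s x\<bar> = outer s x" using outer_ge[of s x] s assms by simp
  also have "\<dots> \<le> (r + 1 + \<Gamma>) * (1 + \<bar>x\<bar>)\<^sup>2" using s assms by (intro outer_bounds) auto
  also have "\<dots> \<le> (r + 2 + \<Gamma>) * (1 + \<bar>x\<bar>)\<^sup>2" by (intro mult_right_mono) auto
  finally show "\<bar>outer s x\<bar> \<le> (r + 2 + \<Gamma>) * (1 + \<bar>x\<bar>)\<^sup>2" .
  have "\<bar>outer_slope s x\<bar> \<le> 2 * (1 + \<bar>x\<bar>)" using s assms by (intro outer_bounds) auto
  also have "\<dots> \<le> (r + 2 + \<Gamma>) * (1 + \<bar>x\<bar>)" using r \<Gamma>_ge by (intro mult_right_mono) auto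
  finally show "\<bar>outer_slope s x\<bar> \<le> (r + 2 + \<Gamma>) * (1 + \<bar>x\<bar>)" .
next
  fix s u x y :: real assume su: "0 \<le> s" "s < u" "u \<le> S"
  have "0 \<le> (r + 2 + \<Gamma>) * ((u - s) * (\<bar>y - x\<bar> + (u - s)))" using r \<Gamma>_ge su by simp
  with outer_taylor[of s u y x] su assms
  show "outer u y \<le> outer s x + outer_slope s x * (y - x - drift r p t s x * (u - s))
    + \<Gamma> / 2 * ((y - x)\<^sup>2 - (u - s)) + (r + 2 + \<Gamma>) * ((u - s) * (\<bar>y - x\<bar> + (u - s)))"
    by linarith
qed

lemma barrier_supersolution:
  assumes "t + S < 1"
  obtains K where "supersolution (drift r p t) S barrier barrier_slope \<Gamma> K"
proof
  define K1 where "K1 = 1 + k * (1 + r) + 2 * \<kappa> * (1 + r)"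
  define K2 where "K2 = k * \<Gamma> + k * \<Gamma>\<^sup>2"
  have K12: "0 \<le> K1" "0 \<le> K2" using k_pos \<kappa>_ge \<Gamma>_ge r by (auto simp: K1_def K2_def)
  define K where "K = (r + 2 + \<Gamma>) + K1 + K2"
  have K: "0 \<le> K" "K1 \<le> K" "K2 \<le> K" "r + 2 + \<Gamma> \<le> K"
    using K12 r \<Gamma>_ge by (auto simp: K_def)
  show "supersolution (drift r p t) S barrier barrier_slope \<Gamma> K"
    unfolding supersolution_def
  proof (intro conjI ballI allI impI)
    show "0 \<le> K" by fact
    fix s x :: real assume s: "s \<in> {0..S}"
    have m [measurable]: "inner s \<in> borel_measurable borel" "outer s \<in> borel_measurable borel"
      "inner_slope s \<in> borel_measurable borel" "outer_slope s \<in> borel_measurable borel"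
      unfolding inner_def outer_def inner_slope_def outer_slope_def by measurable
    show "barrier s \<in> borel_measurable borel" "barrier_slope s \<in> borel_measurable borel"
      unfolding barrier_def barrier_slope_def by measurable
    have sq1: "1 \<le> (1 + \<bar>x\<bar>)\<^sup>2" by simp
    have "- r \<le> barrier s x" using barrier_ge[of s x] s assms by simp
    moreover have "barrier s x \<le> (r + 1 + \<Gamma>) * (1 + \<bar>x\<bar>)\<^sup>2"
      using outer_bounds(1)[of s x] s assms by (simp add: barrier_def min.coboundedI2)
    moreover have "r * 1 \<le> K * (1 + \<bar>x\<bar>)\<^sup>2"
      using K sq1 r \<Gamma>_ge by (intro mult_mono) auto
    moreover have "(r + 1 + \<Gamma>) * (1 + \<bar>x\<bar>)\<^sup>2 \<le> K * (1 + \<bar>x\<bar>)\<^sup>2"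
      using K by (intro mult_right_mono) auto
    ultimately show "\<bar>barrier s x\<bar> \<le> K * (1 + \<bar>x\<bar>)\<^sup>2" by linarith
    have "K1 * (1 + \<bar>x\<bar>) \<le> K * (1 + \<bar>x\<bar>)" "2 * (1 + \<bar>x\<bar>) \<le> K * (1 + \<bar>x\<bar>)"
      by (intro mult_right_mono; use K r \<Gamma>_ge in simp)+
    with inner_slope_bound[of s x] outer_bounds(2)[of s x] s assms
    show "\<bar>barrier_slope s x\<bar> \<le> K * (1 + \<bar>x\<bar>)"
      by (auto simp: barrier_slope_def K1_def)
  next
    fix s u x y :: real assume su: "0 \<le> s" "s < u" "u \<le> S"
    let ?e = "(u - s) * (\<bar>y - x\<bar> + (u - s))"
    have e: "0 \<le> ?e" using su by simp
    show "barrier u y \<le> barrier s x + barrier_slope s x * (y - x - drift r p t s x * (u - s))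
      + \<Gamma> / 2 * ((y - x)\<^sup>2 - (u - s)) + K * ?e"
    \<comment> \<open>At the end point the minimum is bounded by the branch that attains it at the
      starting point, so the Taylor bound of that branch applies. For \<open>inner\<close> to be
      this branch, \<open>x\<close> must lie left of \<open>z / 2\<close>, by
      \<open>outer_less_inner\<close>.\<close>
    proof (cases "inner s x \<le> outer s x")
      case True
      then have x: "x \<le> z / 2" using outer_less_inner[OF su(1), of x] by force
      have "K2 * ?e \<le> K * ?e" using K e by (intro mult_right_mono) auto
      moreover have "barrier u y \<le> inner u y" by (simp add: barrier_def)
      moreover have "barrier s x = inner s x" "barrier_slope s x = inner_slope s x"
        using True by (simp_all add: barrier_def barrier_slope_def)
      moreover have "t + u < 1" using su assms by simp
      note inner_taylor[OF su(1,2) this x, of y, folded K2_def]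
      ultimately show ?thesis by (simp only:)
    next
      case False
      have "0 \<le> K * ?e" using K e by simp
      moreover have "barrier u y \<le> outer u y" by (simp add: barrier_def)
      ultimately show ?thesis
        using outer_taylor[OF su(1,2), of y x] su assms False
        by (simp add: barrier_def barrier_slope_def)
    qed
  qed
qed

end

section \<open>Stopping times up to the terminal time\<close>

text \<open>Fatou's lemma asks for no dominating function, and an upper bound for the limit is all
  that optional stopping has to deliver.\<close>

lemma (in prob_space) fatou_expectation_le:
  fixes f :: "nat \<Rightarrow> 'a \<Rightarrow> real"
  assumes int: "\<And>m. integrable M (f m)" and nonneg: "\<And>m \<omega>. 0 \<le> f m \<omega>" "\<And>\<omega>. 0 \<le> g \<omega>"
    and g: "g \<in> borel_measurable M"
    and lim: "AE \<omega> in M. (\<lambda>m. f m \<omega>) \<longlonglongrightarrow> g \<omega>"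
    and le: "\<And>m. expectation (f m) \<le> c m" and c: "c \<longlonglongrightarrow> l"
  shows "integrable M g" "expectation g \<le> l"
proof -
  have c0: "0 \<le> c m" for m using nonneg(1) by (intro order_trans[OF Bochner_Integration.integral_nonneg le[of m]])
  then have l0: "0 \<le> l" using c by (intro LIMSEQ_le_const[OF c]) auto
  have "(\<integral>\<^sup>+\<omega>. ennreal (g \<omega>) \<partial>M) = (\<integral>\<^sup>+\<omega>. liminf (\<lambda>m. ennreal (f m \<omega>)) \<partial>M)"
  proof (rule nn_integral_cong_AE)
    show "AE \<omega> in M. ennreal (g \<omega>) = liminf (\<lambda>m. ennreal (f m \<omega>))"
      using lim
    proof eventually_elim
      case (elim \<omega>)
      then have "(\<lambda>m. ennreal (f m \<omega>)) \<longlonglongrightarrow> ennreal (g \<omega>)" by (rule tendsto_ennrealI)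
      then show ?case by (simp add: lim_imp_Liminf)
    qed
  qed
  also have "\<dots> \<le> liminf (\<lambda>m. \<integral>\<^sup>+\<omega>. ennreal (f m \<omega>) \<partial>M)"
    using int by (intro nn_integral_liminf) auto
  also have "\<dots> \<le> liminf (\<lambda>m. ennreal (c m))"
  proof (rule Liminf_mono, intro always_eventually allI)
    fix m
    have "(\<integral>\<^sup>+\<omega>. ennreal (f m \<omega>) \<partial>M) = ennreal (expectation (f m))"
      using nonneg by (intro nn_integral_eq_integral int) auto
    also have "\<dots> \<le> ennreal (c m)" by (rule ennreal_leI[OF le])
    finally show "(\<integral>\<^sup>+\<omega>. ennreal (f m \<omega>) \<partial>M) \<le> ennreal (c m)" .
  qed
  also have "\<dots> = ennreal l"
    using tendsto_ennrealI[OF c] by (simp add: lim_imp_Liminf)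
  finally have nn: "(\<integral>\<^sup>+\<omega>. ennreal (g \<omega>) \<partial>M) \<le> ennreal l" .
  show gi: "integrable M g"
    using g nonneg(2) order.strict_trans1[OF nn] by (intro integrableI_nonneg) auto
  have "ennreal (expectation g) = (\<integral>\<^sup>+\<omega>. ennreal (g \<omega>) \<partial>M)"
    using nonneg(2) by (intro nn_integral_eq_integral[symmetric] gi) auto
  with nn have "ennreal (expectation g) \<le> ennreal l" by simp
  then show "expectation g \<le> l" using l0 by simp
qed

lemma (in lipschitz_sde) grid_value_measurable:
  assumes "\<tau> \<in> borel_measurable M" "0 < n"
  shows "(\<lambda>\<omega>. X (grid_time S n (\<tau> \<omega>)) \<omega>) \<in> borel_measurable M"
proof -
  have "X (S / real n * real (min n i)) \<in> borel_measurable M" for i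
    using S_pos assms(2) by (intro X_measurable) (auto simp: field_simps min_def)
  moreover have "(\<lambda>\<omega>. nat \<lceil>\<tau> \<omega> / (S / real n)\<rceil>) \<in> measurable M (count_space UNIV)"
    using assms(1) by measurable
  ultimately show ?thesis
    unfolding grid_time_def
    by (rule measurable_compose_countable[where f="\<lambda>i. X (S / real n * real (min n i))"])
qed

text \<open>Stopping times refer to the filtration of the process, whereas noise increments are
  independent of \<open>F\<close>. The process is adapted to \<open>F\<close> only before the
  terminal time, whence the restriction on \<open>s\<close>.\<close>

lemma natural_filtration_subset:
  assumes bridge: "bridge_solution r p t z M F W Z" and s: "s < 1 - t"
  shows "sets (natural_filtration M (\<lambda>s. Z (t + s)) s) \<subseteq> sets (F s)"
proof -
  have filt: "filtration (space M) F" using bridge by (simp add: bridge_solution_def brownian_motion_def)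
  have "(\<Union>u\<in>{0..s}. {Z (t + u) -` A \<inter> space M | A. A \<in> sets borel}) \<subseteq> sets (F s)"
  proof safe
    fix u and A :: "real set" assume u: "u \<in> {0..s}" and A: "A \<in> sets borel"
    then have "Z (t + u) \<in> borel_measurable (F u)" using bridge s by (auto simp: bridge_solution_def)
    from measurable_sets[OF this A] have "Z (t + u) -` A \<inter> space M \<in> sets (F u)"
      using filt by (simp add: filtration_def)
    moreover have "sets (F u) \<subseteq> sets (F s)" using filt u by (simp add: filtration_def)
    ultimately show "Z (t + u) -` A \<inter> space M \<in> sets (F s)" by blast
  qed
  then have "sigma_sets (space M) (\<Union>u\<in>{0..s}. {Z (t + u) -` A \<inter> space M | A. A \<in> sets borel}) \<subseteq> sets (F s)"
    using sets.sigma_sets_subset[of _ "F s"] filt by (simp add: filtration_def)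
  then show ?thesis
    unfolding natural_filtration_def by (subst sets_measure_of) auto
qed

lemma stopping_time_events:
  assumes bridge: "bridge_solution r p t z M F W Z" and \<tau>: "\<tau> \<in> stopping_times M Z t"
  shows "s < 1 - t \<Longrightarrow> {\<omega>\<in>space M. s < \<tau> \<omega>} \<in> sets (F s)" and "\<tau> \<in> borel_measurable M"
proof -
  let ?N = "natural_filtration M (\<lambda>s. Z (t + s))"
  have st: "stopping_time ?N \<tau>" and range: "\<And>\<omega>. \<omega> \<in> space M \<Longrightarrow> \<tau> \<omega> \<in> {0..1 - t}"
    using \<tau> by (auto simp: stopping_times_def)
  have sp: "space (?N s) = space M" for s
    by (auto simp: natural_filtration_def space_measure_of_conv)
  have FM: "sets (F s) \<subseteq> sets M" for s
    using bridge by (simp add: bridge_solution_def brownian_motion_def)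
  show gt: "{\<omega>\<in>space M. s < \<tau> \<omega>} \<in> sets (F s)" if "s < 1 - t" for s
    using stopping_timeD2[OF st, of s] natural_filtration_subset[OF bridge that]
    by (auto simp: pred_def sp)
  show "\<tau> \<in> borel_measurable M"
    unfolding borel_measurable_iff_greater
  proof
    fix a
    show "{\<omega>\<in>space M. a < \<tau> \<omega>} \<in> sets M"
    proof (cases "a < 1 - t")
      case True
      then show ?thesis using gt FM by blast
    next
      case False
      then have empty: "{\<omega>\<in>space M. a < \<tau> \<omega>} = {}" using range by force
      show ?thesis unfolding empty by (rule sets.empty_sets)
    qed
  qed
qed

text \<open>Each horizon may have its own constant \<open>K\<close>; only the limiting values
  \<open>w 0 z\<close> and \<open>v 0 z\<close> have to be the same for all horizons. The bound by
  \<open>v\<close> makes the stopped value integrable, and \<open>c\<close> keeps the integrands of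
  Fatou's lemma bounded below.\<close>

lemma bridge_stopping_bound:
  assumes bridge: "bridge_solution r p t z M F W Z"
    and r: "0 < r" and p: "0 < p" "p < 1" and t: "0 \<le> t" "t < 1"
    and w: "\<And>S. t + S < 1 \<Longrightarrow> \<exists>K. supersolution (drift r p t) S w \<beta> \<Gamma> K"
    and v: "\<And>S. t + S < 1 \<Longrightarrow> \<exists>K. supersolution (drift r p t) S v \<beta>' \<Gamma>' K"
    and w_ge: "\<And>s x. t + s < 1 \<Longrightarrow> max x c \<le> w s x"
    and v_ge: "\<And>s x. t + s < 1 \<Longrightarrow> \<bar>x\<bar> \<le> v s x"
    and \<tau>: "\<tau> \<in> stopping_times M Z t"
  shows "(\<integral>\<omega>. Z (t + \<tau> \<omega>) \<omega> \<partial>M) \<le> w 0 z"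
proof -
  interpret prob_space M using bridge by (simp add: bridge_solution_def brownian_motion_def)
  have range: "0 \<le> \<tau> \<omega>" "\<tau> \<omega> \<le> 1 - t" if "\<omega> \<in> space M" for \<omega>
    using \<tau> that by (auto simp: stopping_times_def)
  note ev = stopping_time_events[OF bridge \<tau>]
  \<comment> \<open>With 2 in the denominator even the first horizon is positive.\<close>
  define S where "S m = (1 - t) * (1 - 1 / (real m + 2))" for m :: nat
  have S: "0 < S m" "t + S m < 1" for m
  proof -
    show "0 < S m" using t by (simp add: S_def)
    have "S m < (1 - t) * 1" unfolding S_def using t by (intro mult_strict_left_mono) auto
    then show "t + S m < 1" by simp
  qed
  have S_lim: "S \<longlonglongrightarrow> 1 - t"
  proof -
    have "(\<lambda>m. 1 / (real m + 2)) \<longlonglongrightarrow> 0" by real_asymp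
    then have "(\<lambda>m. (1 - t) * (1 - 1 / (real m + 2))) \<longlonglongrightarrow> (1 - t) * (1 - 0)"
      by (intro tendsto_intros)
    then show ?thesis by (simp add: S_def[abs_def])
  qed
  \<comment> \<open>The constant of \<open>optional_stopping_grid\<close> depends on the horizon, so
    \<open>n\<close> is chosen after \<open>m\<close>; the condition \<open>m + 1 <= n\<close> makes
    the mesh at most \<open>1 / (m + 1)\<close>.\<close>
  define good where "good m n \<longleftrightarrow> 0 < n \<and> real m + 1 \<le> real n \<and>
      (\<lambda>\<omega>. Z (t + grid_time (S m) n (\<tau> \<omega>)) \<omega>) \<in> borel_measurable M \<and>
      integrable M (\<lambda>\<omega>. w (grid_time (S m) n (\<tau> \<omega>)) (Z (t + grid_time (S m) n (\<tau> \<omega>)) \<omega>)) \<and>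
      expectation (\<lambda>\<omega>. w (grid_time (S m) n (\<tau> \<omega>)) (Z (t + grid_time (S m) n (\<tau> \<omega>)) \<omega>))
        \<le> w 0 z + 1 / (real m + 1) \<and>
      integrable M (\<lambda>\<omega>. v (grid_time (S m) n (\<tau> \<omega>)) (Z (t + grid_time (S m) n (\<tau> \<omega>)) \<omega>)) \<and>
      expectation (\<lambda>\<omega>. v (grid_time (S m) n (\<tau> \<omega>)) (Z (t + grid_time (S m) n (\<tau> \<omega>)) \<omega>))
        \<le> v 0 z + 1 / (real m + 1)" for m n
  have "\<exists>n. good m n" for m
  proof -
    obtain L where "lipschitz_sde M F W (\<lambda>s. Z (t + s)) (drift r p t) (S m) L z"
      by (rule bridge_solution_lipschitz_sde[OF bridge r p S])
    then interpret X: lipschitz_sde M F W "\<lambda>s. Z (t + s)" "drift r p t" "S m" L z .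
    have ev': "{\<omega>\<in>space M. s < \<tau> \<omega>} \<in> sets (F s)" if "s \<in> {0..<S m}" for s
      using ev(1)[of s] S[of m] that by simp
    obtain K where K: "supersolution (drift r p t) (S m) w \<beta> \<Gamma> K" using w[OF S(2)] by blast
    obtain C where C: "0 \<le> C"
      "\<And>n. 0 < n \<Longrightarrow> integrable M (\<lambda>\<omega>. w (grid_time (S m) n (\<tau> \<omega>)) (Z (t + grid_time (S m) n (\<tau> \<omega>)) \<omega>))"
      "\<And>n. 0 < n \<Longrightarrow> expectation (\<lambda>\<omega>. w (grid_time (S m) n (\<tau> \<omega>)) (Z (t + grid_time (S m) n (\<tau> \<omega>)) \<omega>))
        \<le> w 0 z + C / sqrt n"
      by (rule X.optional_stopping_grid[OF K]) (use range(1) ev' in blast)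
    obtain K' where K': "supersolution (drift r p t) (S m) v \<beta>' \<Gamma>' K'" using v[OF S(2)] by blast
    obtain C' where C': "0 \<le> C'"
      "\<And>n. 0 < n \<Longrightarrow> integrable M (\<lambda>\<omega>. v (grid_time (S m) n (\<tau> \<omega>)) (Z (t + grid_time (S m) n (\<tau> \<omega>)) \<omega>))"
      "\<And>n. 0 < n \<Longrightarrow> expectation (\<lambda>\<omega>. v (grid_time (S m) n (\<tau> \<omega>)) (Z (t + grid_time (S m) n (\<tau> \<omega>)) \<omega>))
        \<le> v 0 z + C' / sqrt n"
      by (rule X.optional_stopping_grid[OF K']) (use range(1) ev' in blast)
    have small: "\<forall>\<^sub>F n in sequentially. D / sqrt (real n) < 1 / (real m + 1)" for D
    proof (rule order_tendstoD)
      show "(\<lambda>n. D / sqrt (real n)) \<longlonglongrightarrow> 0" by real_asymp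
    qed simp
    have "\<forall>\<^sub>F n in sequentially. D / sqrt (real n) < 1 / (real m + 1) \<and>
        D' / sqrt (real n) < 1 / (real m + 1) \<and> Suc m \<le> n" for D D'
      using small[of D] small[of D'] eventually_ge_at_top[of "Suc m"] by eventually_elim auto
    from eventually_happens'[OF sequentially_bot this[of C C']]
    obtain n where n: "C / sqrt (real n) < 1 / (real m + 1)" "C' / sqrt (real n) < 1 / (real m + 1)" "Suc m \<le> n"
      by blast
    then have n': "0 < n" "real m + 1 \<le> real n" by auto
    show ?thesis
      unfolding good_def
    proof (intro exI[of _ n] conjI n' C(2) C'(2) X.grid_value_measurable ev(2))
      show "expectation (\<lambda>\<omega>. w (grid_time (S m) n (\<tau> \<omega>)) (Z (t + grid_time (S m) n (\<tau> \<omega>)) \<omega>))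
          \<le> w 0 z + 1 / (real m + 1)"
        using C(3)[OF n'(1)] n(1) by linarith
      show "expectation (\<lambda>\<omega>. v (grid_time (S m) n (\<tau> \<omega>)) (Z (t + grid_time (S m) n (\<tau> \<omega>)) \<omega>))
          \<le> v 0 z + 1 / (real m + 1)"
        using C'(3)[OF n'(1)] n(2) by linarith
    qed
  qed
  then obtain n where "\<And>m. good m (n m)" by metis
  then have n: "\<And>m. 0 < n m" "\<And>m. real m + 1 \<le> real (n m)"
    and meas: "\<And>m. (\<lambda>\<omega>. Z (t + grid_time (S m) (n m) (\<tau> \<omega>)) \<omega>) \<in> borel_measurable M"
    and wi: "\<And>m. integrable M (\<lambda>\<omega>. w (grid_time (S m) (n m) (\<tau> \<omega>)) (Z (t + grid_time (S m) (n m) (\<tau> \<omega>)) \<omega>))"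
    and we: "\<And>m. expectation (\<lambda>\<omega>. w (grid_time (S m) (n m) (\<tau> \<omega>)) (Z (t + grid_time (S m) (n m) (\<tau> \<omega>)) \<omega>))
        \<le> w 0 z + 1 / (real m + 1)"
    and vi: "\<And>m. integrable M (\<lambda>\<omega>. v (grid_time (S m) (n m) (\<tau> \<omega>)) (Z (t + grid_time (S m) (n m) (\<tau> \<omega>)) \<omega>))"
    and ve: "\<And>m. expectation (\<lambda>\<omega>. v (grid_time (S m) (n m) (\<tau> \<omega>)) (Z (t + grid_time (S m) (n m) (\<tau> \<omega>)) \<omega>))
        \<le> v 0 z + 1 / (real m + 1)"
    unfolding good_def by blast+
  define \<sigma> where "\<sigma> m \<omega> = grid_time (S m) (n m) (\<tau> \<omega>)" for m \<omega>
  define Y where "Y m \<omega> = Z (t + \<sigma> m \<omega>) \<omega>" for m \<omega>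
  define V where "V \<omega> = Z (t + \<tau> \<omega>) \<omega>" for \<omega>
  have \<sigma>_range: "0 \<le> \<sigma> m \<omega>" "t + \<sigma> m \<omega> < 1" if "\<omega> \<in> space M" for m \<omega>
    using grid_time_bounds(1,2)[OF S(1) n(1) range(1)[OF that], of m m] S(2)[of m]
    by (auto simp: \<sigma>_def)
  have \<sigma>_lim: "(\<lambda>m. \<sigma> m \<omega>) \<longlonglongrightarrow> \<tau> \<omega>" if \<omega>: "\<omega> \<in> space M" for \<omega>
  proof -
    have "(\<lambda>m. min (\<tau> \<omega>) (S m)) \<longlonglongrightarrow> min (\<tau> \<omega>) (1 - t)" by (intro tendsto_intros S_lim)
    then have 1: "(\<lambda>m. min (\<tau> \<omega>) (S m)) \<longlonglongrightarrow> \<tau> \<omega>" using range(2)[OF \<omega>] by (simp add: min_absorb1)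
    have 2: "(\<lambda>m. \<sigma> m \<omega> - min (\<tau> \<omega>) (S m)) \<longlonglongrightarrow> 0"
    proof (rule Lim_null_comparison[OF always_eventually], intro allI)
      fix m
      have "\<bar>\<sigma> m \<omega> - min (\<tau> \<omega>) (S m)\<bar> \<le> S m / real (n m)"
        using grid_time_bounds(3)[OF S(1) n(1) range(1)[OF \<omega>], of m m] by (simp add: \<sigma>_def)
      also have "\<dots> \<le> 1 / (real m + 1)"
        using S[of m] t n(2)[of m] by (intro frac_le) auto
      finally show "norm (\<sigma> m \<omega> - min (\<tau> \<omega>) (S m)) \<le> 1 / (real m + 1)" by simp
      show "(\<lambda>m. 1 / (real m + 1)) \<longlonglongrightarrow> 0" by real_asymp
    qed
    from tendsto_add[OF 1 2] show ?thesis by simp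
  qed
  have Y_lim1: "(\<lambda>m. Y m \<omega>) \<longlonglongrightarrow> V \<omega>" if \<omega>: "\<omega> \<in> space M" "\<tau> \<omega> < 1 - t" for \<omega>
  proof -
    have "continuous_on {t..<1} (\<lambda>u. Z u \<omega>)" using bridge \<omega> by (simp add: bridge_solution_def)
    then show ?thesis
      unfolding Y_def V_def
      by (rule continuous_on_tendsto_compose)
        (use \<sigma>_range[OF \<omega>(1)] range[OF \<omega>(1)] \<omega>(2) in \<open>auto intro!: tendsto_intros \<sigma>_lim[OF \<omega>(1)]\<close>)
  qed
  have "AE \<omega> in M. ((\<lambda>u. Z u \<omega>) \<longlongrightarrow> Z 1 \<omega>) (at_left 1)"
    using bridge by (simp add: bridge_solution_def)
  then have Y_lim: "AE \<omega> in M. (\<lambda>m. Y m \<omega>) \<longlonglongrightarrow> V \<omega>"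
    using AE_space
  proof eventually_elim
    case (elim \<omega>)
    show ?case
    proof (cases "\<tau> \<omega> < 1 - t")
      case False
      then have 1: "t + \<tau> \<omega> = 1" using range(2)[OF elim(2)] by simp
      \<comment> \<open>The rounded times stay strictly below 1, so the left limit that defines
        \<open>Z 1\<close> is the one approached.\<close>
      have "(\<lambda>m. t + \<sigma> m \<omega>) \<longlonglongrightarrow> 1"
        using tendsto_add[OF tendsto_const \<sigma>_lim[OF elim(2)], of t] by (simp add: 1)
      then have "filterlim (\<lambda>m. t + \<sigma> m \<omega>) (at_left 1) sequentially"
        using \<sigma>_range(2)[OF elim(2)] by (auto simp: filterlim_at less_imp_neq)
      from filterlim_compose[OF elim(1) this] show ?thesis by (simp add: Y_def V_def 1)
    qed (use Y_lim1 elim in auto)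
  qed
  have Y_meas: "Y m \<in> borel_measurable M" for m
    using meas[of m] unfolding Y_def \<sigma>_def .
  \<comment> \<open>Almost sure convergence would not give measurability, as \<open>M\<close> need
    not be complete. Before the terminal time every path converges, and at the terminal time
    \<open>V\<close> is \<open>Z 1\<close>.\<close>
  have V_meas: "V \<in> borel_measurable M"
  proof -
    have "Z 1 \<in> borel_measurable M" using bridge by (simp add: bridge_solution_def)
    then have "(\<lambda>\<omega>. if \<tau> \<omega> < 1 - t then lim (\<lambda>m. Y m \<omega>) else Z 1 \<omega>) \<in> borel_measurable M"
      using Y_meas ev(2) by (intro measurable_If borel_measurable_lim_metric) auto
    moreover have "(if \<tau> \<omega> < 1 - t then lim (\<lambda>m. Y m \<omega>) else Z 1 \<omega>) = V \<omega>" if "\<omega> \<in> space M" for \<omega>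
      using limI[OF Y_lim1[OF that]] range(2)[OF that] by (auto simp: V_def)
    ultimately show ?thesis by (subst measurable_cong[symmetric]) auto
  qed
  have err: "(\<lambda>m. a + 1 / (real m + 1)) \<longlonglongrightarrow> a" for a :: real by real_asymp
  have abs_int: "integrable M (\<lambda>\<omega>. \<bar>V \<omega>\<bar>)"
  proof (rule fatou_expectation_le(1))
    have le: "\<bar>Y m \<omega>\<bar> \<le> v (\<sigma> m \<omega>) (Y m \<omega>)" if "\<omega> \<in> space M" for m \<omega>
      using v_ge \<sigma>_range(2)[OF that] by simp
    show i: "integrable M (\<lambda>\<omega>. \<bar>Y m \<omega>\<bar>)" for m
      by (rule Bochner_Integration.integrable_bound[OF vi[of m, folded \<sigma>_def, folded Y_def]])
        (use Y_meas le in \<open>auto intro!: AE_I2 order_trans[OF _ abs_ge_self]\<close>)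
    show "expectation (\<lambda>\<omega>. \<bar>Y m \<omega>\<bar>) \<le> v 0 z + 1 / (real m + 1)" for m
      by (rule order_trans[OF integral_mono[OF i vi[of m, folded \<sigma>_def, folded Y_def] le]
            ve[of m, folded \<sigma>_def, folded Y_def]])
    show "AE \<omega> in M. (\<lambda>m. \<bar>Y m \<omega>\<bar>) \<longlonglongrightarrow> \<bar>V \<omega>\<bar>"
      using Y_lim by eventually_elim (rule tendsto_rabs)
  qed (use V_meas err in auto)
  then have V_int: "integrable M V" using V_meas integrable_abs_iff by blast
  \<comment> \<open>Truncating at \<open>c\<close> and subtracting it gives nonnegative integrands,
    still dominated by \<open>w - c\<close>.\<close>
  have "integrable M (\<lambda>\<omega>. max (V \<omega>) c - c)" "expectation (\<lambda>\<omega>. max (V \<omega>) c - c) \<le> w 0 z - c"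
  proof -
    have le: "max (Y m \<omega>) c - c \<le> w (\<sigma> m \<omega>) (Y m \<omega>) - c" if "\<omega> \<in> space M" for m \<omega>
      using w_ge \<sigma>_range(2)[OF that] by simp
    note wi' = wi[folded \<sigma>_def, folded Y_def] and we' = we[folded \<sigma>_def, folded Y_def]
    have wi2: "integrable M (\<lambda>\<omega>. w (\<sigma> m \<omega>) (Y m \<omega>) - c)" for m using wi'[of m] by simp
    have i: "integrable M (\<lambda>\<omega>. max (Y m \<omega>) c - c)" for m
      by (rule Bochner_Integration.integrable_bound[OF wi2[of m]])
        (use Y_meas le in \<open>auto intro!: AE_I2 order_trans[OF _ abs_ge_self]\<close>)
    have e: "expectation (\<lambda>\<omega>. max (Y m \<omega>) c - c) \<le> (w 0 z - c) + 1 / (real m + 1)" for m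
    proof -
      have "expectation (\<lambda>\<omega>. max (Y m \<omega>) c - c) \<le> expectation (\<lambda>\<omega>. w (\<sigma> m \<omega>) (Y m \<omega>) - c)"
        by (rule integral_mono[OF i wi2 le])
      also have "\<dots> = expectation (\<lambda>\<omega>. w (\<sigma> m \<omega>) (Y m \<omega>)) - c" using wi'[of m] by (simp add: prob_space)
      finally show ?thesis using we'[of m] by linarith
    qed
    have lim: "AE \<omega> in M. (\<lambda>m. max (Y m \<omega>) c - c) \<longlonglongrightarrow> max (V \<omega>) c - c"
      using Y_lim by eventually_elim (intro tendsto_intros)
    have m: "(\<lambda>\<omega>. max (V \<omega>) c - c) \<in> borel_measurable M" using V_meas by measurable
    show "integrable M (\<lambda>\<omega>. max (V \<omega>) c - c)" "expectation (\<lambda>\<omega>. max (V \<omega>) c - c) \<le> w 0 z - c"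
      by (rule fatou_expectation_le[OF i _ _ m lim e err]; simp)+
  qed
  moreover have "expectation (\<lambda>\<omega>. V \<omega> - c) \<le> expectation (\<lambda>\<omega>. max (V \<omega>) c - c)"
    using V_int calculation by (intro integral_mono) auto
  moreover have "expectation (\<lambda>\<omega>. V \<omega> - c) = expectation V - c" using V_int by (simp add: prob_space)
  ultimately show ?thesis by (simp add: V_def[abs_def])
qed

section \<open>Continuation and stopping near the terminal time\<close>

text \<open>Waiting for a time \<open>u\<close> gains \<open>b * u\<close> to first order with an
  error of at most \<open>C * u * sqrt u\<close>, which is smaller once \<open>u\<close> is
  small.\<close>

lemma value_greater_if_mean_greater:
  assumes bridge: "bridge_solution r p t z M F W Z"
    and r: "0 < r" and p: "0 < p" "p < 1" and t: "0 \<le> t" "t < 1"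
    and mean: "z < post_mean r p t z"
  obtains s where "0 \<le> s" "s \<le> 1 - t" "z < (\<integral>\<omega>. Z (t + s) \<omega> \<partial>M)"
proof -
  define S where "S = (1 - t) / 2"
  have S: "0 < S" "t + S < 1" using t by (auto simp: S_def field_simps)
  obtain L where "lipschitz_sde M F W (\<lambda>s. Z (t + s)) (drift r p t) S L z"
    by (rule bridge_solution_lipschitz_sde[OF bridge r p S])
  then interpret X: lipschitz_sde M F W "\<lambda>s. Z (t + s)" "drift r p t" S L z .
  obtain C where C: "0 \<le> C"
    "\<And>u. 0 < u \<Longrightarrow> u \<le> S \<Longrightarrow> \<bar>X.expectation (Z (t + u)) - z - drift r p t 0 z * u\<bar> \<le> C * (u * sqrt u)"
    by (rule X.expectation_expansion) blast
  define b where "b = drift r p t 0 z"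
  have b: "0 < b" using mean t by (simp add: b_def drift_def)
  \<comment> \<open>This gives \<open>(C + 1) * sqrt u <= b\<close> and hence
    \<open>C * sqrt u < b\<close>, also when \<open>C = 0\<close>.\<close>
  define u where "u = min S ((b / (C + 1))\<^sup>2)"
  have u: "0 < u" "u \<le> S" using S b C by (auto simp: u_def)
  have "sqrt u \<le> sqrt ((b / (C + 1))\<^sup>2)" by (intro real_sqrt_le_mono) (simp add: u_def)
  also have "\<dots> = b / (C + 1)" using b C by simp
  finally have "(C + 1) * sqrt u \<le> b" using C by (simp add: field_simps)
  then have "C * sqrt u < b" using u by (simp add: distrib_right) (meson less_add_same_cancel1 less_le_trans real_sqrt_gt_zero add_strict_increasing)
  then have "C * (u * sqrt u) < b * u" using u by (simp add: mult.left_commute mult.commute)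
  with C(2)[OF u] have "z < X.expectation (Z (t + u))" unfolding b_def[symmetric] by linarith
  then show ?thesis using that[of u] u S by simp
qed

lemma const_stopping_time:
  assumes "0 \<le> s" "s \<le> 1 - t"
  shows "(\<lambda>_. s) \<in> stopping_times M Z t"
  using assms by (auto simp: stopping_times_def intro!: stopping_timeI)

text \<open>The distance from \<open>r\<close> to the posterior mean is \<open>2 * r\<close> times
  the weight of \<open>- r\<close>, which is below \<open>1 / (\<rho> * y)\<close> because
  \<open>y < exp y\<close>. With \<open>1 - t < \<rho> * \<epsilon>^2\<close> and
  \<open>\<epsilon> < z\<close> this is less than \<open>\<epsilon> / (2 * r)\<close>; hence the
  threshold for \<open>t\<close>.\<close>

lemma post_mean_near_terminal:
  assumes r: "0 < r" and p: "0 < p" "p < 1" and \<epsilon>: "0 < \<epsilon>"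
    and t: "1 - p / (1 - p) * \<epsilon>\<^sup>2 < t" "t < 1" and z: "\<epsilon> < z"
  shows "r - \<epsilon> < post_mean r p t z"
proof -
  define \<rho> where "\<rho> = p / (1 - p)"
  have \<rho>: "0 < \<rho>" using p by (simp add: \<rho>_def)
  define y where "y = 2 * r * z / (1 - t)"
  have y: "0 < y" using r z \<epsilon> t by (simp add: y_def)
  have "1 - post_weight r p t z = 1 / (\<rho> * exp y + 1)"
  proof -
    have "0 < \<rho> * exp y + 1" using \<rho> by (simp add: add_pos_pos)
    moreover have "post_weight r p t z = \<rho> * exp y / (\<rho> * exp y + 1)"
      by (simp add: post_weight_def \<rho>_def y_def)
    ultimately show ?thesis by (simp add: field_simps)
  qed
  also have "\<dots> < 1 / (\<rho> * y)"
  proof (rule divide_strict_left_mono)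
    have "y < exp y" using exp_ge_add_one_self[of y] by linarith
    then have "\<rho> * y < \<rho> * exp y" using \<rho> by simp
    then show "\<rho> * y < \<rho> * exp y + 1" by simp
  qed (use \<rho> y in \<open>auto intro!: mult_pos_pos add_pos_pos\<close>)
  also have "\<dots> = (1 - t) / (\<rho> * (2 * r * z))" by (simp add: y_def)
  also have "\<dots> \<le> (\<rho> * \<epsilon>\<^sup>2) / (\<rho> * (2 * r * \<epsilon>))"
    using t z r \<rho> \<epsilon> by (intro frac_le) (auto simp: \<rho>_def[symmetric])
  also have "\<dots> = \<epsilon> / (2 * r)" using \<rho> r \<epsilon> by (simp add: power2_eq_square field_simps)
  finally have "2 * r * (1 - post_weight r p t z) < \<epsilon>" using r by (simp add: field_simps)
  then show ?thesis by (simp add: post_mean_eq[OF p] algebra_simps)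
qed

lemma negative_point_stopped:
  fixes M :: "real \<Rightarrow> real \<Rightarrow> 'a measure"
  assumes bridge: "bridge_solution r p t z (M t z) F W (Z t z)"
    and barrier: "bridge_barrier r p t z k \<kappa> \<Gamma>"
  shows "(t, z) \<in> stopping_region M Z"
proof -
  interpret bridge_barrier r p t z k \<kappa> \<Gamma> by (rule barrier)
  have "(\<integral>\<omega>. Z t z (t + \<tau> \<omega>) \<omega> \<partial>M t z) \<le> z" if "\<tau> \<in> stopping_times (M t z) (Z t z) t" for \<tau>
  proof -
    have "(\<integral>\<omega>. Z t z (t + \<tau> \<omega>) \<omega> \<partial>M t z) \<le> barrier 0 z"
    proof (rule bridge_stopping_bound[where w=barrier and v=outer and c="- r",
          OF bridge r p t _ _ _ _ that])
      show "\<exists>K. supersolution (drift r p t) S barrier barrier_slope \<Gamma> K" if "t + S < 1" for S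
        by (rule barrier_supersolution[OF that]) blast
      show "\<exists>K. supersolution (drift r p t) S outer outer_slope \<Gamma> K" if "t + S < 1" for S
        using outer_supersolution[OF that] by blast
    qed (fact barrier_ge, fact outer_ge)
    then show ?thesis by (simp add: barrier_start)
  qed
  then have "value_function M Z t z \<le> ereal z"
    unfolding value_function_def by (intro SUP_least) simp
  then show ?thesis using t by (auto simp: stopping_region_def continuation_region_def)
qed

lemma barrier_exists:
  assumes r: "0 < r" and p: "0 < p" "p < 1" and z: "- r < z" "z < 0" and \<epsilon>: "0 < \<epsilon>"
  obtains t k \<kappa> \<Gamma> where "1 - \<epsilon> \<le> t" "t < 1" "bridge_barrier r p t z k \<kappa> \<Gamma>"
proof -
  define k where "k = 2 / (r + z)"
  define \<kappa> where "\<kappa> = 2 + (2 * r + 2) / (z / 2)\<^sup>2"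
  define \<Gamma> where "\<Gamma> = k + 2 * \<kappa>"
  have \<Gamma>: "0 < \<Gamma>" using r z by (auto simp: \<Gamma>_def k_def \<kappa>_def intro!: add_pos_pos)
  define c where "c = 8 * r * (p / (1 - p))"
  have c: "0 < c" using r p by (simp add: c_def)
  \<comment> \<open>The entries ensure, in this order, \<open>0 <= t\<close>,
    \<open>1 - \<epsilon> <= t\<close> and the three conditions in \<open>small\<close>, for
    \<open>t = 1 - T\<close>.\<close>
  define T where "T = Min {1, \<epsilon>, (r + z) / 2 / \<Gamma>, 2 / \<Gamma>, \<Gamma> * (r * z)\<^sup>2 / c}"
  have T: "0 < T" using z r \<Gamma> c \<epsilon> by (simp add: T_def)
  have T_le: "T \<le> 1" "T \<le> \<epsilon>" "T \<le> (r + z) / 2 / \<Gamma>" "T \<le> 2 / \<Gamma>" "T \<le> \<Gamma> * (r * z)\<^sup>2 / c"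
    unfolding T_def by (intro Min_le; simp)+
  have "bridge_barrier r p (1 - T) z k \<kappa> \<Gamma>"
  proof
    show "\<Gamma> * (1 - (1 - T)) \<le> (r + z) / 2" using T_le(3) \<Gamma> by (simp add: field_simps)
    show "\<Gamma> * (1 - (1 - T)) \<le> 2" using T_le(4) \<Gamma> by (simp add: field_simps)
    show "8 * r * (p / (1 - p)) * (1 - (1 - T)) \<le> \<Gamma> * (r * z)\<^sup>2"
      unfolding c_def[symmetric] using T_le(5) c by (simp add: pos_le_divide_eq mult.commute)
  qed (use r p z T T_le in \<open>auto simp: k_def \<kappa>_def \<Gamma>_def\<close>)
  then show ?thesis using that[of "1 - T"] T T_le(2) by simp
qed

theorem proposition4p5:
  fixes r p :: real
    and M :: "real \<Rightarrow> real \<Rightarrow> 'a measure"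
    and F :: "real \<Rightarrow> real \<Rightarrow> real \<Rightarrow> 'a measure"
    and W Z :: "real \<Rightarrow> real \<Rightarrow> real \<Rightarrow> 'a \<Rightarrow> real"
  assumes "r > 0" and "p \<in> {0<..<1}"
    and "\<And>t z. t \<in> {0..<1} \<Longrightarrow> bridge_solution r p t z (M t z) (F t z) (W t z) (Z t z)"
  shows "(\<forall>\<epsilon>>0. \<exists>\<delta>>0. {1 - \<delta><..<1} \<times> {\<epsilon><..<r - \<epsilon>} \<subseteq> continuation_region M Z) \<and>
         (\<forall>z\<in>{-r<..<0}. \<forall>\<epsilon>>0.
            ({1 - \<epsilon>..<1} \<times> {z - \<epsilon><..<z + \<epsilon>}) \<inter> stopping_region M Z \<noteq> {})"
proof (intro conjI allI impI ballI)
  have p: "0 < p" "p < 1" using assms(2) by auto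
  fix \<epsilon> :: real assume \<epsilon>: "0 < \<epsilon>"
  \<comment> \<open>The bound by 1 keeps the starting times nonnegative; the other entry is the
    threshold of \<open>post_mean_near_terminal\<close>.\<close>
  define \<delta> where "\<delta> = min 1 (p / (1 - p) * \<epsilon>\<^sup>2)"
  have "{1 - \<delta><..<1} \<times> {\<epsilon><..<r - \<epsilon>} \<subseteq> continuation_region M Z"
  proof clarsimp
    fix t z assume t: "1 - \<delta> < t" "t < 1" and z: "\<epsilon> < z" "z < r - \<epsilon>"
    have t0: "0 \<le> t" using t by (simp add: \<delta>_def)
    note bridge = assms(3)[of t z, simplified, OF conjI, OF t0 t(2)]
    have "z < post_mean r p t z"
    proof -
      have "\<delta> \<le> p / (1 - p) * \<epsilon>\<^sup>2" by (simp add: \<delta>_def)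
      then have "1 - p / (1 - p) * \<epsilon>\<^sup>2 < t" using t(1) by linarith
      from post_mean_near_terminal[OF assms(1) p \<epsilon> this t(2) z(1)] z(2) show ?thesis by simp
    qed
    then obtain s where s: "0 \<le> s" "s \<le> 1 - t" "z < (\<integral>\<omega>. Z t z (t + s) \<omega> \<partial>M t z)"
      using value_greater_if_mean_greater[OF bridge assms(1) p t0 t(2)] by blast
    have "ereal z < ereal (\<integral>\<omega>. Z t z (t + s) \<omega> \<partial>M t z)" using s by simp
    also have "\<dots> \<le> value_function M Z t z"
      unfolding value_function_def by (rule SUP_upper2[OF const_stopping_time[OF s(1,2)]]) simp
    finally show "(t, z) \<in> continuation_region M Z" using t0 t by (simp add: continuation_region_def)
  qed
  moreover have "0 < \<delta>" using \<epsilon> p by (simp add: \<delta>_def)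
  ultimately show "\<exists>\<delta>>0. {1 - \<delta><..<1} \<times> {\<epsilon><..<r - \<epsilon>} \<subseteq> continuation_region M Z" by blast
next
  have p: "0 < p" "p < 1" using assms(2) by auto
  fix z \<epsilon> :: real assume z: "z \<in> {- r<..<0}" and \<epsilon>: "0 < \<epsilon>"
  have z': "- r < z" "z < 0" using z by auto
  obtain t k \<kappa> \<Gamma> where t: "1 - \<epsilon> \<le> t" "t < 1" and B: "bridge_barrier r p t z k \<kappa> \<Gamma>"
    by (rule barrier_exists[OF assms(1) p z' \<epsilon>])
  have "t \<in> {0..<1}" using B by (simp add: bridge_barrier_def)
  from negative_point_stopped[where M=M and Z=Z and t=t and z=z, OF assms(3)[OF this] B]
  have "(t, z) \<in> ({1 - \<epsilon>..<1} \<times> {z - \<epsilon><..<z + \<epsilon>}) \<inter> stopping_region M Z"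
    using t \<epsilon> by simp
  then show "({1 - \<epsilon>..<1} \<times> {z - \<epsilon><..<z + \<epsilon>}) \<inter> stopping_region M Z \<noteq> {}" by blast
qed

end
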